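(* The group $$G_W=\langle a,b,c,d,s,t\mid c=ab,\ c=ba,\ d=c^2,\ s^{-1}as=d,\ t^{-1}bt=d\rangle$$ is almost convex with respect to the generating set $\{a,b,c,d,s,t\}$, and $G_W$ is non-Hopfian.
   Context: Almost convex: a group $G$ with finite generating set $X$ is almost convex (with respect to $X$) if there is a constant $C>0$ such that for every $N$ and every pair of elements $g,g'$ in the metric sphere of radius $N$ about the identity in the Cayley graph $\Gamma(G,X)$ (path metric, each edge of length 1) with $d(g,g')\le 2$, there is a path of length at most $C$ from $g$ to $g'$ which runs inside the metric ball of radius $N$ about the identity. A group is non-Hopfian if it admits a surjective endomorphism that is not injective. *)

theory Defs
  imports Complex_Main "HOL-Algebra.Generated_Groups"
begin

section \<open>Groups given by generators and relations\<close>

text \<open>A letter is a pair of a generator and a sign; \<^term>\<open>(x, False)\<close> stands for the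
  formal inverse of \<^term>\<open>x\<close>. Elements of the presented group are the classes of words
  modulo the least congruence containing free cancellation and the given relations
  \<open>l = r\<close>.\<close>

type_synonym 'g word = "('g \<times> bool) list"

abbreviation pos :: "'g \<Rightarrow> 'g \<times> bool" where "pos x \<equiv> (x, True)"
abbreviation neg :: "'g \<Rightarrow> 'g \<times> bool" where "neg x \<equiv> (x, False)"

inductive pres_eq :: "('g word \<times> 'g word) set \<Rightarrow> 'g word \<Rightarrow> 'g word \<Rightarrow> bool"
  for R :: "('g word \<times> 'g word) set" where
  refl: "pres_eq R u u"
| sym: "pres_eq R u v \<Longrightarrow> pres_eq R v u"
| trans: "pres_eq R u v \<Longrightarrow> pres_eq R v w \<Longrightarrow> pres_eq R u w"
| append: "pres_eq R u u' \<Longrightarrow> pres_eq R v v' \<Longrightarrow> pres_eq R (u @ v) (u' @ v')"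
| cancel: "pres_eq R [(x, e), (x, \<not> e)] []"
| relation: "(l, r) \<in> R \<Longrightarrow> pres_eq R l r"

definition pres_class :: "('g word \<times> 'g word) set \<Rightarrow> 'g word \<Rightarrow> 'g word set" where
  "pres_class R u = {v. pres_eq R u v}"

definition presented_group :: "('g word \<times> 'g word) set \<Rightarrow> 'g word set monoid" where
  "presented_group R =
     \<lparr>carrier = range (pres_class R),
      monoid.mult = (\<lambda>P Q. {w. \<exists>u\<in>P. \<exists>v\<in>Q. pres_eq R (u @ v) w}),
      monoid.one = pres_class R []\<rparr>"

lemma pres_class_eq_iff: "pres_class R u = pres_class R v \<longleftrightarrow> pres_eq R u v"
  unfolding pres_class_def
  by (auto intro: pres_eq.refl pres_eq.sym pres_eq.trans)

lemma pres_class_mult: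
  "pres_class R u \<otimes>\<^bsub>presented_group R\<^esub> pres_class R v = pres_class R (u @ v)"
  unfolding presented_group_def pres_class_def
  by (auto intro: pres_eq.refl pres_eq.append pres_eq.trans)

lemma pres_inverse: "\<exists>v. pres_eq R (v @ u) []"
proof (induction u)
  case Nil
  show ?case by (auto intro: pres_eq.refl)
next
  case (Cons a u)
  then obtain v where v: "pres_eq R (v @ u) []" by blast
  obtain x e where a: "a = (x, e)" by (cases a)
  have "pres_eq R [(x, \<not> e), (x, e)] []"
    using pres_eq.cancel[of R x "\<not> e"] by simp
  then have "pres_eq R ([(x, \<not> e), (x, e)] @ u) ([] @ u)"
    by (rule pres_eq.append[OF _ pres_eq.refl])
  then have "pres_eq R (v @ ([(x, \<not> e), (x, e)] @ u)) (v @ ([] @ u))"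
    by (rule pres_eq.append[OF pres_eq.refl])
  then have "pres_eq R ((v @ [(x, \<not> e)]) @ (a # u)) []"
    using v a by (auto intro: pres_eq.trans)
  then show ?case by blast
qed

lemma group_presented_group: "group (presented_group R)"
proof (rule groupI)
  have car: "carrier (presented_group R) = range (pres_class R)"
    and one: "\<one>\<^bsub>presented_group R\<^esub> = pres_class R []"
    by (simp_all add: presented_group_def)
  show "\<one>\<^bsub>presented_group R\<^esub> \<in> carrier (presented_group R)"
    by (simp add: car one)
  show "P \<otimes>\<^bsub>presented_group R\<^esub> Q \<in> carrier (presented_group R)"
    if "P \<in> carrier (presented_group R)" "Q \<in> carrier (presented_group R)" for P Q
    using that by (auto simp: car pres_class_mult)
  show "P \<otimes>\<^bsub>presented_group R\<^esub> Q \<otimes>\<^bsub>presented_group R\<^esub> T =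
        P \<otimes>\<^bsub>presented_group R\<^esub> (Q \<otimes>\<^bsub>presented_group R\<^esub> T)"
    if "P \<in> carrier (presented_group R)" "Q \<in> carrier (presented_group R)"
       "T \<in> carrier (presented_group R)" for P Q T
    using that by (auto simp: car pres_class_mult)
  show "\<one>\<^bsub>presented_group R\<^esub> \<otimes>\<^bsub>presented_group R\<^esub> P = P"
    if "P \<in> carrier (presented_group R)" for P
    using that by (auto simp: car one pres_class_mult)
  show "\<exists>Q\<in>carrier (presented_group R). Q \<otimes>\<^bsub>presented_group R\<^esub> P = \<one>\<^bsub>presented_group R\<^esub>"
    if "P \<in> carrier (presented_group R)" for P
    using that pres_inverse by (fastforce simp: car one pres_class_mult pres_class_eq_iff)
qed


section \<open>Cayley graphs and almost convexity\<close>

definition cayley_adj :: "('a, 'b) monoid_scheme \<Rightarrow> 'a set \<Rightarrow> 'a \<Rightarrow> 'a \<Rightarrow> bool" where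
  "cayley_adj G S g h \<longleftrightarrow>
     g \<in> carrier G \<and> h \<in> carrier G \<and> (\<exists>x\<in>S. h = g \<otimes>\<^bsub>G\<^esub> x \<or> g = h \<otimes>\<^bsub>G\<^esub> x)"

text \<open>An edge path is given by its list of vertices, so its length is one less than the
  length of the list.\<close>

definition cayley_path ::
  "('a, 'b) monoid_scheme \<Rightarrow> 'a set \<Rightarrow> 'a \<Rightarrow> 'a \<Rightarrow> 'a list \<Rightarrow> bool" where
  "cayley_path G S g h p \<longleftrightarrow>
     p \<noteq> [] \<and> hd p = g \<and> last p = h \<and> set p \<subseteq> carrier G \<and> successively (cayley_adj G S) p"

definition cayley_dist :: "('a, 'b) monoid_scheme \<Rightarrow> 'a set \<Rightarrow> 'a \<Rightarrow> 'a \<Rightarrow> nat" where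
  "cayley_dist G S g h = (LEAST n. \<exists>p. cayley_path G S g h p \<and> length p = Suc n)"

definition cayley_sphere :: "('a, 'b) monoid_scheme \<Rightarrow> 'a set \<Rightarrow> nat \<Rightarrow> 'a set" where
  "cayley_sphere G S N = {g \<in> carrier G. cayley_dist G S \<one>\<^bsub>G\<^esub> g = N}"

text \<open>The ball is a ball in the path metric of the Cayley graph with edges of length 1, so a
  path runs inside it only if the interior points of its edges do too. The point at parameter
  \<open>r\<close> of an edge from \<open>u\<close> to \<open>v\<close> is reached from the identity through \<open>u\<close> or through \<open>v\<close>,
  which gives the minimum below. In particular, an edge joining two vertices of the sphere of
  radius \<open>N\<close> leaves the ball of radius \<open>N\<close>.\<close>

definition edge_in_ball :: "('a, 'b) monoid_scheme \<Rightarrow> 'a set \<Rightarrow> nat \<Rightarrow> 'a \<Rightarrow> 'a \<Rightarrow> bool" where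
  "edge_in_ball G S N u v \<longleftrightarrow>
     (\<forall>r\<in>{0..1::real}.
        min (real (cayley_dist G S \<one>\<^bsub>G\<^esub> u) + r) (real (cayley_dist G S \<one>\<^bsub>G\<^esub> v) + (1 - r)) \<le> real N)"

definition path_in_ball :: "('a, 'b) monoid_scheme \<Rightarrow> 'a set \<Rightarrow> nat \<Rightarrow> 'a list \<Rightarrow> bool" where
  "path_in_ball G S N p \<longleftrightarrow>
     (\<forall>v\<in>set p. cayley_dist G S \<one>\<^bsub>G\<^esub> v \<le> N) \<and> successively (edge_in_ball G S N) p"

definition almost_convex :: "('a, 'b) monoid_scheme \<Rightarrow> 'a set \<Rightarrow> bool" where
  "almost_convex G S \<longleftrightarrow>
     group G \<and> finite S \<and> S \<subseteq> carrier G \<and> generate G S = carrier G \<and>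
     (\<exists>C::real. C > 0 \<and>
        (\<forall>N. \<forall>g\<in>cayley_sphere G S N. \<forall>g'\<in>cayley_sphere G S N.
           cayley_dist G S g g' \<le> 2 \<longrightarrow>
             (\<exists>p. cayley_path G S g g' p \<and> path_in_ball G S N p \<and> real (length p - 1) \<le> C)))"


section \<open>Non-Hopfian groups\<close>

definition non_Hopfian :: "('a, 'b) monoid_scheme \<Rightarrow> bool" where
  "non_Hopfian G \<longleftrightarrow>
     group G \<and> (\<exists>\<phi>\<in>epi G G. \<not> inj_on \<phi> (carrier G))"


section \<open>The group \<open>G\<^sub>W\<close>\<close>

datatype wgen = ga | gb | gc | gd | gs | gt

definition wise_relations :: "(wgen word \<times> wgen word) set" where
  "wise_relations =
     {([pos gc], [pos ga, pos gb]),
      ([pos gc], [pos gb, pos ga]),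
      ([pos gd], [pos gc, pos gc]),
      ([neg gs, pos ga, pos gs], [pos gd]),
      ([neg gt, pos gb, pos gt], [pos gd])}"

definition G_W :: "wgen word set monoid" where
  "G_W = presented_group wise_relations"

definition wise_elt :: "wgen \<Rightarrow> wgen word set" where
  "wise_elt x = pres_class wise_relations [pos x]"

end

theory Submission
  imports Defs
begin

text \<open>The group is a double HNN extension of the free abelian group on \<open>a\<close>, \<open>b\<close>, so its Cayley graph is
  a tree of copies of the Cayley graph of that group with the generators \<open>a\<close>, \<open>b\<close>, \<open>c\<close>, \<open>d\<close>, glued along
  strips whose two sides are lines in the directions \<open>a\<close>, \<open>b\<close>, \<open>d\<close>. These lines are isometrically embedded,
  so in each copy the distance \<open>F\<close> to the identity is \<open>F v = min n. f n + nrm (v - n * l)\<close>, where \<open>l\<close> is the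
  direction of the line through which the copy is entered and \<open>f\<close> is the distance along that line.

  A pair of points at distance at most 2 on a sphere is handled through horizontal edges and peaks.
  In a single copy these can be bypassed by short paths as soon as \<open>f\<close> has no high bumps; only bumps with
  respect to the slope 1/2 matter. An approximate convexity at all dyadic
  scales, \<open>f (z + r) + f (z + K) \<le> f z + f (z + r + K) + 1\<close> for \<open>K = 2 ^ j\<close> and \<open>r \<ge> 0\<close>, excludes them and
  passes from one copy to the next. If the edge lies on the entry line it is pushed
  through the strip into the parent copy, which can happen at most twice in a row.

  The surjective endomorphism \<open>a \<mapsto> a\<^sup>2\<close>, \<open>b \<mapsto> b\<^sup>2\<close>, \<open>s \<mapsto> s\<close>, \<open>t \<mapsto> t\<close> kills the commutator of \<open>s c s\<^sup>-\<^sup>1\<close> and \<open>t c t\<^sup>-\<^sup>1\<close>,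
  whose normal form is not trivial.\<close>

section \<open>The word norm on the rank two abelian subgroup\<close>

text \<open>The convexity property is shaped by error control: its defect 1 must not accumulate
  along a chain of copies. It does not, because only one ingredient pays at a time. If the optimal
  entry points of the two outer points are at least one scale apart, they are exchanged at the cost
  of the defect of \<open>f\<close>, while the norm terms are only translated or shifted by even
  amounts, which is free. Otherwise the entry points stay and only the rounding of the norm costs 1.
  Free shifts need even scales, hence \<open>2 ^ j\<close> with \<open>j \<ge> 1\<close>. Since d is
  twice the diagonal, going from an a-line to a d-line uses scale 2K to get K, and from a d-line to
  an a-line scale K gives 2K, so all scales are carried along. Scale 2 behind a d-line would need
  scale 1 and comes from the slope of the norm instead. Why two pushes suffice: an a-line or b-line
  borders a single strip, so a reduced form never leaves a copy through an entry line of this kind.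
  A d-line borders two strips and can be left through the other one, but a copy entered through a
  d-line was reached by s or t, so the next push arrives at an a-line or b-line.\<close>

text \<open>The six terms are the facets of the hexagon with vertices +-(1,0), +-(0,1), +-(2,2),
  rounded up: \<open>x - y div 2\<close> is the ceiling of x - y/2, \<open>(y + 1) div 2 - x\<close>
  that of y/2 - x. That the rounded maximum is the word length follows from
  \<open>nrm_triangle\<close> and \<open>nrm_descent\<close>.\<close>

definition nrm :: "int \<Rightarrow> int \<Rightarrow> int" where
  "nrm x y = Max {x - y, y - x, x - y div 2, (y + 1) div 2 - x, y - x div 2, (x + 1) div 2 - y}"

lemma nrm_lower:
  "x - y \<le> nrm x y \<and> y - x \<le> nrm x y \<and> x - y div 2 \<le> nrm x y \<and> (y + 1) div 2 - x \<le> nrm x y \<and>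
   y - x div 2 \<le> nrm x y \<and> (x + 1) div 2 - y \<le> nrm x y"
  unfolding nrm_def by (intro conjI; rule Max_ge; simp)

lemma nrm_cases:
  "nrm x y = x - y \<or> nrm x y = y - x \<or> nrm x y = x - y div 2 \<or> nrm x y = (y + 1) div 2 - x \<or>
   nrm x y = y - x div 2 \<or> nrm x y = (x + 1) div 2 - y"
proof -
  have "nrm x y \<in> {x - y, y - x, x - y div 2, (y + 1) div 2 - x, y - x div 2, (x + 1) div 2 - y}"
    unfolding nrm_def by (rule Max_in) auto
  then show ?thesis by blast
qed

lemma nrm_le_iff:
  "nrm x y \<le> k \<longleftrightarrow> x - y \<le> k \<and> y - x \<le> k \<and> x - y div 2 \<le> k \<and> (y + 1) div 2 - x \<le> k \<and>
     y - x div 2 \<le> k \<and> (x + 1) div 2 - y \<le> k"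
  unfolding nrm_def by (subst Max_le_iff) auto

lemma nrm_swap: "nrm y x = nrm x y"
proof -
  have "nrm y x \<le> nrm x y" for x y
    unfolding nrm_le_iff using nrm_lower[of x y] by blast
  then show ?thesis by (simp add: antisym)
qed

lemma nrm_neg: "nrm (-x) (-y) = nrm x y"
proof -
  have le: "nrm x y \<le> nrm (-x) (-y)" for x y
  proof -
    have d: "(1 - x) div 2 = - (x div 2)" "(1 - y) div 2 = - (y div 2)"
      "(- x) div 2 = - ((x + 1) div 2)" "(- y) div 2 = - ((y + 1) div 2)"
      by presburger+
    show ?thesis
      unfolding nrm_le_iff using nrm_lower[of "-x" "-y"] by (simp add: d)
  qed
  show ?thesis using le[of x y] le[of "-x" "-y"] by simp
qed

text \<open>Writing both coordinates as \<open>2 * X + e\<close> with a bit \<open>e\<close> turns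
  every floor in \<open>nrm\<close> into a linear term, so the inequalities below become linear
  integer arithmetic.\<close>

definition is_bit :: "int \<Rightarrow> bool" where "is_bit e \<longleftrightarrow> 0 \<le> e \<and> e \<le> 1"

lemma bit_div: "is_bit e \<Longrightarrow> (2 * x + e) div 2 = x" "is_bit e \<Longrightarrow> (2 * x + e + 1) div 2 = x + e"
  unfolding is_bit_def by presburger+

lemma obtain_bit: obtains X e where "x = 2 * X + e" "is_bit e"
proof
  show "x = 2 * (x div 2) + x mod 2" by simp
  show "is_bit (x mod 2)" by (simp add: is_bit_def)
qed

lemma nrm_lower_bit:
  assumes "is_bit e" "is_bit f"
  shows "2*x+e - (2*y+f) \<le> nrm (2*x+e) (2*y+f) \<and> 2*y+f - (2*x+e) \<le> nrm (2*x+e) (2*y+f) \<and>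
   2*x+e - y \<le> nrm (2*x+e) (2*y+f) \<and> y+f - (2*x+e) \<le> nrm (2*x+e) (2*y+f) \<and>
   2*y+f - x \<le> nrm (2*x+e) (2*y+f) \<and> x+e - (2*y+f) \<le> nrm (2*x+e) (2*y+f)"
  using nrm_lower[of "2*x+e" "2*y+f"] unfolding bit_div[OF assms(1)] bit_div[OF assms(2)] .

lemma nrm_cases_bit:
  assumes "is_bit e" "is_bit f"
  shows "nrm (2*x+e) (2*y+f) = 2*x+e - (2*y+f) \<or> nrm (2*x+e) (2*y+f) = 2*y+f - (2*x+e) \<or>
   nrm (2*x+e) (2*y+f) = 2*x+e - y \<or> nrm (2*x+e) (2*y+f) = y+f - (2*x+e) \<or>
   nrm (2*x+e) (2*y+f) = 2*y+f - x \<or> nrm (2*x+e) (2*y+f) = x+e - (2*y+f)"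
  using nrm_cases[of "2*x+e" "2*y+f"] unfolding bit_div[OF assms(1)] bit_div[OF assms(2)] by assumption

section \<open>Exchange inequalities: moving two vectors towards each other\<close>

text \<open>A translation submodularity of the hexagonal norm along (1,1). An even \<open>al\<close>
  changes each floor by exactly \<open>al div 2\<close>, so no rounding error appears.\<close>

lemma nrm_shift_diag_even:
  assumes "even al" "al \<ge> 0" "x' - x \<ge> al" "y' - y \<ge> al"
  shows "nrm (x + al) (y + al) + nrm (x' - al) (y' - al) \<le> nrm x y + nrm x' y'"
proof -
  obtain k where k: "al = 2 * k" using assms(1) by blast
  obtain X e where x: "x = 2 * X + e" and e: "is_bit e" by (rule obtain_bit)
  obtain Y f where y: "y = 2 * Y + f" and f: "is_bit f" by (rule obtain_bit)
  obtain X' e' where x': "x' = 2 * X' + e'" and e': "is_bit e'" by (rule obtain_bit)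
  obtain Y' f' where y': "y' = 2 * Y' + f'" and f': "is_bit f'" by (rule obtain_bit)
  have sh: "x + al = 2*(X+k)+e" "y + al = 2*(Y+k)+f" "x' - al = 2*(X'-k)+e'" "y' - al = 2*(Y'-k)+f'"
    unfolding x y x' y' k by auto
  define m n m' n' where d: "m = nrm (2*(X+k)+e) (2*(Y+k)+f)" "n = nrm (2*(X'-k)+e') (2*(Y'-k)+f')"
    "m' = nrm (2*X+e) (2*Y+f)" "n' = nrm (2*X'+e') (2*Y'+f')"
  note L = nrm_lower_bit[OF e f, of X Y, folded d] nrm_lower_bit[OF e' f', of X' Y', folded d]
  note C = nrm_cases_bit[OF e f, of "X+k" "Y+k", folded d] nrm_cases_bit[OF e' f', of "X'-k" "Y'-k", folded d]
  have "m + n \<le> m' + n'"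
    using C L assms(2-)[unfolded x y x' y' k] e f e' f' unfolding is_bit_def by (smt (z3))
  then show ?thesis unfolding d sh[symmetric] x[symmetric] y[symmetric] x'[symmetric] y'[symmetric] .
qed

text \<open>Equal parity of \<open>y\<close> and \<open>y'\<close> makes both vectors round alike,
  so again nothing is lost.\<close>

lemma nrm_shift_snd_even:
  assumes "even al" "al \<ge> 0" "even (y' - y)" "y' - y \<ge> al" "(y' - x') - (y - x) \<ge> al"
  shows "nrm x (y + al) + nrm x' (y' - al) \<le> nrm x y + nrm x' y'"
proof -
  obtain k where k: "al = 2 * k" using assms(1) by blast
  obtain X e where x: "x = 2 * X + e" and e: "is_bit e" by (rule obtain_bit)
  obtain Y f where y: "y = 2 * Y + f" and f: "is_bit f" by (rule obtain_bit)
  obtain X' e' where x': "x' = 2 * X' + e'" and e': "is_bit e'" by (rule obtain_bit)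
  obtain j where "y' - y = 2 * j" using assms(3) by blast
  then obtain Y' where y': "y' = 2 * Y' + f" using y by (metis add.assoc add.commute diff_add_cancel distrib_left)
  have sh: "y + al = 2*(Y+k)+f" "y' - al = 2*(Y'-k)+f"
    unfolding y y' k by auto
  define m n m' n' where d: "m = nrm (2*X+e) (2*(Y+k)+f)" "n = nrm (2*X'+e') (2*(Y'-k)+f)"
    "m' = nrm (2*X+e) (2*Y+f)" "n' = nrm (2*X'+e') (2*Y'+f)"
  note L = nrm_lower_bit[OF e f, of X Y, folded d] nrm_lower_bit[OF e' f, of X' Y', folded d]
  note C = nrm_cases_bit[OF e f, of "X" "Y+k", folded d] nrm_cases_bit[OF e' f, of "X'" "Y'-k", folded d]
  have "m + n \<le> m' + n'"
    using C L assms(2,4-)[unfolded x y x' y' k] e f e' unfolding is_bit_def by (smt (z3))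
  then show ?thesis unfolding d sh[symmetric] x[symmetric] y[symmetric] x'[symmetric] y'[symmetric] .
qed

lemma nrm_lower2:
  "2 * (x - y) \<le> 2 * nrm x y \<and> 2 * (y - x) \<le> 2 * nrm x y \<and> 2 * x - y \<le> 2 * nrm x y \<and> y - 2 * x \<le> 2 * nrm x y \<and>
   2 * y - x \<le> 2 * nrm x y \<and> x - 2 * y \<le> 2 * nrm x y"
proof -
  obtain X e where x: "x = 2 * X + e" and e: "is_bit e" by (rule obtain_bit)
  obtain Y f where y: "y = 2 * Y + f" and f: "is_bit f" by (rule obtain_bit)
  show ?thesis
    using nrm_lower_bit[OF e f, of X Y] e f unfolding x y is_bit_def by (smt (z3))
qed

text \<open>Doubling clears the floors: twice the norm exceeds the active doubled facet by at most
  1, and the facets \<open>x - y\<close>, \<open>y - x\<close> are exact. Two such roundings lose at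
  most 2 after doubling, which is the error 1 in the shift lemmas without parity conditions.\<close>

lemma nrm_cases2:
  "2 * nrm x y = 2 * (x - y) \<or> 2 * nrm x y = 2 * (y - x) \<or> 2 * nrm x y \<le> 2 * x - y + 1 \<or>
   2 * nrm x y \<le> y - 2 * x + 1 \<or> 2 * nrm x y \<le> 2 * y - x + 1 \<or> 2 * nrm x y \<le> x - 2 * y + 1"
proof -
  obtain X e where x: "x = 2 * X + e" and e: "is_bit e" by (rule obtain_bit)
  obtain Y f where y: "y = 2 * Y + f" and f: "is_bit f" by (rule obtain_bit)
  show ?thesis
    using nrm_cases_bit[OF e f, of X Y] e f unfolding x y is_bit_def by (smt (z3))
qed

lemma nrm_shift_diag:
  assumes "al \<ge> 0" "x' - x \<ge> al" "y' - y \<ge> al"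
  shows "nrm (x + al) (y + al) + nrm (x' - al) (y' - al) \<le> nrm x y + nrm x' y' + 1"
  using nrm_cases2[of "x+al" "y+al"] nrm_cases2[of "x'-al" "y'-al"] nrm_lower2[of x y] nrm_lower2[of x' y'] assms
  by (smt (z3))

lemma nrm_shift_snd:
  assumes "al \<ge> 0" "y' - y \<ge> al" "(y' - x') - (y - x) \<ge> al"
  shows "nrm x (y + al) + nrm x' (y' - al) \<le> nrm x y + nrm x' y' + 1"
  using nrm_cases2[of "x" "y+al"] nrm_cases2[of "x'" "y'-al"] nrm_lower2[of x y] nrm_lower2[of x' y'] assms
  by (smt (z3))

lemma nrm_shift_fst:
  assumes "al \<ge> 0" "x' - x \<ge> al" "(x' - y') - (x - y) \<ge> al"
  shows "nrm (x + al) y + nrm (x' - al) y' \<le> nrm x y + nrm x' y' + 1"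
  using nrm_shift_snd[OF assms] by (simp add: nrm_swap)

section \<open>Convolutions of functions on a line with the norm\<close>

definition nonexp :: "(int \<Rightarrow> int) \<Rightarrow> bool" where
  "nonexp f \<longleftrightarrow> (\<forall>n. \<bar>f (n + 1) - f n\<bar> \<le> 1)"

text \<open>Equivalently, the increment of \<open>f\<close> over a step of length \<open>K\<close>
  drops by at most 1 when the step is moved to the right. At \<open>K = 2\<close> this forbids a
  rise of slope 1/2 followed by a fall of slope 1/2, whose increments drop from 1 to -1.\<close>

definition tame :: "int \<Rightarrow> (int \<Rightarrow> int) \<Rightarrow> bool" where
  "tame K f \<longleftrightarrow> (\<forall>z r. r \<ge> 0 \<longrightarrow> f (z + r) + f (z + K) \<le> f z + f (z + r + K) + 1)"

text \<open>The minimum over all integers \<open>n\<close>, given by bound and attainment so that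
  one predicate serves for any function \<open>F\<close> that arises.\<close>

definition inf_conv :: "(int \<Rightarrow> int) \<Rightarrow> int \<Rightarrow> int \<Rightarrow> (int \<Rightarrow> int \<Rightarrow> int) \<Rightarrow> bool" where
  "inf_conv f ex ey F \<longleftrightarrow> (\<forall>x y n. F x y \<le> f n + nrm (x - n * ex) (y - n * ey)) \<and>
     (\<forall>x y. \<exists>n. F x y = f n + nrm (x - n * ex) (y - n * ey))"

lemma inf_conv_le: "inf_conv f ex ey F \<Longrightarrow> F x y \<le> f n + nrm (x - n * ex) (y - n * ey)"
  by (simp add: inf_conv_def)

lemma inf_conv_le':
  "inf_conv f ex ey F \<Longrightarrow> u = x - n * ex \<Longrightarrow> v = y - n * ey \<Longrightarrow> F x y \<le> f n + nrm u v"
  by (simp add: inf_conv_def)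

lemma inf_conv_attained:
  assumes "inf_conv f ex ey F"
  obtains n where "F x y = f n + nrm (x - n * ex) (y - n * ey)"
  using assms unfolding inf_conv_def by blast

lemma tameD: "tame K f \<Longrightarrow> z \<le> u \<Longrightarrow> f u + f (z + K) \<le> f z + f (u + K) + 1"
proof -
  assume t: "tame K f" and "z \<le> u"
  then have "f (z + (u - z)) + f (z + K) \<le> f z + f (z + (u - z) + K) + 1"
    unfolding tame_def by (meson diff_ge_0_iff_ge)
  then show ?thesis by simp
qed

lemma nonexpD:
  assumes "nonexp f" shows "\<bar>f m - f n\<bar> \<le> \<bar>m - n\<bar>"
proof -
  have "\<bar>f (n + int k) - f n\<bar> \<le> int k" for n k
  proof (induction k)
    case (Suc k)
    have "\<bar>f (n + int k + 1) - f (n + int k)\<bar> \<le> 1" using assms by (simp add: nonexp_def)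
    with Suc show ?case by (simp add: algebra_simps)
  qed simp
  from this[of n "nat (m - n)"] this[of m "nat (n - m)"] show ?thesis by (cases "n \<le> m") auto
qed

section \<open>Approximate convexity passes to the lines of the next copy\<close>

text \<open>\<open>z\<close> and \<open>k\<close> are optimal entry points of the two outer points.
  If \<open>k\<close> exceeds \<open>z\<close> by at least \<open>K\<close>, both move by
  \<open>K\<close>, the norm vectors stay the same and \<open>f\<close> alone contributes the error;
  otherwise \<open>f\<close> is evaluated at the same two points and the norm alone contributes
  it.\<close>

lemma tame_fst_line_fst:
  assumes F: "inf_conv f 1 0 F" and t: "tame K f" and K: "K \<ge> 0"
  shows "tame K (\<lambda>n. F (p + n) q)"
  unfolding tame_def
proof (intro allI impI)
  fix n r :: int assume r: "r \<ge> 0"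
  define x where "x = p + n"
  obtain z where z: "F x q = f z + nrm (x - z * 1) (q - z * 0)" by (rule inf_conv_attained[OF F])
  obtain k where k: "F (x + r + K) q = f k + nrm (x + r + K - k * 1) (q - k * 0)" by (rule inf_conv_attained[OF F])
  note le = inf_conv_le'[OF F]
  have "F (x + r) q + F (x + K) q \<le> F x q + F (x + r + K) q + 1"
  proof (cases "K \<le> k - z")
    case True
    have "f (k - K) + f (z + K) \<le> f z + f k + 1"
      using tameD[OF t, of z "k - K"] True by simp
    moreover have "F (x + r) q \<le> f (k - K) + nrm (x + r + K - k * 1) (q - k * 0)" by (rule le) auto
    moreover have "F (x + K) q \<le> f (z + K) + nrm (x - z * 1) (q - z * 0)" by (rule le) auto
    ultimately show ?thesis using z k by linarith
  next
    case small: False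
    \<comment> \<open>The middle points may be served by \<open>z\<close> and \<open>k\<close> in
      either order; the order is chosen so that the shifted first coordinates stay between the two
      original ones.\<close>
    show ?thesis
    proof (cases "k - z \<le> r")
      case True
      have "nrm (x - z + K) q + nrm (x + r + K - k - K) q \<le> nrm (x - z) q + nrm (x + r + K - k) q + 1"
        by (rule nrm_shift_fst) (use True K in auto)
      moreover have "F (x + r) q \<le> f k + nrm (x + r + K - k - K) q" by (rule le) auto
      moreover have "F (x + K) q \<le> f z + nrm (x - z + K) q" by (rule le) auto
      ultimately show ?thesis using z k by simp
    next
      case False
      have "nrm (x - z + r) q + nrm (x + r + K - k - r) q \<le> nrm (x - z) q + nrm (x + r + K - k) q + 1"
        by (rule nrm_shift_fst) (use small r in auto)
      moreover have "F (x + r) q \<le> f z + nrm (x - z + r) q" by (rule le) auto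
      moreover have "F (x + K) q \<le> f k + nrm (x + r + K - k - r) q" by (rule le) auto
      ultimately show ?thesis using z k by simp
    qed
  qed
  then show "F (p + (n + r)) q + F (p + (n + K)) q \<le> F (p + n) q + F (p + (n + r + K)) q + 1"
    by (simp add: x_def add.assoc)
qed

lemma tame_diag_line_diag:
  assumes F: "inf_conv f 2 2 F" and t: "tame K f" and K: "K \<ge> 0"
  shows "tame K (\<lambda>n. F (p + 2 * n) (q + 2 * n))"
  unfolding tame_def
proof (intro allI impI)
  fix n r :: int assume r: "r \<ge> 0"
  define x y where xy: "x = p + 2 * n" "y = q + 2 * n"
  define x' y' where xy': "x' = x + 2 * r + 2 * K" "y' = y + 2 * r + 2 * K"
  obtain z where z: "F x y = f z + nrm (x - z * 2) (y - z * 2)" by (rule inf_conv_attained[OF F])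
  obtain k where k: "F x' y' = f k + nrm (x' - k * 2) (y' - k * 2)" by (rule inf_conv_attained[OF F])
  note le = inf_conv_le'[OF F]
  have "F (x + 2 * r) (y + 2 * r) + F (x + 2 * K) (y + 2 * K) \<le> F x y + F x' y' + 1"
  proof (cases "K \<le> k - z")
    case True
    have "f (k - K) + f (z + K) \<le> f z + f k + 1"
      using tameD[OF t, of z "k - K"] True by simp
    moreover have "F (x + 2 * r) (y + 2 * r) \<le> f (k - K) + nrm (x' - k * 2) (y' - k * 2)"
      by (rule le) (auto simp: xy')
    moreover have "F (x + 2 * K) (y + 2 * K) \<le> f (z + K) + nrm (x - z * 2) (y - z * 2)"
      by (rule le) auto
    ultimately show ?thesis using z k by linarith
  next
    case small: False
    show ?thesis
    proof (cases "k - z \<le> r")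
      case True
      have "nrm (x - z * 2 + 2 * K) (y - z * 2 + 2 * K) + nrm (x' - k * 2 - 2 * K) (y' - k * 2 - 2 * K)
         \<le> nrm (x - z * 2) (y - z * 2) + nrm (x' - k * 2) (y' - k * 2) + 1"
        by (rule nrm_shift_diag) (use True K in \<open>simp_all add: xy'\<close>)
      moreover have "F (x + 2 * r) (y + 2 * r) \<le> f k + nrm (x' - k * 2 - 2 * K) (y' - k * 2 - 2 * K)"
        by (rule le) (auto simp: xy')
      moreover have "F (x + 2 * K) (y + 2 * K) \<le> f z + nrm (x - z * 2 + 2 * K) (y - z * 2 + 2 * K)"
        by (rule le) auto
      ultimately show ?thesis using z k by linarith
    next
      case False
      have "nrm (x - z * 2 + 2 * r) (y - z * 2 + 2 * r) + nrm (x' - k * 2 - 2 * r) (y' - k * 2 - 2 * r)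
         \<le> nrm (x - z * 2) (y - z * 2) + nrm (x' - k * 2) (y' - k * 2) + 1"
        by (rule nrm_shift_diag) (use small r in \<open>simp_all add: xy'\<close>)
      moreover have "F (x + 2 * r) (y + 2 * r) \<le> f z + nrm (x - z * 2 + 2 * r) (y - z * 2 + 2 * r)"
        by (rule le) auto
      moreover have "F (x + 2 * K) (y + 2 * K) \<le> f k + nrm (x' - k * 2 - 2 * r) (y' - k * 2 - 2 * r)"
        by (rule le) (auto simp: xy')
      ultimately show ?thesis using z k by linarith
    qed
  qed
  then show "F (p + 2 * (n + r)) (q + 2 * (n + r)) + F (p + 2 * (n + K)) (q + 2 * (n + K))
      \<le> F (p + 2 * n) (q + 2 * n) + F (p + 2 * (n + r + K)) (q + 2 * (n + r + K)) + 1"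
    by (simp add: xy xy' algebra_simps)
qed

text \<open>Along b the relevant order of the entry points is reversed: they are exchanged only if
  \<open>z\<close> exceeds \<open>k\<close> by \<open>K\<close>. The norm vectors then move
  diagonally by \<open>K\<close> in both coordinates, which is free because \<open>K\<close> is
  even.\<close>

lemma tame_fst_line_snd:
  assumes F: "inf_conv f 1 0 F" and t: "tame K f" and K: "K \<ge> 0" "even K"
  shows "tame K (\<lambda>n. F p (q + n))"
  unfolding tame_def
proof (intro allI impI)
  fix n r :: int assume r: "r \<ge> 0"
  define y where "y = q + n"
  obtain z where z: "F p y = f z + nrm (p - z * 1) (y - z * 0)" by (rule inf_conv_attained[OF F])
  obtain k where k: "F p (y + r + K) = f k + nrm (p - k * 1) (y + r + K - k * 0)" by (rule inf_conv_attained[OF F])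
  note le = inf_conv_le'[OF F]
  have "F p (y + r) + F p (y + K) \<le> F p y + F p (y + r + K) + 1"
  proof (cases "K \<le> z - k")
    case True
    have "f (z - K) + f (k + K) \<le> f z + f k + 1"
      using tameD[OF t, of k "z - K"] True by simp
    moreover have "nrm (p - z + K) (y + K) + nrm (p - k - K) (y + r + K - K) \<le> nrm (p - z) y + nrm (p - k) (y + r + K)"
      by (rule nrm_shift_diag_even) (use True K r in auto)
    moreover have "F p (y + K) \<le> f (z - K) + nrm (p - z + K) (y + K)" by (rule le) auto
    moreover have "F p (y + r) \<le> f (k + K) + nrm (p - k - K) (y + r + K - K)" by (rule le) auto
    ultimately show ?thesis using z k by simp
  next
    case False
    have "nrm (p - z) (y + r) + nrm (p - k) (y + r + K - r) \<le> nrm (p - z) y + nrm (p - k) (y + r + K) + 1"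
      by (rule nrm_shift_snd) (use False K r in auto)
    moreover have "F p (y + r) \<le> f z + nrm (p - z) (y + r)" by (rule le) auto
    moreover have "F p (y + K) \<le> f k + nrm (p - k) (y + r + K - r)" by (rule le) auto
    ultimately show ?thesis using z k by simp
  qed
  then show "F p (q + (n + r)) + F p (q + (n + K)) \<le> F p (q + n) + F p (q + (n + r + K)) + 1"
    by (simp add: y_def add.assoc)
qed

text \<open>A step of d advances each coordinate by 2, so scale \<open>K\<close> on the diagonal
  corresponds to \<open>2 * K\<close> on the entry line. The second coordinates absorb an even
  shift, which is free.\<close>

lemma tame_fst_line_diag:
  assumes F: "inf_conv f 1 0 F" and t: "tame (2 * K) f" and K: "K \<ge> 0"
  shows "tame K (\<lambda>n. F (p + 2 * n) (q + 2 * n))"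
  unfolding tame_def
proof (intro allI impI)
  fix n r :: int assume r: "r \<ge> 0"
  define x y where xy: "x = p + 2 * n" "y = q + 2 * n"
  define x' y' where xy': "x' = x + 2 * r + 2 * K" "y' = y + 2 * r + 2 * K"
  obtain z where z: "F x y = f z + nrm (x - z * 1) (y - z * 0)" by (rule inf_conv_attained[OF F])
  obtain k where k: "F x' y' = f k + nrm (x' - k * 1) (y' - k * 0)" by (rule inf_conv_attained[OF F])
  note le = inf_conv_le'[OF F]
  have "F (x + 2 * r) (y + 2 * r) + F (x + 2 * K) (y + 2 * K) \<le> F x y + F x' y' + 1"
  proof (cases "2 * K \<le> k - z")
    case True
    have "f (k - 2 * K) + f (z + 2 * K) \<le> f z + f k + 1"
      using tameD[OF t, of z "k - 2 * K"] True by simp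
    moreover have "nrm (x - z) (y + 2 * K) + nrm (x' - k) (y' - 2 * K) \<le> nrm (x - z) y + nrm (x' - k) y'"
      by (rule nrm_shift_snd_even) (use True K r in \<open>simp_all add: xy'\<close>)
    moreover have "F (x + 2 * r) (y + 2 * r) \<le> f (k - 2 * K) + nrm (x' - k) (y' - 2 * K)"
      by (rule le) (auto simp: xy')
    moreover have "F (x + 2 * K) (y + 2 * K) \<le> f (z + 2 * K) + nrm (x - z) (y + 2 * K)"
      by (rule le) auto
    ultimately show ?thesis using z k by simp
  next
    case False
    have "nrm (x - z + 2 * r) (y + 2 * r) + nrm (x' - k - 2 * r) (y' - 2 * r) \<le> nrm (x - z) y + nrm (x' - k) y' + 1"
      by (rule nrm_shift_diag) (use False K r in \<open>simp_all add: xy'\<close>)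
    moreover have "F (x + 2 * r) (y + 2 * r) \<le> f z + nrm (x - z + 2 * r) (y + 2 * r)"
      by (rule le) auto
    moreover have "F (x + 2 * K) (y + 2 * K) \<le> f k + nrm (x' - k - 2 * r) (y' - 2 * r)"
      by (rule le) (auto simp: xy')
    ultimately show ?thesis using z k by simp
  qed
  then show "F (p + 2 * (n + r)) (q + 2 * (n + r)) + F (p + 2 * (n + K)) (q + 2 * (n + K))
      \<le> F (p + 2 * n) (q + 2 * n) + F (p + 2 * (n + r + K)) (q + 2 * (n + r + K)) + 1"
    by (simp add: xy xy' algebra_simps)
qed

text \<open>The converse change of scale: one step of the d-line moves the first coordinate by 2,
  and the second coordinates again absorb an even shift.\<close>

lemma tame_diag_line_fst:
  assumes F: "inf_conv f 2 2 F" and t: "tame h f" and h: "h \<ge> 0"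
  shows "tame (2 * h) (\<lambda>n. F (p + n) q)"
  unfolding tame_def
proof (intro allI impI)
  fix n r :: int assume r: "r \<ge> 0"
  define x x' where x: "x = p + n" "x' = x + r + 2 * h"
  obtain z where z: "F x q = f z + nrm (x - z * 2) (q - z * 2)" by (rule inf_conv_attained[OF F])
  obtain k where k: "F x' q = f k + nrm (x' - k * 2) (q - k * 2)" by (rule inf_conv_attained[OF F])
  note le = inf_conv_le'[OF F]
  have "F (x + r) q + F (x + 2 * h) q \<le> F x q + F x' q + 1"
  proof (cases "h \<le> k - z")
    case True
    have "f (k - h) + f (z + h) \<le> f z + f k + 1"
      using tameD[OF t, of z "k - h"] True by simp
    moreover have "nrm (x' - k * 2) (q - k * 2 + 2 * h) + nrm (x - z * 2) (q - z * 2 - 2 * h)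
        \<le> nrm (x' - k * 2) (q - k * 2) + nrm (x - z * 2) (q - z * 2)"
      by (rule nrm_shift_snd_even) (use True h r in \<open>simp_all add: x\<close>)
    moreover have "F (x + r) q \<le> f (k - h) + nrm (x' - k * 2) (q - k * 2 + 2 * h)"
      by (rule le) (auto simp: x)
    moreover have "F (x + 2 * h) q \<le> f (z + h) + nrm (x - z * 2) (q - z * 2 - 2 * h)"
      by (rule le) (auto simp: x)
    ultimately show ?thesis using z k by linarith
  next
    case False
    have "nrm (x - z * 2 + r) (q - z * 2) + nrm (x' - k * 2 - r) (q - k * 2)
       \<le> nrm (x - z * 2) (q - z * 2) + nrm (x' - k * 2) (q - k * 2) + 1"
      by (rule nrm_shift_fst) (use False h r in \<open>simp_all add: x\<close>)
    moreover have "F (x + r) q \<le> f z + nrm (x - z * 2 + r) (q - z * 2)"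
      by (rule le) (auto simp: x)
    moreover have "F (x + 2 * h) q \<le> f k + nrm (x' - k * 2 - r) (q - k * 2)"
      by (rule le) (auto simp: x)
    ultimately show ?thesis using z k by linarith
  qed
  then show "F (p + (n + r)) q + F (p + (n + 2 * h)) q \<le> F (p + n) q + F (p + (n + r + 2 * h)) q + 1"
    by (simp add: x add.assoc)
qed

section \<open>Symmetries under swapping the coordinates and negation\<close>

lemma inf_conv_swap:
  assumes "inf_conv f ex ey F"
  shows "inf_conv f ey ex (\<lambda>x y. F y x)"
proof -
  have "nrm (x - n * ey) (y - n * ex) = nrm (y - n * ex) (x - n * ey)" for x y n
    by (rule nrm_swap)
  then show ?thesis using assms unfolding inf_conv_def by presburger
qed

lemma inf_conv_neg:
  assumes "inf_conv f ex ey F"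
  shows "inf_conv (\<lambda>n. f (- n)) ex ey (\<lambda>x y. F (- x) (- y))"
proof -
  have e: "nrm (- x - n * ex) (- y - n * ey) = nrm (x - (- n) * ex) (y - (- n) * ey)" for x y n
    using nrm_neg[of "x + n * ex" "y + n * ey"] by (simp add: algebra_simps)
  show ?thesis
    unfolding inf_conv_def
  proof (intro conjI allI)
    fix x y n
    show "F (- x) (- y) \<le> f (- n) + nrm (x - n * ex) (y - n * ey)"
      using inf_conv_le[OF assms, of "-x" "-y" "-n"] e[of x "-n" y] by simp
  next
    fix x y
    obtain n where "F (- x) (- y) = f n + nrm (- x - n * ex) (- y - n * ey)"
      by (rule inf_conv_attained[OF assms])
    then show "\<exists>n. F (- x) (- y) = f (- n) + nrm (x - n * ex) (y - n * ey)"
      by (intro exI[of _ "-n"]) (simp add: e)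
  qed
qed

lemma nonexp_neg: "nonexp f \<Longrightarrow> nonexp (\<lambda>n. f (- n))"
  unfolding nonexp_def
proof
  fix n assume "\<forall>n. \<bar>f (n + 1) - f n\<bar> \<le> 1"
  from spec[OF this, of "- n - 1"] show "\<bar>f (- (n + 1)) - f (- n)\<bar> \<le> 1" by (simp add: abs_minus_commute)
qed

lemma tame_neg: "tame K f \<Longrightarrow> tame K (\<lambda>n. f (- n))"
  unfolding tame_def
proof (intro allI impI)
  fix z r :: int assume a: "\<forall>z r. 0 \<le> r \<longrightarrow> f (z + r) + f (z + K) \<le> f z + f (z + r + K) + 1" and "0 \<le> r"
  from a[rule_format, of r "- z - r - K"] \<open>0 \<le> r\<close>
  have "f (- z - r - K + r) + f (- z - r - K + K) \<le> f (- z - r - K) + f (- z - r - K + r + K) + 1" by simp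
  moreover have "- z - r - K + r = - (z + K)" "- z - r - K + K = - (z + r)" "- z - r - K = - (z + r + K)"
    "- z - r - K + r + K = - z" by auto
  ultimately show "f (- (z + r)) + f (- (z + K)) \<le> f (- z) + f (- (z + r + K)) + 1"
    by (simp only: add.commute)
qed

section \<open>Scale 2 on an a-line of a copy entered through a d-line\<close>

text \<open>For a point moved left by 2, the first alternative keeps the entry point and gains 1.
  The second one stands for entering the d-line one step earlier: it gains 2 in the norm and pays at
  most 1 on the line.\<close>

lemma nrm_right:
  assumes "x \<ge> y + 2"
  shows "nrm (x - 2) y + 1 \<le> nrm x y \<or> nrm x (y + 2) + 2 \<le> nrm x y"
proof -
  obtain X e where x: "x = 2 * X + e" and e: "is_bit e" by (rule obtain_bit)
  obtain Y f where y: "y = 2 * Y + f" and f: "is_bit f" by (rule obtain_bit)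
  have sh: "x - 2 = 2 * (X - 1) + e" "y + 2 = 2 * (Y + 1) + f" by (simp_all add: x y)
  define m n k where d: "m = nrm (2 * (X - 1) + e) (2 * Y + f)" "n = nrm (2 * X + e) (2 * (Y + 1) + f)"
    "k = nrm (2 * X + e) (2 * Y + f)"
  have "m + 1 \<le> k \<or> n + 2 \<le> k"
    using nrm_cases_bit[OF e f, of "X - 1" Y, folded d] nrm_cases_bit[OF e f, of X "Y + 1", folded d]
      nrm_lower_bit[OF e f, of X Y, folded d] assms[unfolded x y] e f unfolding is_bit_def by (smt (z3))
  then show ?thesis unfolding d sh[symmetric] x[symmetric] y[symmetric] .
qed

text \<open>Used for the one step of length 2 that straddles the diagonal, where the slope estimates
  of the two sides do not apply.\<close>

lemma nrm_cross: "\<bar>nrm (x + 1) x - nrm (x - 1) x\<bar> \<le> 1"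
  using nrm_lower2[of "x + 1" x] nrm_cases2[of "x + 1" x] nrm_lower2[of "x - 1" x] nrm_cases2[of "x - 1" x]
  by (smt (z3))

lemma nrm_triangle: "nrm (x + x') (y + y') \<le> nrm x y + nrm x' y'"
  using nrm_cases2[of "x + x'" "y + y'"] nrm_lower2[of x y] nrm_lower2[of x' y'] by (smt (z3))

lemma inf_conv_lipschitz:
  assumes F: "inf_conv f ex ey F"
  shows "F x y \<le> F x' y' + nrm (x - x') (y - y')"
proof -
  obtain n where n: "F x' y' = f n + nrm (x' - n * ex) (y' - n * ey)" by (rule inf_conv_attained[OF F])
  have "F x y \<le> f n + nrm (x - x' + (x' - n * ex)) (y - y' + (y' - n * ey))" by (rule inf_conv_le'[OF F]) auto
  then show ?thesis
    using n nrm_triangle[of "x - x'" "x' - n * ex" "y - y'" "y' - n * ey"] by linarith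
qed

lemma nrm_gens [simp]: "nrm 0 0 = 0" "nrm 1 0 = 1" "nrm 0 1 = 1" "nrm 1 1 = 1" "nrm 2 2 = 1"
  "nrm (-1) 0 = 1" "nrm 0 (-1) = 1" "nrm (-1) (-1) = 1" "nrm (-2) (-2) = 1" "nrm 2 0 = 2" "nrm (-2) 0 = 2"
  unfolding nrm_def by (simp_all add: insert_commute)

text \<open>\<open>tame_diag_line_fst\<close> would require scale 1 of \<open>f\<close>. Instead,
  over a step of 2 the function \<open>F\<close> grows by 1 or 2 right of the diagonal, falls by 1
  or 2 left of it, and grows by at most 1 across it; hence these increments never drop by more than
  1.\<close>

lemma tame2_diag_line_fst:
  assumes F: "inf_conv f 2 2 F" and f: "nonexp f"
  shows "tame 2 (\<lambda>n. F (p + n) q)"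
proof -
  have right: "F x y + 1 \<le> F (x + 2) y" if "x \<ge> y" and F: "inf_conv f 2 2 F" and f: "nonexp f" for x y f F
  proof -
    obtain k where k: "F (x + 2) y = f k + nrm (x + 2 - k * 2) (y - k * 2)" by (rule inf_conv_attained[OF F])
    have "x + 2 - k * 2 \<ge> y - k * 2 + 2" using that by simp
    from nrm_right[OF this] show ?thesis
    proof
      assume "nrm (x + 2 - k * 2 - 2) (y - k * 2) + 1 \<le> nrm (x + 2 - k * 2) (y - k * 2)"
      moreover have "F x y \<le> f k + nrm (x + 2 - k * 2 - 2) (y - k * 2)"
        by (rule inf_conv_le'[OF F]) auto
      ultimately show ?thesis using k by linarith
    next
      assume "nrm (x + 2 - k * 2) (y - k * 2 + 2) + 2 \<le> nrm (x + 2 - k * 2) (y - k * 2)"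
      moreover have "F x y \<le> f (k - 1) + nrm (x + 2 - k * 2) (y - k * 2 + 2)"
        by (rule inf_conv_le'[OF F]) auto
      ultimately show ?thesis using k nonexpD[OF f, of "k - 1" k] by linarith
    qed
  qed
  have left: "F (x + 2) y + 1 \<le> F x y" if "x + 2 \<le> y" for x y
    using right[of "-y" "- x - 2", OF _ inf_conv_neg[OF F] nonexp_neg[OF f]] that by (simp add: add.commute)
  have lip: "\<bar>F (x + 2) y - F x y\<bar> \<le> 2" for x y
    using inf_conv_lipschitz[OF F, of "x + 2" y x y] inf_conv_lipschitz[OF F, of x y "x + 2" y] by simp
  have mid: "F (x + 1) x \<le> F (x - 1) x + 1" for x
  proof -
    obtain k where k: "F (x - 1) x = f k + nrm (x - 1 - k * 2) (x - k * 2)" by (rule inf_conv_attained[OF F])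
    have "F (x + 1) x \<le> f k + nrm (x - k * 2 + 1) (x - k * 2)" by (rule inf_conv_le'[OF F]) auto
    moreover have e: "x - 1 - k * 2 = x - k * 2 - 1" by simp
    moreover note nrm_cross[of "x - k * 2"] k[unfolded e]
    ultimately show ?thesis by linarith
  qed
  show ?thesis
    unfolding tame_def
  proof (intro allI impI)
    fix n r :: int assume r: "r \<ge> 0"
    define x where "x = p + n"
    consider "x \<ge> q" | "x = q - 1" "r = 0" | "x = q - 1" "r > 0" | "x \<le> q - 2" using r by linarith
    then have "F (x + r) q + F (x + 2) q \<le> F x q + F (x + r + 2) q + 1"
    proof cases
      case 1
      then show ?thesis using right[OF _ F f, of q "x + r"] lip[of x q] r by simp
    next
      case 2
      then show ?thesis by simp
    next
      case 3
      have e: "q + 1 = x + 2" "q - 1 = x" using 3 by auto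
      show ?thesis using right[OF _ F f, of q "x + r"] mid[of q, unfolded e] 3 by simp
    next
      case 4
      then show ?thesis using left[of x q] lip[of "x + r" q] by simp
    qed
    then show "F (p + (n + r)) q + F (p + (n + 2)) q \<le> F (p + n) q + F (p + (n + r + 2)) q + 1"
      by (simp add: x_def add.assoc)
  qed
qed

section \<open>Bounded connections below a level\<close>

text \<open>\<open>k\<close> bounds the number of edges from above, hence the free \<open>k\<close>
  in \<open>conn_refl\<close>.\<close>

inductive conn :: "('a \<Rightarrow> 'a \<Rightarrow> bool) \<Rightarrow> nat \<Rightarrow> 'a \<Rightarrow> 'a \<Rightarrow> bool" for E where
  conn_refl: "conn E k u u"
| conn_step: "E u w \<Longrightarrow> conn E k w v \<Longrightarrow> conn E (Suc k) u v"

lemma conn_mono: "conn E k u v \<Longrightarrow> k \<le> l \<Longrightarrow> conn E l u v"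
proof (induction arbitrary: l rule: conn.induct)
  case (conn_step u w k v)
  then show ?case by (cases l) (auto intro: conn.conn_step)
qed (rule conn.conn_refl)

lemma conn_trans: "conn E k u v \<Longrightarrow> conn E l v w \<Longrightarrow> conn E (k + l) u w"
proof (induction rule: conn.induct)
  case (conn_refl k u)
  then show ?case by (rule conn_mono) simp
qed (auto intro: conn.conn_step)

lemma conn_edge: "E u v \<Longrightarrow> conn E 1 u v"
  using conn_step[OF _ conn_refl, of E u v 0] by simp

lemma conn_sym:
  assumes "\<And>u v. E u v \<Longrightarrow> E v u"
  shows "conn E k u v \<Longrightarrow> conn E k v u"
proof (induction rule: conn.induct)
  case (conn_step u w k v)
  from conn_trans[OF conn_step(3) conn_edge[where E = E, OF assms[OF conn_step(1)]]] show ?case by simp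
qed (rule conn.conn_refl)

lemma conn_map:
  assumes "\<And>u v. E u v \<Longrightarrow> E' (h u) (h v)"
  shows "conn E k u v \<Longrightarrow> conn E' k (h u) (h v)"
  by (induction rule: conn.induct) (auto intro: conn.intros assms)

lemma conn_bind:
  assumes "\<And>u v. E u v \<Longrightarrow> conn E' l (h u) (h v)"
  shows "conn E k u v \<Longrightarrow> conn E' (k * l) (h u) (h v)"
  by (induction rule: conn.induct) (auto intro: conn_trans assms conn_refl)

section \<open>Edges inside one copy and their symmetries\<close>

definition isgen :: "int \<Rightarrow> int \<Rightarrow> bool" where
  "isgen p q \<longleftrightarrow> (p, q) \<in> {(1, 0), (-1, 0), (0, 1), (0, -1), (1, 1), (-1, -1), (2, 2), (-2, -2)}"

lemma isgen_cases:
  assumes "isgen p q"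
  obtains "p = 1" "q = 0" | "p = -1" "q = 0" | "p = 0" "q = 1" | "p = 0" "q = -1" | "p = 1" "q = 1"
    | "p = -1" "q = -1" | "p = 2" "q = 2" | "p = -2" "q = -2"
  using assms unfolding isgen_def by auto

lemma isgen_minus: "isgen p q \<Longrightarrow> isgen (- p) (- q)"
  unfolding isgen_def by (elim insertE emptyE) simp_all

lemma isgen_swap: "isgen p q \<Longrightarrow> isgen q p"
  unfolding isgen_def by (elim insertE emptyE) simp_all

definition gadj :: "int \<times> int \<Rightarrow> int \<times> int \<Rightarrow> bool" where
  "gadj u v \<longleftrightarrow> isgen (fst v - fst u) (snd v - snd u)"

text \<open>Two notions of staying below a level. \<open>edge_lt\<close> also rejects edges with
  both ends on level \<open>N\<close>, whose midpoints leave the ball. \<open>edge_le\<close> admits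
  them; it serves for peaks, where the horizontal edges are bypassed afterwards.\<close>

definition edge_le :: "(int \<Rightarrow> int \<Rightarrow> int) \<Rightarrow> int \<Rightarrow> int \<times> int \<Rightarrow> int \<times> int \<Rightarrow> bool" where
  "edge_le F N u v \<longleftrightarrow> gadj u v \<and> case_prod F u \<le> N \<and> case_prod F v \<le> N"

definition edge_lt :: "(int \<Rightarrow> int \<Rightarrow> int) \<Rightarrow> int \<Rightarrow> int \<times> int \<Rightarrow> int \<times> int \<Rightarrow> bool" where
  "edge_lt F N u v \<longleftrightarrow> edge_le F N u v \<and> (case_prod F u < N \<or> case_prod F v < N)"

lemma gadj_sym: "gadj u v \<Longrightarrow> gadj v u"
  unfolding gadj_def using isgen_minus[of "fst v - fst u" "snd v - snd u"] by simp

lemma edge_le_sym: "edge_le F N u v \<Longrightarrow> edge_le F N v u"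
  unfolding edge_le_def using gadj_sym by blast

lemma edge_lt_sym: "edge_lt F N u v \<Longrightarrow> edge_lt F N v u"
  unfolding edge_lt_def using edge_le_sym by blast

lemma gadj_swap: "gadj u v \<Longrightarrow> gadj (prod.swap u) (prod.swap v)"
  unfolding gadj_def using isgen_swap by simp

lemma edge_lt_swap: "edge_lt (\<lambda>x y. F y x) N u v \<Longrightarrow> edge_lt F N (prod.swap u) (prod.swap v)"
  unfolding edge_lt_def edge_le_def using gadj_swap[of u v] by (simp add: case_prod_beta)

lemma edge_le_swap: "edge_le (\<lambda>x y. F y x) N u v \<Longrightarrow> edge_le F N (prod.swap u) (prod.swap v)"
  unfolding edge_le_def using gadj_swap[of u v] by (simp add: case_prod_beta)

definition pneg :: "int \<times> int \<Rightarrow> int \<times> int" where "pneg u = (- fst u, - snd u)"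

lemma gadj_neg: "gadj u v \<Longrightarrow> gadj (pneg u) (pneg v)"
  unfolding gadj_def pneg_def using isgen_minus[of "fst v - fst u" "snd v - snd u"] by simp

lemma edge_lt_neg: "edge_lt (\<lambda>x y. F (- x) (- y)) N u v \<Longrightarrow> edge_lt F N (pneg u) (pneg v)"
  unfolding edge_lt_def edge_le_def using gadj_neg[of u v] by (simp add: case_prod_beta pneg_def)

lemma edge_le_neg: "edge_le (\<lambda>x y. F (- x) (- y)) N u v \<Longrightarrow> edge_le F N (pneg u) (pneg v)"
  unfolding edge_le_def using gadj_neg[of u v] by (simp add: case_prod_beta pneg_def)

lemma conn_lt_swap: "conn (edge_lt (\<lambda>x y. F y x) N) k (x, y) (x', y') \<Longrightarrow> conn (edge_lt F N) k (y, x) (y', x')"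
  using conn_map[of "edge_lt (\<lambda>x y. F y x) N" "edge_lt F N" prod.swap, OF edge_lt_swap] by fastforce

lemma conn_le_swap: "conn (edge_le (\<lambda>x y. F y x) N) k (x, y) (x', y') \<Longrightarrow> conn (edge_le F N) k (y, x) (y', x')"
  using conn_map[of "edge_le (\<lambda>x y. F y x) N" "edge_le F N" prod.swap, OF edge_le_swap] by fastforce

lemma conn_lt_neg:
  assumes "conn (edge_lt (\<lambda>x y. F (- x) (- y)) N) k (- x, - y) (- x', - y')"
  shows "conn (edge_lt F N) k (x, y) (x', y')"
  using conn_map[of "edge_lt (\<lambda>x y. F (- x) (- y)) N" "edge_lt F N" pneg, OF edge_lt_neg assms] by (simp add: pneg_def)

lemma conn_le_neg:
  assumes "conn (edge_le (\<lambda>x y. F (- x) (- y)) N) k (- x, - y) (- x', - y')"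
  shows "conn (edge_le F N) k (x, y) (x', y')"
  using conn_map[of "edge_le (\<lambda>x y. F (- x) (- y)) N" "edge_le F N" pneg, OF edge_le_neg assms] by (simp add: pneg_def)

lemma conn2: "E u v \<Longrightarrow> E v w \<Longrightarrow> conn E 2 u w"
  using conn_step[of E u v 1 w] conn_edge[of E v w] by (simp add: numeral_2_eq_2)
lemma conn3: "E u v \<Longrightarrow> E v w \<Longrightarrow> E w x \<Longrightarrow> conn E 3 u x"
  using conn_step[of E u v 2 x] conn2[of E v w x] by (simp add: numeral_3_eq_3 numeral_2_eq_2)
lemma conn4: "E u v \<Longrightarrow> E v w \<Longrightarrow> E w x \<Longrightarrow> E x y \<Longrightarrow> conn E 4 u y"
  using conn_step[of E u v 3 y] conn3[of E v w x y] by simp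

section \<open>Explicit levels in a copy entered through a d-line\<close>

lemma nrm_quadrant: "x \<ge> 0 \<Longrightarrow> y \<le> 0 \<Longrightarrow> nrm x y = x - y"
proof -
  assume a: "x \<ge> 0" "y \<le> 0"
  then have "y \<le> y div 2" "(y + 1) div 2 \<le> 0" "x div 2 \<ge> 0" "(x + 1) div 2 \<le> x" by presburger+
  with a have "nrm x y \<le> x - y" unfolding nrm_le_iff by (intro conjI) linarith+
  moreover have "x - y \<le> nrm x y" using nrm_lower by blast
  ultimately show ?thesis by simp
qed

text \<open>From an entry point (2n, 2n) with \<open>y \<le> 2 * n\<close> and
  \<open>2 * n \<le> x\<close> the target is reached by a-steps and inverse b-steps alone, and their
  number \<open>x - y\<close> does not depend on \<open>n\<close>.\<close>

lemma diag_le: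
  assumes "inf_conv f 2 2 F" "y \<le> 2 * n" "2 * n \<le> x"
  shows "F x y \<le> x - y + f n"
  using inf_conv_le[OF assms(1), of x y n] assms(2,3) nrm_quadrant[of "x - n * 2" "y - n * 2"] by simp

text \<open>On this side of the diagonal the level is \<open>x - y\<close> plus the minimum of
  \<open>f\<close> over the entry points between \<open>y\<close> and \<open>x\<close>: any other
  entry point can be replaced by the nearest one in this range, because \<open>f\<close> changes by
  at most 1 per step. For \<open>x = y\<close> odd the range is empty, which is the case of
  \<open>diag_mid\<close>.\<close>

lemma diag_attained:
  assumes F: "inf_conv f 2 2 F" and f: "nonexp f" and "x \<ge> y" "x = y \<Longrightarrow> even x"
  obtains n where "y \<le> 2 * n" "2 * n \<le> x" "F x y = x - y + f n"
proof -
  obtain n where n: "F x y = f n + nrm (x - n * 2) (y - n * 2)" by (rule inf_conv_attained[OF F])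
  have "\<exists>m. y \<le> 2 * m \<and> 2 * m \<le> x \<and> x - y + f m \<le> F x y"
  proof -
    consider "y \<le> 2 * n" "2 * n \<le> x" | "2 * n < y" | "x < 2 * n" by linarith
    then show ?thesis
    proof cases
      case 1
      then show ?thesis using n nrm_quadrant[of "x - n * 2" "y - n * 2"] by (intro exI[of _ n]) simp
    next
      case 2
      define m where "m = (y + 1) div 2"
      have m: "y \<le> 2 * m" "2 * m \<le> x" "n \<le> m" unfolding m_def using assms(3,4) 2 by presburger+
      have "(x - n * 2) - (y - n * 2) div 2 \<le> nrm (x - n * 2) (y - n * 2)" using nrm_lower by blast
      moreover have "(y - n * 2) div 2 = y div 2 - n" "y div 2 = y - m" unfolding m_def by presburger+
      ultimately show ?thesis using n m nonexpD[OF f, of m n] by (intro exI[of _ m]) simp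
    next
      case 3
      define m where "m = x div 2"
      have m: "y \<le> 2 * m" "2 * m \<le> x" "m \<le> n" unfolding m_def using assms(3,4) 3 by presburger+
      have "(x - n * 2 + 1) div 2 - (y - n * 2) \<le> nrm (x - n * 2) (y - n * 2)" using nrm_lower by blast
      moreover have "(x - n * 2 + 1) div 2 = (x + 1) div 2 - n" "(x + 1) div 2 = x - m" unfolding m_def by presburger+
      ultimately show ?thesis using n m nonexpD[OF f, of m n] by (intro exI[of _ m]) simp
    qed
  qed
  then obtain m where "y \<le> 2 * m" "2 * m \<le> x" "x - y + f m \<le> F x y" by blast
  with diag_le[OF F, of y m x] that[of m] show ?thesis by simp
qed

text \<open>An odd diagonal point has no entry point between its coordinates; a single c-step from
  one of the two neighbouring points of the line is optimal.\<close>

lemma diag_mid: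
  assumes F: "inf_conv f 2 2 F" and f: "nonexp f"
  shows "F (2 * n + 1) (2 * n + 1) = 1 + min (f n) (f (n + 1))"
proof -
  have "F (2 * n + 1) (2 * n + 1) \<le> f n + nrm 1 1" by (rule inf_conv_le'[OF F]) auto
  moreover have "F (2 * n + 1) (2 * n + 1) \<le> f (n + 1) + nrm (-1) (-1)" by (rule inf_conv_le'[OF F]) auto
  moreover have "1 + min (f n) (f (n + 1)) \<le> F (2 * n + 1) (2 * n + 1)"
  proof -
    define w where "w k = nrm (2 * n + 1 - k * 2) (2 * n + 1 - k * 2)" for k
    obtain k where k: "F (2 * n + 1) (2 * n + 1) = f k + w k"
      unfolding w_def by (rule inf_conv_attained[OF F])
    have "2 * n + 1 - k * 2 \<le> 2 * w k" "k * 2 - 2 * n - 1 \<le> 2 * w k"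
      unfolding w_def using nrm_lower2[of "2 * n + 1 - k * 2" "2 * n + 1 - k * 2"] by simp_all
    then have "1 + n - k \<le> w k" "k - n \<le> w k" by linarith+
    moreover have "f n \<le> f k + (n - k) \<or> f (n + 1) \<le> f k + (k - (n + 1))"
      using nonexpD[OF f, of k n] nonexpD[OF f, of k "n + 1"] by linarith
    ultimately show ?thesis unfolding k by linarith
  qed
  ultimately show ?thesis by simp
qed

lemma diag_line:
  assumes F: "inf_conv f 2 2 F" and f: "nonexp f"
  shows "F (2 * n) (2 * n) = f n"
proof -
  obtain m where "2 * n \<le> 2 * m" "2 * m \<le> 2 * n" and m: "F (2 * n) (2 * n) = 2 * n - 2 * n + f m"
    by (rule diag_attained[OF F f, of "2 * n" "2 * n"]) auto
  then have "m = n" by linarith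
  with m show ?thesis by simp
qed

section \<open>Copies entered through a line in the direction of d\<close>

lemma edge_ltI:
  "isgen (x' - x) (y' - y) \<Longrightarrow> F x y \<le> N \<Longrightarrow> F x' y' \<le> N \<Longrightarrow> F x y < N \<or> F x' y' < N \<Longrightarrow>
   edge_lt F N (x, y) (x', y')"
  by (simp add: edge_lt_def edge_le_def gadj_def)

lemma edge_leI:
  "isgen (x' - x) (y' - y) \<Longrightarrow> F x y \<le> N \<Longrightarrow> F x' y' \<le> N \<Longrightarrow> edge_le F N (x, y) (x', y')"
  by (simp add: edge_le_def gadj_def)

lemma isgen_gens [simp]: "isgen 1 0" "isgen (-1) 0" "isgen 0 1" "isgen 0 (-1)" "isgen 1 1" "isgen (-1) (-1)"
  "isgen 2 2" "isgen (-2) (-2)"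
  by (simp_all add: isgen_def)

lemma isgen_nrm: "isgen p q \<Longrightarrow> nrm p q = 1"
  unfolding isgen_def by (elim insertE emptyE) simp_all

lemma inf_conv_step:
  assumes "inf_conv f ex ey F" "isgen (x - x') (y - y')"
  shows "F x y \<le> F x' y' + 1"
  using inf_conv_lipschitz[OF assms(1), of x y x' y'] isgen_nrm[OF assms(2)] by simp

lemma nrm_neg_one: "y \<le> -1 \<Longrightarrow> nrm (-1) y \<le> - y"
  unfolding nrm_le_iff by (intro conjI; presburger)

text \<open>The map from (x, y) to (-y, -x) preserves the half-plane \<open>x \<ge> y\<close> and
  exchanges a with the inverse of b, so results on a-edges transfer to b-edges without changing
  sides.\<close>

lemma inf_conv_antiswap:
  "inf_conv f 2 2 F \<Longrightarrow> inf_conv (\<lambda>n. f (- n)) 2 2 (\<lambda>x y. F (- y) (- x))"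
  using inf_conv_swap[OF inf_conv_neg] by simp

lemma conn_lt_antiswap:
  assumes "conn (edge_lt (\<lambda>x y. F (- y) (- x)) N) k (- y, - x) (- y', - x')"
  shows "conn (edge_lt F N) k (x, y) (x', y')"
  by (rule conn_lt_neg, rule conn_lt_swap) (use assms in simp)

section \<open>Horizontal edges and monotonicity on the side x >= y of the diagonal\<close>

context
  fixes f F
  assumes F: "inf_conv f 2 2 F" and f: "nonexp f"
begin

text \<open>The best entry point of \<open>(x + 1, y)\<close> must be the last one,
  \<open>2 * k = x + 1\<close>, as any other would put \<open>(x, y)\<close> below \<open>N\<close>.
  It still serves \<open>(x + 1, y + 1)\<close>, which therefore lies lower and closes a triangle
  with sides a, b, c.\<close>

lemma diag_hor_fst:
  assumes "x \<ge> y" "F x y = N" "F (x + 1) y = N"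
  shows "conn (edge_lt F N) 2 (x, y) (x + 1, y)"
proof -
  obtain k where k: "y \<le> 2 * k" "2 * k \<le> x + 1" "F (x + 1) y = x + 1 - y + f k"
    by (rule diag_attained[OF F f, of y "x + 1"]) (use assms in auto)
  have "\<not> 2 * k \<le> x" using diag_le[OF F k(1), of x] k assms by auto
  then have e: "2 * k = x + 1" using k by simp
  have "F (x + 1) (y + 1) \<le> x + 1 - (y + 1) + f k" by (rule diag_le[OF F]) (use e assms in auto)
  then have "F (x + 1) (y + 1) < N" using k assms by simp
  then show ?thesis
    by (intro conn2[of _ _ "(x + 1, y + 1)"] edge_ltI) (use assms in auto)
qed

lemma diag_hor_diag:
  assumes "x \<ge> y" "F x y = N" "F (x + 1) (y + 1) = N"
  shows "conn (edge_lt F N) 3 (x, y) (x + 1, y + 1)"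
proof (cases "x = y")
  case eq: True
  show ?thesis
  proof (cases "even x")
    case True
    then obtain n where n: "x = 2 * n" by blast
    have "N = f n" "N = 1 + min (f n) (f (n + 1))"
      using assms diag_line[OF F f, of n] diag_mid[OF F f, of n] by (auto simp: n eq[symmetric])
    then have "f (n + 1) = N - 1" by auto
    then have "F (2 * (n + 1)) (2 * (n + 1)) < N" using diag_line[OF F f, of "n + 1"] by simp
    moreover have "2 * (n + 1) = x + 2" using n by simp
    ultimately have "F (x + 2) (y + 2) < N" using eq by simp
    then have "conn (edge_lt F N) 2 (x, y) (x + 1, y + 1)"
      by (intro conn2[of _ _ "(x + 2, y + 2)"] edge_ltI) (use assms in auto)
    then show ?thesis by (rule conn_mono) simp
  next
    case False
    then obtain n where n: "x = 2 * n + 1" by (auto elim: oddE)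
    have e: "x + 1 = 2 * (n + 1)" using n by simp
    have "F (x + 1) (y + 1) = f (n + 1)" unfolding eq[symmetric] e by (rule diag_line[OF F f])
    moreover have "F x y = 1 + min (f n) (f (n + 1))" unfolding eq[symmetric] n by (rule diag_mid[OF F f])
    ultimately have "N = f (n + 1)" "N = 1 + min (f n) (f (n + 1))" using assms by simp_all
    then have "f n = N - 1" by auto
    then have "F (2 * n) (2 * n) < N" using diag_line[OF F f, of "n"] by simp
    moreover have "x - 1 = 2 * n" "y - 1 = 2 * n" using eq n by auto
    ultimately have "F (x - 1) (y - 1) < N" by simp
    then have "conn (edge_lt F N) 2 (x, y) (x + 1, y + 1)"
      by (intro conn2[of _ _ "(x - 1, y - 1)"] edge_ltI) (use assms in auto)
    then show ?thesis by (rule conn_mono) simp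
  qed
next
  case False
  then have xy: "x \<ge> y + 1" using assms by simp
  obtain p where p: "y \<le> 2 * p" "2 * p \<le> x" "F x y = x - y + f p"
    by (rule diag_attained[OF F f, of y "x"]) (use xy in auto)
  obtain q where q: "y + 1 \<le> 2 * q" "2 * q \<le> x + 1" "F (x + 1) (y + 1) = x + 1 - (y + 1) + f q"
    by (rule diag_attained[OF F f, of "y + 1" "x + 1"]) (use xy in auto)
  show ?thesis
  proof (cases "2 * p \<ge> y + 1 \<or> 2 * q \<le> x")
    case True
    then have "F x (y + 1) < N"
      using diag_le[OF F, of "y + 1" p x] diag_le[OF F, of "y + 1" q x] p q assms by auto
    then have "conn (edge_lt F N) 2 (x, y) (x + 1, y + 1)"
      by (intro conn2[of _ _ "(x, y + 1)"] edge_ltI) (use assms in auto)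
    then show ?thesis by (rule conn_mono) simp
  next
    case False
    \<comment> \<open>Here \<open>2 * p = y\<close> and \<open>2 * q = x + 1\<close>: the two
      optimal entry points sit at opposite ends, and the lower points next to the two vertices
      differ by a d-step.\<close>
    have "F (x - 1) y < N" using diag_le[OF F, of y p "x - 1"] p False assms xy by auto
    moreover have "F (x + 1) (y + 2) < N" using diag_le[OF F, of "y + 2" q "x + 1"] q False assms xy by auto
    ultimately show ?thesis
      by (intro conn3[of _ _ "(x - 1, y)" "(x + 1, y + 2)"] edge_ltI) (use assms in auto)
  qed
qed

text \<open>Off the diagonal each end has a lower neighbour, to its left or above it. Neighbours of
  the same kind are joined by d, the inner mixed pair by c, and only the outer mixed pair needs the
  additional point \<open>(x, y + 1)\<close>, which may itself lie on level \<open>N\<close>. At odd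
  diagonal points the detour runs along the entry line.\<close>

lemma diag_hor_diag2:
  assumes "x \<ge> y" "x = y \<Longrightarrow> odd x" "F x y = N" "F (x + 2) (y + 2) = N"
  shows "conn (edge_lt F N) 4 (x, y) (x + 2, y + 2)"
proof (cases "x = y")
  case eq: True
  then obtain n where n: "x = 2 * n + 1" using assms by (auto elim: oddE)
  have e: "x - 1 = 2 * n" "x + 1 = 2 * (n + 1)" "x + 2 = 2 * (n + 1) + 1" "x + 3 = 2 * (n + 2)" using n by simp_all
  have L: "F (x - 1) (y - 1) = f n" "F (x + 1) (y + 1) = f (n + 1)" "F (x + 3) (y + 3) = f (n + 2)"
    unfolding eq[symmetric] e by (rule diag_line[OF F f])+
  have "F x y = 1 + min (f n) (f (n + 1))" unfolding eq[symmetric] n by (rule diag_mid[OF F f])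
  moreover have "F (x + 2) (y + 2) = 1 + min (f (n + 1)) (f (n + 2))"
    unfolding eq[symmetric] e using diag_mid[OF F f, of "n + 1"] by (simp add: algebra_simps)
  ultimately consider "f (n + 1) < N" | "f n = N - 1" "f (n + 2) = N - 1"
    using assms(3,4) by linarith
  then show ?thesis
  proof cases
    case 1
    then have "conn (edge_lt F N) 2 (x, y) (x + 2, y + 2)"
      by (intro conn2[of _ _ "(x + 1, y + 1)"] edge_ltI) (use assms(3,4) L in auto)
    then show ?thesis by (rule conn_mono) simp
  next
    case 2
    then have "f (n + 1) \<le> N" using nonexpD[OF f, of "n + 1" n] by simp
    then show ?thesis
      by (intro conn4[of _ _ "(x - 1, y - 1)" "(x + 1, y + 1)" "(x + 3, y + 3)"] edge_ltI) (use assms(3,4) L 2 in auto)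
  qed
next
  case False
  then have xy: "x \<ge> y + 1" using assms(1) by simp
  obtain p where p: "y \<le> 2 * p" "2 * p \<le> x" "F x y = x - y + f p"
    by (rule diag_attained[OF F f, of y "x"]) (use xy in auto)
  obtain q where q: "y + 2 \<le> 2 * q" "2 * q \<le> x + 2" "F (x + 2) (y + 2) = x + 2 - (y + 2) + f q"
    by (rule diag_attained[OF F f, of "y + 2" "x + 2"]) (use xy in auto)
  have 1: "F x (y + 1) < N \<or> F (x - 1) y < N"
  proof (cases "2 * p \<le> x - 1")
    case True
    then show ?thesis using diag_le[OF F p(1) True] p(3) assms(3) by simp
  next
    case False
    then have "y + 1 \<le> 2 * p" using p xy by simp
    from diag_le[OF F this p(2)] show ?thesis using p(3) assms(3) by simp
  qed
  have 2: "F (x + 2) (y + 3) < N \<or> F (x + 1) (y + 2) < N"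
  proof (cases "2 * q \<le> x + 1")
    case True
    then show ?thesis using diag_le[OF F q(1) True] q(3) assms(4) by simp
  next
    case False
    then have "y + 3 \<le> 2 * q" using q xy by simp
    from diag_le[OF F this q(2)] show ?thesis using q(3) assms(4) by simp
  qed
  consider "F x (y + 1) < N" "F (x + 2) (y + 3) < N" | "F (x - 1) y < N" "F (x + 1) (y + 2) < N"
    | "F x (y + 1) < N" "F (x + 1) (y + 2) < N" | "F (x - 1) y < N" "F (x + 2) (y + 3) < N"
    using 1 2 by blast
  then show ?thesis
  proof cases
    case 1
    then have "conn (edge_lt F N) 3 (x, y) (x + 2, y + 2)"
      by (intro conn3[of _ _ "(x, y + 1)" "(x + 2, y + 3)"] edge_ltI) (use assms(1,3,4) in auto)
    then show ?thesis by (rule conn_mono) simp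
  next
    case 2
    then have "conn (edge_lt F N) 3 (x, y) (x + 2, y + 2)"
      by (intro conn3[of _ _ "(x - 1, y)" "(x + 1, y + 2)"] edge_ltI) (use assms(1,3,4) in auto)
    then show ?thesis by (rule conn_mono) simp
  next
    case 3
    then have "conn (edge_lt F N) 3 (x, y) (x + 2, y + 2)"
      by (intro conn3[of _ _ "(x, y + 1)" "(x + 1, y + 2)"] edge_ltI) (use assms(1,3,4) in auto)
    then show ?thesis by (rule conn_mono) simp
  next
    case 4
    then have "F x (y + 1) \<le> N" using inf_conv_step[OF F, of x "x - 1" "y + 1" y] by simp
    then show ?thesis
      by (intro conn4[of _ _ "(x - 1, y)" "(x, y + 1)" "(x + 2, y + 3)"] edge_ltI) (use assms(3,4) 4 in auto)
  qed
qed

lemma diag_mono_fst: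
  assumes "x \<ge> y"
  shows "F x y \<le> F (x + 1) y"
proof -
  obtain k where k: "y \<le> 2 * k" "2 * k \<le> x + 1" "F (x + 1) y = x + 1 - y + f k"
    by (rule diag_attained[OF F f, of y "x + 1"]) (use assms in auto)
  show ?thesis
  proof (cases "2 * k \<le> x")
    case True
    then show ?thesis using diag_le[OF F k(1), of x] k assms by auto
  next
    case False
    then have e: "2 * k = x + 1" using k by simp
    have "F x y \<le> f k + nrm (-1) (y - k * 2)" by (rule inf_conv_le'[OF F]) (use e in auto)
    moreover have "nrm (-1) (y - k * 2) \<le> - (y - k * 2)"
      by (rule nrm_neg_one) (use e assms in auto)
    ultimately show ?thesis using k e by simp
  qed
qed

lemma diag_mono_hub: 
  assumes "x \<ge> y + 1" "F x y = N + 1" "F (x + 2) (y + 2) \<le> N"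
  shows "F x (y + 1) \<le> N"
proof -
  obtain q where q: "y + 2 \<le> 2 * q" "2 * q \<le> x + 2" "F (x + 2) (y + 2) = x + 2 - (y + 2) + f q"
    by (rule diag_attained[OF F f, of "y + 2" "x + 2"]) (use assms in auto)
  have "\<not> 2 * q \<le> x" using diag_le[OF F, of y q x] q assms by auto
  show ?thesis
  proof (cases "2 * q - 2 \<ge> y + 1")
    case True
    then show ?thesis
      using diag_le[OF F, of "y + 1" "q - 1" x] nonexpD[OF f, of "q - 1" q] q assms by auto
  next
    case False
    then have e: "x = 2 * q - 1" "y = 2 * q - 2" using q \<open>\<not> 2 * q \<le> x\<close> assms by auto
    have "F x (y + 1) \<le> f q + nrm (-1) (-1)" by (rule inf_conv_le'[OF F]) (use e in auto)
    then show ?thesis using q e assms by simp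
  qed
qed

end

section \<open>Peaks in a copy entered through a d-line\<close>

context
  fixes f F
  assumes F: "inf_conv f 2 2 F" and f: "nonexp f"
begin

private lemma F': "inf_conv (\<lambda>n. f (- n)) 2 2 (\<lambda>x y. F (- y) (- x))"
  by (rule inf_conv_antiswap[OF F])

private lemma f': "nonexp (\<lambda>n. f (- n))"
  by (rule nonexp_neg[OF f])

lemma diag_hor_snd:
  assumes "x \<ge> y + 1" "F x y = N" "F x (y + 1) = N"
  shows "conn (edge_lt F N) 2 (x, y) (x, y + 1)"
proof -
  have "conn (edge_lt (\<lambda>x y. F (- y) (- x)) N) 2 (- (y + 1), - x) (- (y + 1) + 1, - x)"
  proof (rule diag_hor_fst[OF F' f'])
    show "- x \<le> - (y + 1)" using assms(1) by linarith
    show "F (- (- x)) (- (- (y + 1))) = N" using assms(3) by (simp only: minus_minus)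
    have "- (- (y + 1) + 1) = y" by simp
    then show "F (- (- x)) (- (- (y + 1) + 1)) = N" using assms(2) by (simp only: minus_minus)
  qed
  then have "conn (edge_lt (\<lambda>x y. F (- y) (- x)) N) 2 (- (y + 1), - x) (- y, - x)" by simp
  then have "conn (edge_lt F N) 2 (x, y + 1) (x, y)"
    by (rule conn_lt_antiswap)
  then show ?thesis by (rule conn_sym[rotated]) (rule edge_lt_sym)
qed

lemma diag_mono_snd: "x \<ge> y \<Longrightarrow> F x y \<le> F x (y - 1)"
  using diag_mono_fst[OF F' f', of "- x" "- y"] by (simp add: algebra_simps)

lemma diag_mono_hub':
  assumes "x \<ge> y + 1" "F x y = N + 1" "F (x - 2) (y - 2) \<le> N"
  shows "F (x - 1) y \<le> N"
  using diag_mono_hub[OF F' f', of "- x" "- y" N] assms by (simp add: algebra_simps)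

text \<open>By monotonicity, a lower neighbour in any direction implies that one of the two points
  nearer to the diagonal, \<open>(x - 1, y)\<close> or \<open>(x, y + 1)\<close>, is low as well and
  close to it. These two hubs differ by a c-step.\<close>

lemma diag_peak_hub:
  assumes x: "x \<ge> y + 1" "F x y = N + 1" and g: "isgen p q" "F (x + p) (y + q) \<le> N"
  shows "(F (x - 1) y \<le> N \<and> conn (edge_le F N) 2 (x + p, y + q) (x - 1, y)) \<or>
    (F x (y + 1) \<le> N \<and> conn (edge_le F N) 2 (x + p, y + q) (x, y + 1))"
proof -
  from g(1) show ?thesis
  proof (cases rule: isgen_cases)
    case 1
    then show ?thesis using diag_mono_fst[OF F f, of y x] x g by simp
  next
    case 2
    then show ?thesis using g by (simp add: conn_refl)
  next
    case 3
    then show ?thesis using g by (simp add: conn_refl)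
  next
    case 4
    then show ?thesis using diag_mono_snd[of y x] x g by simp
  next
    case 5
    then have "F x (y + 1) \<le> N" using diag_mono_fst[OF F f, of "y + 1" x] x g by simp
    moreover have "conn (edge_le F N) 1 (x + 1, y + 1) (x, y + 1)"
      by (intro conn_edge edge_leI) (use 5 g calculation in auto)
    ultimately show ?thesis using 5 conn_mono[of "edge_le F N" 1 "(x + 1, y + 1)" "(x, y + 1)" 2] by simp
  next
    case 6
    then have "F (x - 1) y \<le> N" using diag_mono_snd[of y "x - 1"] x g by simp
    moreover have "conn (edge_le F N) 1 (x - 1, y - 1) (x - 1, y)"
      by (intro conn_edge edge_leI) (use 6 g calculation in auto)
    ultimately show ?thesis using 6 conn_mono[of "edge_le F N" 1 "(x - 1, y - 1)" "(x - 1, y)" 2] by simp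
  next
    case 7
    then have "F x (y + 1) \<le> N" using diag_mono_hub[OF F f, of y x N] x g by simp
    moreover have "F (x + 1) (y + 2) \<le> N" using diag_mono_fst[OF F f, of "y + 2" "x + 1"] x g 7 by (simp add: add.commute)
    ultimately have "conn (edge_le F N) 2 (x + 2, y + 2) (x, y + 1)"
      by (intro conn2[of _ _ "(x + 1, y + 2)"] edge_leI) (use 7 g in auto)
    with \<open>F x (y + 1) \<le> N\<close> show ?thesis using 7 by auto
  next
    case 8
    then have "F (x - 1) y \<le> N" using diag_mono_hub'[of y x N] x g by simp
    moreover have "F (x - 2) (y - 1) \<le> N" using diag_mono_snd[of "y - 1" "x - 2"] x g 8 by (simp add: algebra_simps)
    ultimately have "conn (edge_le F N) 2 (x - 2, y - 2) (x - 1, y)"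
      by (intro conn2[of _ _ "(x - 2, y - 1)"] edge_leI) (use 8 g in auto)
    with \<open>F (x - 1) y \<le> N\<close> show ?thesis using 8 by auto
  qed
qed

text \<open>At an odd diagonal point the hubs are its two neighbours on the entry line, joined by a
  d-edge.\<close>

lemma diag_peak_hub_mid:
  assumes x: "F (2 * n + 1) (2 * n + 1) = N + 1" and g: "isgen p q" "F (2 * n + 1 + p) (2 * n + 1 + q) \<le> N"
  shows "(f n \<le> N \<and> conn (edge_le F N) 2 (2 * n + 1 + p, 2 * n + 1 + q) (2 * n, 2 * n)) \<or>
    (f (n + 1) \<le> N \<and> conn (edge_le F N) 2 (2 * n + 1 + p, 2 * n + 1 + q) (2 * (n + 1), 2 * (n + 1)))"
proof -
  note L = diag_line[OF F f, of n] diag_line[OF F f, of "n + 1"]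
  have m: "min (f n) (f (n + 1)) = N" using diag_mid[OF F f, of n] x by simp
  from g(1) show ?thesis
  proof (cases rule: isgen_cases)
    case 1
    then show ?thesis using diag_mono_fst[OF F f, of "2 * n + 1" "2 * n + 1"] x g by simp
  next
    case 2
    then show ?thesis using diag_mono_snd[of "2 * n + 1" "2 * n + 1"] diag_mono_fst[OF inf_conv_swap[OF F'] f', of "- (2 * n + 1)" "- (2 * n + 1)"] x g
      by (simp add: algebra_simps)
  next
    case 3
    then show ?thesis using diag_mono_fst[OF inf_conv_swap[OF F] f, of "2 * n + 1" "2 * n + 1"] x g by simp
  next
    case 4
    then show ?thesis using diag_mono_snd[of "2 * n + 1" "2 * n + 1"] x g by simp
  next
    case 5
    have e: "2 * n + 1 + 1 = 2 * (n + 1)" by simp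
    show ?thesis using g L unfolding 5 e by (simp add: conn_refl)
  next
    case 6
    then show ?thesis using g L by (simp add: conn_refl)
  next
    case 7
    have "F (2 * (n + 1) + 1) (2 * (n + 1) + 1) = 1 + min (f (n + 1)) (f (n + 1 + 1))" by (rule diag_mid[OF F f])
    moreover have "2 * n + 1 + 2 = 2 * (n + 1) + 1" by simp
    ultimately have "1 + min (f (n + 1)) (f (n + 1 + 1)) \<le> N" using g(2) unfolding 7 by simp
    then have "f (n + 1) \<le> N" using m nonexpD[OF f, of "n + 1" "n + 1 + 1"] by (auto simp: min_def split: if_splits)
    moreover have "conn (edge_le F N) 1 (2 * n + 1 + p, 2 * n + 1 + q) (2 * (n + 1), 2 * (n + 1))"
      by (intro conn_edge edge_leI) (use g calculation L in \<open>simp_all add: 7\<close>)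
    then have "conn (edge_le F N) 2 (2 * n + 1 + p, 2 * n + 1 + q) (2 * (n + 1), 2 * (n + 1))"
      by (rule conn_mono) simp
    ultimately show ?thesis by blast
  next
    case 8
    have "F (2 * (n - 1) + 1) (2 * (n - 1) + 1) = 1 + min (f (n - 1)) (f (n - 1 + 1))" by (rule diag_mid[OF F f])
    moreover have "2 * n + 1 + - 2 = 2 * (n - 1) + 1" by simp
    ultimately have "1 + min (f (n - 1)) (f n) \<le> N" using g(2) unfolding 8 by simp
    then have "f n \<le> N" using m nonexpD[OF f, of "n - 1" n] by (auto simp: min_def split: if_splits)
    moreover have "conn (edge_le F N) 1 (2 * n + 1 + p, 2 * n + 1 + q) (2 * n, 2 * n)"
      by (intro conn_edge edge_leI) (use g calculation L in \<open>simp_all add: 8\<close>)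
    then have "conn (edge_le F N) 2 (2 * n + 1 + p, 2 * n + 1 + q) (2 * n, 2 * n)"
      by (rule conn_mono) simp
    ultimately show ?thesis by blast
  qed
qed

end

lemma conn_via_hubs:
  assumes sym: "\<And>u v. E u v \<Longrightarrow> E v u"
    and "conn E k u h" "conn E k v h'" "conn E l h h'" 
  shows "conn E (k + (l + k)) u v"
  using assms(2) conn_trans[OF assms(4) conn_sym[OF sym assms(3)]] by (rule conn_trans)

text \<open>The link between the hubs is needed only if the neighbours \<open>u\<close> and
  \<open>v\<close> lead to different hubs; then both hubs are known to be low, which is why
  \<open>ab\<close> may assume \<open>P\<close> and \<open>Q\<close>.\<close>

lemma conn_two_hubs:
  assumes sym: "\<And>u v. E u v \<Longrightarrow> E v u"
    and u: "(P \<and> conn E k u a) \<or> (Q \<and> conn E k u b)"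
    and v: "(P \<and> conn E k v a) \<or> (Q \<and> conn E k v b)"
    and ab: "P \<Longrightarrow> Q \<Longrightarrow> conn E l a b"
  shows "conn E (k + (l + k)) u v"
  using u
proof (elim disjE conjE)
  assume u: P "conn E k u a"
  from v show ?thesis
  proof (elim disjE conjE)
    assume "conn E k v a"
    from conn_via_hubs[OF sym u(2) this conn_refl] show ?thesis .
  next
    assume Q "conn E k v b"
    from conn_via_hubs[OF sym u(2) this(2) ab[OF u(1) this(1)]] show ?thesis .
  qed
next
  assume u: Q "conn E k u b"
  from v show ?thesis
  proof (elim disjE conjE)
    assume "conn E k v b"
    from conn_via_hubs[OF sym u(2) this conn_refl] show ?thesis .
  next
    assume P "conn E k v a"
    from conn_via_hubs[OF sym u(2) this(2) conn_sym[OF sym ab[OF this(1) u(1)]]] show ?thesis .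
  qed
qed

lemma diag_peak_ge:
  assumes F: "inf_conv f 2 2 F" and f: "nonexp f"
    and x: "x \<ge> y" "x = y \<Longrightarrow> odd x" "F x y = N + 1" 
    and g: "isgen p q" "F (x + p) (y + q) \<le> N" and g': "isgen p' q'" "F (x + p') (y + q') \<le> N"
  shows "conn (edge_le F N) 5 (x + p, y + q) (x + p', y + q')"
proof (cases "x = y")
  case True
  then obtain n where n: "x = 2 * n + 1" "y = 2 * n + 1" using x(2) by (auto elim: oddE)
  have e: "conn (edge_le F N) 1 (2 * n, 2 * n) (2 * (n + 1), 2 * (n + 1))" if "f n \<le> N" "f (n + 1) \<le> N"
    by (rule conn_edge, rule edge_leI) (use that diag_line[OF F f, of n] diag_line[OF F f, of "n + 1"] in simp_all)
  have "conn (edge_le F N) (2 + (1 + 2)) (x + p, y + q) (x + p', y + q')"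
    unfolding n by (rule conn_two_hubs[OF edge_le_sym diag_peak_hub_mid[OF F f x(3)[unfolded n] g[unfolded n]]
      diag_peak_hub_mid[OF F f x(3)[unfolded n] g'[unfolded n]] e])
  then show ?thesis by simp
next
  case False
  then have xy: "x \<ge> y + 1" using x(1) by simp
  have e: "conn (edge_le F N) 1 (x - 1, y) (x, y + 1)" if "F (x - 1) y \<le> N" "F x (y + 1) \<le> N"
    by (rule conn_edge, rule edge_leI) (use that in simp_all)
  have "conn (edge_le F N) (2 + (1 + 2)) (x + p, y + q) (x + p', y + q')"
    by (rule conn_two_hubs[OF edge_le_sym diag_peak_hub[OF F f xy x(3) g] diag_peak_hub[OF F f xy x(3) g'] e])
  then show ?thesis by simp
qed

definition on_diag :: "int \<Rightarrow> int \<Rightarrow> bool" where "on_diag x y \<longleftrightarrow> x = y \<and> even x"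

lemma on_diag_swap: "on_diag y x \<longleftrightarrow> on_diag x y"
  by (auto simp: on_diag_def)

theorem diag_peak:
  assumes F: "inf_conv f 2 2 F" and f: "nonexp f" and x: "\<not> on_diag x y" "F x y = N + 1" 
    and g: "isgen p q" "F (x + p) (y + q) \<le> N" and g': "isgen p' q'" "F (x + p') (y + q') \<le> N"
  shows "conn (edge_le F N) 5 (x + p, y + q) (x + p', y + q')"
proof (cases "x \<ge> y")
  case True
  show ?thesis
    by (rule diag_peak_ge[OF F f True _ x(2) g g']) (use x in \<open>simp add: on_diag_def\<close>)
next
  case False
  have "conn (edge_le (\<lambda>x y. F y x) N) 5 (y + q, x + p) (y + q', x + p')"
    by (rule diag_peak_ge[OF inf_conv_swap[OF F] f]) (use False x g g' isgen_swap[OF g(1)] isgen_swap[OF g'(1)] in simp_all)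
  then show ?thesis by (rule conn_le_swap)
qed

theorem diag_hor:
  assumes F: "inf_conv f 2 2 F" and f: "nonexp f" and g: "isgen p q" "F x y = N" "F (x + p) (y + q) = N" 
    and L: "\<not> (on_diag x y \<and> on_diag (x + p) (y + q))"
  shows "conn (edge_lt F N) 4 (x, y) (x + p, y + q)"
proof -
  have pos: "conn (edge_lt F N) 4 (x, y) (x + p, y + q)"
    if F: "inf_conv f 2 2 F" and g: "F x y = N" "F (x + p) (y + q) = N" 
      and L: "\<not> (on_diag x y \<and> on_diag (x + p) (y + q))"
      and pq: "(p, q) \<in> {(1, 0), (1, 1), (2, 2), (0, 1)}" and xy: "x \<ge> y" "(p, q) = (0, 1) \<Longrightarrow> x \<ge> y + 1"
    for F x y p q
  proof -
    from pq consider "p = 1" "q = 0" | "p = 1" "q = 1" | "p = 2" "q = 2" | "p = 0" "q = 1" by auto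
    then show ?thesis
    proof cases
      case 1
      then show ?thesis using conn_mono[OF diag_hor_fst[OF F f, of y x N], of 4] g xy by simp
    next
      case 2
      then show ?thesis using conn_mono[OF diag_hor_diag[OF F f, of y x N], of 4] g xy by simp
    next
      case 3
      then show ?thesis using conn_mono[OF diag_hor_diag2[OF F f, of y x N], of 4] g xy L by (simp add: on_diag_def)
    next
      case 4
      then show ?thesis using conn_mono[OF diag_hor_snd[OF F f, of y x N], of 4] g xy by simp
    qed
  qed
  have pos': "conn (edge_lt F N) 4 (x, y) (x + p, y + q)"
    if g: "F x y = N" "F (x + p) (y + q) = N" 
      and L: "\<not> (on_diag x y \<and> on_diag (x + p) (y + q))"
      and pq: "(p, q) \<in> {(1, 0), (1, 1), (2, 2), (0, 1)}"
    for x y p q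
  proof (cases "x \<ge> y \<and> ((p, q) = (0, 1) \<longrightarrow> x \<ge> y + 1)")
    case True
    then show ?thesis by (intro pos[OF F g L pq]) simp_all
  next
    case False
    have "conn (edge_lt (\<lambda>x y. F y x) N) 4 (y, x) (y + q, x + p)"
    proof (rule pos[OF inf_conv_swap[OF F]])
      show "F x y = N" "F (x + p) (y + q) = N" by fact+
      show "\<not> (on_diag y x \<and> on_diag (y + q) (x + p))" using L by (simp only: on_diag_swap not_False_eq_True)
      show "(q, p) \<in> {(1, 0), (1, 1), (2, 2), (0, 1)}" using pq by (elim insertE emptyE) simp_all
      show "x \<le> y" using False by auto
      show "x + 1 \<le> y" if "(q, p) = (0, 1)" using False that by auto
    qed
    then show ?thesis by (rule conn_lt_swap)
  qed
  show ?thesis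
  proof (cases "(p, q) \<in> {(1, 0), (1, 1), (2, 2), (0, 1)}")
    case True
    show ?thesis by (rule pos'[OF g(2,3) L True])
  next
    case False
    have "(- p, - q) \<in> {(1, 0), (1, 1), (2, 2), (0, 1)}"
      using g(1) False unfolding isgen_def by (elim insertE emptyE) simp_all
    moreover have e: "x + p + - p = x" "y + q + - q = y" by simp_all
    have "conn (edge_lt F N) 4 (x + p, y + q) (x + p + - p, y + q + - q)"
      by (rule pos'[OF g(3) _ _ calculation], unfold e) (use g(2) L in blast)+
    then have "conn (edge_lt F N) 4 (x + p, y + q) (x, y)" by simp
    then show ?thesis by (rule conn_sym[rotated]) (rule edge_lt_sym)
  qed
qed

section \<open>Copies entered through a line in the direction of a\<close>

text \<open>The route uses d-steps, one c-step if \<open>m\<close> is odd, and b-steps for the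
  remaining height; each pair of horizontal units saves one step.\<close>

lemma nrm_upper: "0 \<le> m \<Longrightarrow> m \<le> y \<Longrightarrow> nrm m y = y - m div 2"
proof -
  assume a: "0 \<le> m" "m \<le> y"
  then have "m - y div 2 \<le> y - m div 2" "(y + 1) div 2 - m \<le> y - m div 2" "(m + 1) div 2 - y \<le> y - m div 2"
    "m - y \<le> y - m div 2" "y - m \<le> y - m div 2"
    by presburger+
  then have "nrm m y \<le> y - m div 2" unfolding nrm_le_iff by (intro conjI) simp_all
  moreover have "y - m div 2 \<le> nrm m y" using nrm_lower by blast
  ultimately show ?thesis by simp
qed

context
  fixes f F
  assumes F: "inf_conv f 1 0 F" and f: "nonexp f"
begin

lemma fst_le: "0 \<le> m \<Longrightarrow> m \<le> y \<Longrightarrow> F x y \<le> y - m div 2 + f (x - m)"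
  using inf_conv_le'[OF F, of m x "x - m" y y] nrm_upper[of m y] by simp

text \<open>Above an a-line, entering further left by \<open>m\<close> saves \<open>m div 2\<close>
  steps, to be weighed against the change of \<open>f\<close>. This balance is what makes the slope
  1/2 critical. Entry points outside the range are replaced by \<open>m = 0\<close> or
  \<open>m = y\<close>.\<close>

lemma fst_attained:
  assumes "y \<ge> 0"
  obtains m where "0 \<le> m" "m \<le> y" "F x y = y - m div 2 + f (x - m)"
proof -
  obtain n where n: "F x y = f n + nrm (x - n * 1) (y - n * 0)" by (rule inf_conv_attained[OF F])
  then have n: "F x y = f n + nrm (x - n) y" by simp
  have "\<exists>m. 0 \<le> m \<and> m \<le> y \<and> y - m div 2 + f (x - m) \<le> F x y"
  proof -
    consider "n \<le> x" "x - n \<le> y" | "x < n" | "x - n > y" by linarith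
    then show ?thesis
    proof cases
      case 1
      then show ?thesis using n nrm_upper[of "x - n" y] by (intro exI[of _ "x - n"]) simp
    next
      case 2
      have "y - (x - n) \<le> nrm (x - n) y" using nrm_lower by blast
      then show ?thesis using 2 n assms nonexpD[OF f, of x n] by (intro exI[of _ 0]) simp
    next
      case 3
      have "x - n - y div 2 \<le> nrm (x - n) y" using nrm_lower by blast
      then show ?thesis using 3 n assms nonexpD[OF f, of "x - y" n] by (intro exI[of _ y]) simp
    qed
  qed
  then obtain m where "0 \<le> m" "m \<le> y" "y - m div 2 + f (x - m) \<le> F x y" by blast
  with fst_le[of m y x] that[of m] show ?thesis by simp
qed

lemma fst_line: "F x 0 = f x"
  using fst_attained[of 0 x] fst_le[of 0 0 x] by auto

lemma fst_one: "F x 1 = 1 + min (f x) (f (x - 1))"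
proof -
  have y: "(1::int) \<ge> 0" by simp
  obtain m where m: "0 \<le> m" "m \<le> 1" "F x 1 = 1 - m div 2 + f (x - m)" by (rule fst_attained[OF y])
  then have "m = 0 \<or> m = 1" by auto
  then show ?thesis using m fst_le[of 0 1 x] fst_le[of 1 1 x] by auto
qed

lemma fst_hor_diag:
  assumes "y \<ge> 0" "F x y = N" "F (x + 1) (y + 1) = N"
  shows "conn (edge_lt F N) 2 (x, y) (x + 1, y + 1)"
proof -
  have y: "y + 1 \<ge> 0" using assms by simp
  obtain m where m: "0 \<le> m" "m \<le> y + 1" "F (x + 1) (y + 1) = y + 1 - m div 2 + f (x + 1 - m)"
    by (rule fst_attained[OF y])
  have sh: "x - (m - 1) = x + 1 - m" "x - 1 - (m - 2) = x + 1 - m" "(m - 2) div 2 = m div 2 - 1" by auto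
  have "m = 0 \<or> odd m \<or> even m \<and> m \<ge> 2" using m(1) by presburger
  then consider "m = 0" | "odd m" | "even m" "m \<ge> 2" by blast
  then show ?thesis
  proof cases
    case 1
    then have "F (x + 1) y < N" using fst_le[of 0 y "x + 1"] m assms by simp
    then show ?thesis
      by (intro conn2[of _ _ "(x + 1, y)"] edge_ltI) (use assms in auto)
  next
    case 2
    \<comment> \<open>An odd \<open>m\<close> is impossible: from the same entry point
      \<open>(x, y)\<close> would be reached in fewer than \<open>N\<close> steps.\<close>
    then have "1 \<le> m" "(m - 1) div 2 = m div 2" using m by presburger+
    then show ?thesis using fst_le[of "m - 1" y x] m assms unfolding sh by simp
  next
    case 3
    then have "F (x - 1) (y - 1) < N" using fst_le[of "m - 2" "y - 1" "x - 1"] m assms unfolding sh by simp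
    then show ?thesis
      by (intro conn2[of _ _ "(x - 1, y - 1)"] edge_ltI) (use assms in auto)
  qed
qed

text \<open>An optimal \<open>k \<ge> 2\<close> for the upper end would put the lower end below
  level \<open>N\<close>. So \<open>k \<le> 1\<close>, the upper end descends by b, and so does the
  lower end unless it is on the entry line; the d-edge is then pushed down by one b-step.\<close>

lemma fst_hor_diag2:
  assumes "y \<ge> 0" "F x y = N" "F (x + 2) (y + 2) = N"
  shows "conn (edge_lt F N) 3 (x, y) (x + 2, y + 2)"
proof -
  have y2: "y + 2 \<ge> 0" using assms by simp
  obtain k where k: "0 \<le> k" "k \<le> y + 2" "F (x + 2) (y + 2) = y + 2 - k div 2 + f (x + 2 - k)"
    by (rule fst_attained[OF y2])
  obtain m where m: "0 \<le> m" "m \<le> y" "F x y = y - m div 2 + f (x - m)"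
    by (rule fst_attained[OF assms(1)])
  have sh: "x - (k - 2) = x + 2 - k" "(k - 2) div 2 = k div 2 - 1" by auto
  have "\<not> k \<ge> 2"
  proof
    assume "k \<ge> 2"
    then show False using fst_le[of "k - 2" y x] k assms unfolding sh by simp
  qed
  then have k0: "k div 2 = 0" "k \<le> 1" using k by auto
  have v: "F (x + 2) (y + 1) < N" using fst_le[of k "y + 1" "x + 2"] k assms k0 by simp
  show ?thesis
  proof (cases "y = 0")
    case True
    have "F (x + 1) (y + 1) < N \<or> f (x + 1) < N"
      using nonexpD[OF f, of "x + 1" "x + 2 - k"] k k0 assms True by auto
    moreover have fx: "f x = N" using fst_line assms True by simp
    ultimately have "F (x + 1) 0 < N \<or> F (x + 1) 1 < N" using fst_line True by auto
    moreover have "F (x + 1) 0 < N" if "F (x + 1) 1 < N"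
      using that fst_one[of "x + 1"] fx nonexpD[OF f, of "x + 1" x] by auto
    ultimately have "F (x + 1) 0 < N" by blast
    then show ?thesis
      by (intro conn3[of _ _ "(x + 1, 0)" "(x + 2, y + 1)"] edge_ltI) (use assms v True in auto)
  next
    case False
    have "F x (y - 1) < N"
    proof (cases "m < y")
      case True
      then show ?thesis using fst_le[of m "y - 1" x] m assms by simp
    next
      case False
      have "f x \<le> N - y" using nonexpD[OF f, of x "x + 2 - k"] k k0 assms by auto
      then show ?thesis using fst_le[of 0 "y - 1" x] \<open>y \<noteq> 0\<close> assms by simp
    qed
    then show ?thesis
      by (intro conn3[of _ _ "(x, y - 1)" "(x + 2, y + 1)"] edge_ltI) (use assms v in auto)
  qed
qed

end

context
  fixes f F
  assumes F: "inf_conv f 1 0 F" and f: "nonexp f"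
begin

private lemma le: "0 \<le> m \<Longrightarrow> m \<le> y \<Longrightarrow> m' = x - m \<Longrightarrow> F x y \<le> y - m div 2 + f m'"
  using fst_le[OF F f, of m y x] by simp

text \<open>For \<open>y \<ge> 2\<close> short detours exist if both ends descend by b, or both by
  d, or the left end by b and the right one by d. In the remaining configuration the left end is
  known to descend only by d (\<open>m = y\<close>) and the right one only by b
  (\<open>k \<le> 1\<close>); except for \<open>y = 2\<close> with \<open>k = 1\<close>, scale 2 of
  \<open>f\<close> supplies a further descent.\<close>

lemma fst_hor_fst:
  assumes y: "y \<ge> 1" and N: "F x y = N" "F (x + 1) y = N" and t: "tame 2 f"
  shows "conn (edge_lt F N) 4 (x, y) (x + 1, y)"
proof (cases "y = 1")
  case True
  have e: "F x 1 = 1 + min (f x) (f (x - 1))" "F (x + 1) 1 = 1 + min (f (x + 1)) (f x)"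
    using fst_one[OF F f, of x] fst_one[OF F f, of "x + 1"] by simp_all
  note L = fst_line[OF F f, of x] fst_line[OF F f, of "x + 1"] fst_line[OF F f, of "x - 1"]
  show ?thesis
  proof (cases "f x < N")
    case lt: True
    then have "conn (edge_lt F N) 2 (x, y) (x + 1, y)"
      by (intro conn2[of _ _ "(x, 0)"] edge_ltI) (use True N L in auto)
    then show ?thesis by (rule conn_mono) simp
  next
    case False
    moreover have "1 + min (f x) (f (x - 1)) = N" "1 + min (f (x + 1)) (f x) = N"
      using e N unfolding True by auto
    ultimately have "f (x - 1) = N - 1" "f (x + 1) = N - 1" by linarith+
    moreover have "f x \<le> N" using nonexpD[OF f, of x "x - 1"] calculation by simp
    ultimately show ?thesis
      by (intro conn4[of _ _ "(x - 1, 0)" "(x, 0)" "(x + 1, 0)"] edge_ltI) (use True N L in auto)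
  qed
next
  case False
  then have y2: "y \<ge> 2" using y by simp
  have y0: "y \<ge> 0" using y by simp
  obtain m where m: "0 \<le> m" "m \<le> y" "F x y = y - m div 2 + f (x - m)"
    by (rule fst_attained[OF F f y0])
  obtain k where k: "0 \<le> k" "k \<le> y" "F (x + 1) y = y - k div 2 + f (x + 1 - k)"
    by (rule fst_attained[OF F f y0])
  have md: "F (x - 2) (y - 2) < N" if "m \<ge> 2"
    using le[of "m - 2" "y - 2" "x - m" "x - 2"] that m N by simp
  have kd: "F (x - 1) (y - 2) < N" if "k \<ge> 2"
    using le[of "k - 2" "y - 2" "x + 1 - k" "x - 1"] that k N by simp
  have mb: "F x (y - 1) < N" if "m < y"
    using le[of m "y - 1" "x - m" "x"] that m N by simp
  have kb: "F (x + 1) (y - 1) < N" if "k < y"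
    using le[of k "y - 1" "x + 1 - k" "x + 1"] that k N by simp
  have dd: ?thesis if "F (x - 2) (y - 2) < N" "F (x - 1) (y - 2) < N"
  proof (rule conn_mono)
    show "conn (edge_lt F N) 3 (x, y) (x + 1, y)"
      by (intro conn3[of _ _ "(x - 2, y - 2)" "(x - 1, y - 2)"] edge_ltI) (use N that in auto)
  qed simp
  have bb: ?thesis if "F x (y - 1) < N" "F (x + 1) (y - 1) < N"
  proof (rule conn_mono)
    show "conn (edge_lt F N) 3 (x, y) (x + 1, y)"
      by (intro conn3[of _ _ "(x, y - 1)" "(x + 1, y - 1)"] edge_ltI) (use N that in auto)
  qed simp
  have bd: ?thesis if "F x (y - 1) < N" "F (x - 1) (y - 2) < N"
  proof (rule conn_mono)
    show "conn (edge_lt F N) 3 (x, y) (x + 1, y)"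
      by (intro conn3[of _ _ "(x, y - 1)" "(x - 1, y - 2)"] edge_ltI) (use N that in auto)
  qed simp
  consider "m < y" "k \<ge> 2" | "m < y" "k < y" | "m \<ge> 2" "k \<ge> 2" | "m = y" "k \<le> 1" using m k y2 by linarith
  then show ?thesis
  proof cases
    case 1
    then show ?thesis using bd mb kd by blast
  next
    case 2
    then show ?thesis using bb mb kb by blast
  next
    case 3
    then show ?thesis using dd md kd by blast
  next
    case 4
    then have k0: "k div 2 = 0" using k by simp
    show ?thesis
    proof (cases "k \<le> y - 2")
      case True
      \<comment> \<open>The left-hand side of this inequality bounds the sum of the levels of
        \<open>(x, y - 1)\<close> and \<open>(x - 1, y - 2)\<close> by \<open>2 * N - 1\<close>, so
        one of them is below \<open>N\<close>.\<close>
      have "f (x - 1 - k) + f (x - y + 2) \<le> f (x - y) + f (x - 1 - k + 2) + 1"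
        by (rule tameD[OF t]) (use True in simp)
      moreover have "x - 1 - k + 2 = x + 1 - k" by simp
      ultimately have tm: "f (x - 1 - k) + f (x - y + 2) \<le> f (x - y) + f (x + 1 - k) + 1" by simp
      have "F x (y - 1) \<le> y - 1 - (y - 2) div 2 + f (x - y + 2)" by (rule le) (use y2 in auto)
      moreover have "(y - 2) div 2 = y div 2 - 1" by simp
      moreover have "F (x - 1) (y - 2) \<le> y - 2 - k div 2 + f (x - 1 - k)" by (rule le) (use True k in auto)
      moreover have "F x y = y - y div 2 + f (x - y)" "F (x + 1) y = y + f (x + 1 - k)" using m k k0 4 by simp_all
      ultimately have "F x (y - 1) < N \<or> F (x - 1) (y - 2) < N"
        using tm k0 N by linarith
      then show ?thesis
      proof
        assume "F x (y - 1) < N"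
        then show ?thesis using bb kb 4 y2 by auto
      next
        assume "F (x - 1) (y - 2) < N"
        then show ?thesis using dd md 4 y2 by auto
      qed
    next
      case False
      then have e: "y = 2" "k = 1" using 4 y2 by auto
      have "F x (y - 1) \<le> y - 1 - 0 div 2 + f x" by (rule le) (use y2 in auto)
      then have "F x (y - 1) < N" using k N e by simp
      then show ?thesis using bb kb e by simp
    qed
  qed
qed

text \<open>The upper end can only be reached optimally with \<open>k = y + 1\<close>, so for
  \<open>y \<ge> 1\<close> it descends by d. A descent of the lower end by d or c lands next to it;
  if \<open>m = 0\<close> and \<open>y \<ge> 2\<close>, scale 2 of \<open>f\<close> provides the
  descent by d.\<close>

lemma fst_hor_snd:
  assumes y: "y \<ge> 0" and N: "F x y = N" "F x (y + 1) = N" and t: "tame 2 f"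
  shows "conn (edge_lt F N) 4 (x, y) (x, y + 1)"
proof -
  have y1: "y + 1 \<ge> 0" using y by simp
  obtain k where k: "0 \<le> k" "k \<le> y + 1" "F x (y + 1) = y + 1 - k div 2 + f (x - k)"
    by (rule fst_attained[OF F f y1])
  have "\<not> k \<le> y"
    using le[of k y "x - k" x] k N by auto
  then have ky: "k = y + 1" using k by simp
  note L = fst_line[OF F f]
  show ?thesis
  proof (cases "y = 0")
    case True
    then have "f (x - 1) < N" using k ky N by simp
    then have "conn (edge_lt F N) 2 (x, y) (x, y + 1)"
      by (intro conn2[of _ _ "(x - 1, 0)"] edge_ltI) (use True N L in auto)
    then show ?thesis by (rule conn_mono) simp
  next
    case False
    then have y1: "y \<ge> 1" using y by simp
    obtain m where m: "0 \<le> m" "m \<le> y" "F x y = y - m div 2 + f (x - m)"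
      by (rule fst_attained[OF F f y])
    have d: "(y - 1) div 2 = (y + 1) div 2 - 1" by presburger
    have kd: "F (x - 2) (y - 1) < N"
      using le[of "y - 1" "y - 1" "x - (y + 1)" "x - 2"] y1 k ky N d by simp
    have dd: ?thesis if "F (x - 2) (y - 2) < N"
    proof (rule conn_mono)
      show "conn (edge_lt F N) 3 (x, y) (x, y + 1)"
        by (intro conn3[of _ _ "(x - 2, y - 2)" "(x - 2, y - 1)"] edge_ltI) (use N kd that in auto)
    qed simp
    have cc: ?thesis if "F (x - 1) (y - 1) < N"
    proof (rule conn_mono)
      show "conn (edge_lt F N) 3 (x, y) (x, y + 1)"
        by (intro conn3[of _ _ "(x - 1, y - 1)" "(x - 2, y - 1)"] edge_ltI) (use N kd that in auto)
    qed simp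
    consider "m \<ge> 2" | "m = 1" | "m = 0" "y \<ge> 2" | "m = 0" "y = 1" using m y1 by linarith
    then show ?thesis
    proof cases
      case 1
      then have "F (x - 2) (y - 2) < N" using le[of "m - 2" "y - 2" "x - m" "x - 2"] m N by simp
      then show ?thesis by (rule dd)
    next
      case 2
      then have "F (x - 1) (y - 1) < N" using le[of 0 "y - 1" "x - 1" "x - 1"] m N y1 by simp
      then show ?thesis by (rule cc)
    next
      case 3
      have tm: "f (x - 2) + f (x - y - 1 + 2) \<le> f (x - y - 1) + f (x - 2 + 2) + 1"
        by (rule tameD[OF t]) (use y1 in simp)
      have e: "x - y - 1 + 2 = x - y + 1" "x - 2 + 2 = x" "x - y - 1 = x - (y + 1)" by auto
      note tm = tm[unfolded e(1,2), unfolded e(3)]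
      have "F x y \<le> y - (y - 1) div 2 + f (x - y + 1)" by (rule le) (use y1 in auto)
      moreover have "F (x - 2) (y - 2) \<le> y - 2 - 0 div 2 + f (x - 2)" by (rule le) (use 3 in auto)
      ultimately have "F (x - 2) (y - 2) < N" using tm m k ky 3 N d by simp
      then show ?thesis by (rule dd)
    next
      case 4
      then have fx: "f x = N - 1" "f (x - 2) = N - 1" using m k ky N by auto
      then have "f (x - 1) \<le> N" using nonexpD[OF f, of "x - 1" x] by simp
      then show ?thesis
        by (intro conn4[of _ _ "(x, 0)" "(x - 1, 0)" "(x - 2, 0)"] edge_ltI) (use 4 N L fx in auto)
    qed
  qed
qed

text \<open>At height 1 the hubs are the two points of the entry line from which the peak is reached
  by c and by b. The premise \<open>up\<close> concerns the other side of the line, where the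
  neighbour by the inverse of d lies.\<close>

lemma fst_peak_hub_one:
  assumes N: "F x 1 = N + 1" and g: "isgen p q" "F (x + p) (1 + q) \<le> N"
    and up: "F (x - 2) (- 1) = 1 + min (f (x - 2)) (f (x - 1))"
  shows "(F (x - 1) 0 \<le> N \<and> conn (edge_le F N) 2 (x + p, 1 + q) (x - 1, 0)) \<or>
    (F x 0 \<le> N \<and> conn (edge_le F N) 2 (x + p, 1 + q) (x, 0))"
proof -
  note L = fst_line[OF F f] and O = fst_one[OF F f]
  have fx: "f x \<ge> N" "f (x - 1) \<ge> N" using N O[of x] by auto
  have C1: "conn (edge_le F N) 2 u v" if "edge_le F N u v" for u v
    using conn_mono[OF conn_edge[of "edge_le F N", OF that], of 2] by simp
  from g(1) show ?thesis
  proof (cases rule: isgen_cases)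
    case 1
    then have "min (f (x + 1)) (f x) \<le> N - 1" using g O[of "x + 1"] by simp
    then have "f x \<le> N" using nonexpD[OF f, of x "x + 1"] by linarith
    then have "edge_le F N (x + 1, 1) (x, 0)" by (intro edge_leI) (use g 1 L in simp_all)
    then show ?thesis using C1 1 \<open>f x \<le> N\<close> L by simp
  next
    case 2
    then have "min (f (x - 1)) (f (x - 2)) \<le> N - 1" using g O[of "x - 1"] by simp
    then have "f (x - 1) \<le> N" using nonexpD[OF f, of "x - 1" "x - 2"] by linarith
    then have "edge_le F N (x - 1, 1) (x - 1, 0)" by (intro edge_leI) (use g 2 L in simp_all)
    then show ?thesis using C1 2 \<open>f (x - 1) \<le> N\<close> L by simp
  next
    case 3
    have y2: "(2::int) \<ge> 0" by simp
    obtain k where k: "0 \<le> k" "k \<le> 2" "F x 2 = 2 - k div 2 + f (x - k)"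
      by (rule fst_attained[OF F f y2])
    then have "k = 0 \<or> k = 1 \<or> k = 2" by auto
    then have "f (x - 2) \<le> N - 1" using k g 3 fx by auto
    then have a: "f (x - 1) \<le> N" "F (x - 1) 1 \<le> N" using nonexpD[OF f, of "x - 1" "x - 2"] O[of "x - 1"] by auto
    have "conn (edge_le F N) 2 (x, 2) (x - 1, 0)"
      by (intro conn2[of _ _ "(x - 1, 1)"] edge_leI) (use g 3 L a in simp_all)
    then show ?thesis using 3 a L by simp
  next
    case 4
    then show ?thesis using g by (simp add: conn_refl)
  next
    case 5
    have y2: "(2::int) \<ge> 0" by simp
    obtain k where k: "0 \<le> k" "k \<le> 2" "F (x + 1) 2 = 2 - k div 2 + f (x + 1 - k)"
      by (rule fst_attained[OF F f y2])
    then have "k = 0 \<or> k = 1 \<or> k = 2" by auto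
    then show ?thesis using k g 5 fx nonexpD[OF f, of "x + 1" x] by auto
  next
    case 6
    then show ?thesis using g by (simp add: conn_refl)
  next
    case 7
    have y2: "(3::int) \<ge> 0" by simp
    obtain k where k: "0 \<le> k" "k \<le> 3" "F (x + 2) 3 = 3 - k div 2 + f (x + 2 - k)"
      by (rule fst_attained[OF F f y2])
    then have "k = 0 \<or> k = 1 \<or> k = 2 \<or> k = 3" by auto
    then show ?thesis using k g 7 fx nonexpD[OF f, of "x + 2 - k" x] by auto
  next
    case 8
    then have "min (f (x - 2)) (f (x - 1)) \<le> N - 1" using g up by simp
    then have "f (x - 1) \<le> N" using nonexpD[OF f, of "x - 1" "x - 2"] by linarith
    then have "edge_le F N (x - 2, -1) (x - 1, 0)" by (intro edge_leI) (use g 8 L in simp_all)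
    then show ?thesis using C1 8 \<open>f (x - 1) \<le> N\<close> L by simp
  qed
qed

text \<open>The hubs are the points below the peak by b and by d. Neighbours by c and d cannot be
  lower. The neighbour by b descends through \<open>(x - 1, y)\<close>, which accounts for the third
  edge.\<close>

lemma fst_peak_hub:
  assumes y: "y \<ge> 2" and N: "F x y = N + 1" and g: "isgen p q" "F (x + p) (y + q) \<le> N"
  shows "(F x (y - 1) \<le> N \<and> conn (edge_le F N) 3 (x + p, y + q) (x, y - 1)) \<or>
    (F (x - 2) (y - 2) \<le> N \<and> conn (edge_le F N) 3 (x + p, y + q) (x - 2, y - 2))"
proof -
  have C1: "conn (edge_le F N) 3 u v" if "edge_le F N u v" for u v
    using conn_mono[OF conn_edge[of "edge_le F N", OF that], of 3] by simp
  have low: "N + 1 \<le> y - m div 2 + f m'" if "0 \<le> m" "m \<le> y" "m' = x - m" for m m'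
    using le[OF that] N by simp
  have left: "F (x - 2) (y - 2) \<le> N \<and> conn (edge_le F N) 2 (x - 1, y) (x - 2, y - 2)" if g: "F (x - 1) y \<le> N"
  proof -
    have y0: "y \<ge> 0" using y by simp
    obtain m where m: "0 \<le> m" "m \<le> y" "F (x - 1) y = y - m div 2 + f (x - 1 - m)"
      by (rule fst_attained[OF F f y0])
    have "\<not> m < y"
    proof
      assume "m < y"
      then have "N + 1 \<le> y - (m + 1) div 2 + f (x - 1 - m)" by (intro low) (use m in auto)
      moreover have "m div 2 \<le> (m + 1) div 2" by presburger
      ultimately show False using m g by simp
    qed
    then have my: "m = y" using m by simp
    then have fy: "y - y div 2 + f (x - 1 - y) \<le> N" using m g by simp
    have fy': "f (x - y) \<le> f (x - 1 - y) + 1" using nonexpD[OF f, of "x - y" "x - 1 - y"] by simp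
    have "F (x - 2) (y - 2) \<le> y - 2 - (y - 2) div 2 + f (x - y)" by (rule le) (use y in auto)
    moreover have "(y - 2) div 2 = y div 2 - 1" by simp
    ultimately have d: "F (x - 2) (y - 2) \<le> N" using fy fy' by simp
    show ?thesis
    proof (cases "even y")
      case True
      have "F (x - 2) (y - 1) \<le> y - 1 - (y - 1) div 2 + f (x - 1 - y)" by (rule le) (use y in auto)
      moreover have "(y - 1) div 2 = y div 2 - 1" using True by presburger
      ultimately have "F (x - 2) (y - 1) \<le> N" using fy by simp
      then have "conn (edge_le F N) 2 (x - 1, y) (x - 2, y - 2)"
        by (intro conn2[of _ _ "(x - 2, y - 1)"] edge_leI) (use g d in simp_all)
      with d show ?thesis by simp
    next
      case False
      have "F (x - 1) (y - 1) \<le> y - 1 - (y - 1) div 2 + f (x - y)" by (rule le) (use y in auto)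
      moreover have "(y - 1) div 2 = y div 2" using False by presburger
      ultimately have "F (x - 1) (y - 1) \<le> N" using fy fy' by simp
      then have "conn (edge_le F N) 2 (x - 1, y) (x - 2, y - 2)"
        by (intro conn2[of _ _ "(x - 1, y - 1)"] edge_leI) (use g d in simp_all)
      with d show ?thesis by simp
    qed
  qed
  from g(1) show ?thesis
  proof (cases rule: isgen_cases)
    case 1
    have y0: "y \<ge> 0" using y by simp
    obtain m where m: "0 \<le> m" "m \<le> y" "F (x + 1) y = y - m div 2 + f (x + 1 - m)"
      by (rule fst_attained[OF F f y0])
    have "F x (y - 1) \<le> N"
    proof (cases "m = 0")
      case True
      have "F x (y - 1) \<le> y - 1 - 0 div 2 + f x" by (rule le) (use y in auto)
      then show ?thesis using m True g 1 nonexpD[OF f, of x "x + 1"] by simp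
    next
      case False
      have "F x (y - 1) \<le> y - 1 - (m - 1) div 2 + f (x + 1 - m)" by (rule le) (use m False in auto)
      moreover have "m div 2 \<le> (m - 1) div 2 + 1" by presburger
      ultimately show ?thesis using m g 1 by simp
    qed
    then have "edge_le F N (x + 1, y) (x, y - 1)" by (intro edge_leI) (use g 1 in simp_all)
    then show ?thesis using C1 1 \<open>F x (y - 1) \<le> N\<close> by simp
  next
    case 2
    then show ?thesis using left g conn_mono[of "edge_le F N" 2 "(x - 1, y)" "(x - 2, y - 2)" 3] by simp
  next
    case 3
    have y0: "y + 1 \<ge> 0" using y by simp
    obtain m where m: "0 \<le> m" "m \<le> y + 1" "F x (y + 1) = y + 1 - m div 2 + f (x - m)"
      by (rule fst_attained[OF F f y0])
    have "\<not> m \<le> y" using low[of m "x - m"] m g 3 by auto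
    then have my: "m = y + 1" using m by simp
    have "F (x - 1) y \<le> y - y div 2 + f (x - m)" by (rule le) (use my y in auto)
    moreover have "(y + 1) div 2 \<le> y div 2 + 1" by presburger
    ultimately have a: "F (x - 1) y \<le> N" using m g 3 my by simp
    then have "edge_le F N (x, y + 1) (x - 1, y)" by (intro edge_leI) (use g 3 in simp_all)
    from conn_step[of "edge_le F N", OF this conjunct2[OF left[OF a]]]
    show ?thesis using 3 left[OF a] by simp
  next
    case 4
    then show ?thesis using g by (simp add: conn_refl)
  next
    case 5
    have y0: "y + 1 \<ge> 0" using y by simp
    obtain m where m: "0 \<le> m" "m \<le> y + 1" "F (x + 1) (y + 1) = y + 1 - m div 2 + f (x + 1 - m)"
      by (rule fst_attained[OF F f y0])
    have False
    proof (cases "m = 0")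
      case True
      then show False using low[of 0 x] y m g 5 nonexpD[OF f, of x "x + 1"] by simp
    next
      case False
      have "N + 1 \<le> y - (m - 1) div 2 + f (x + 1 - m)" by (rule low) (use m False in auto)
      moreover have "m div 2 \<le> (m - 1) div 2 + 1" by presburger
      ultimately show False using m g 5 by simp
    qed
    then show ?thesis ..
  next
    case 6
    have y0: "y - 1 \<ge> 0" using y by simp
    obtain m where m: "0 \<le> m" "m \<le> y - 1" "F (x - 1) (y - 1) = y - 1 - m div 2 + f (x - 1 - m)"
      by (rule fst_attained[OF F f y0])
    show ?thesis
    proof (cases "m < y - 1")
      case True
      have "F x (y - 1) \<le> y - 1 - (m + 1) div 2 + f (x - 1 - m)" by (rule le) (use m True in auto)
      moreover have "m div 2 \<le> (m + 1) div 2" by presburger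
      ultimately have a: "F x (y - 1) \<le> N" using m g 6 by simp
      then have "edge_le F N (x - 1, y - 1) (x, y - 1)" by (intro edge_leI) (use g 6 in simp_all)
      then show ?thesis using C1 6 a by simp
    next
      case False
      then have my: "m = y - 1" using m by simp
      have "F (x - 2) (y - 2) \<le> y - 2 - (y - 2) div 2 + f (x - 1 - m)" by (rule le) (use my y in auto)
      moreover have "(y - 1) div 2 \<le> (y - 2) div 2 + 1" by presburger
      ultimately have a: "F (x - 2) (y - 2) \<le> N" using m g 6 my by simp
      then have "edge_le F N (x - 1, y - 1) (x - 2, y - 2)" by (intro edge_leI) (use g 6 in simp_all)
      then show ?thesis using C1 6 a by simp
    qed
  next
    case 7
    have y0: "y + 2 \<ge> 0" using y by simp
    obtain m where m: "0 \<le> m" "m \<le> y + 2" "F (x + 2) (y + 2) = y + 2 - m div 2 + f (x + 2 - m)"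
      by (rule fst_attained[OF F f y0])
    have False
    proof (cases "m \<ge> 2")
      case True
      have "N + 1 \<le> y - (m - 2) div 2 + f (x + 2 - m)" by (rule low) (use m True in auto)
      moreover have "(m - 2) div 2 = m div 2 - 1" by simp
      ultimately show False using m g 7 by simp
    next
      case False
      then have "m div 2 = 0" "m = 0 \<or> m = 1" using m by auto
      then show False using low[of 0 x] y m g 7 nonexpD[OF f, of x "x + 2 - m"] by auto
    qed
    then show ?thesis ..
  next
    case 8
    then show ?thesis using g by (simp add: conn_refl)
  qed
qed

text \<open>The hubs differ by (2, 1), which is no generator, so a low common neighbour is sought.
  In the last case the obstruction would be a bump of \<open>f\<close> relative to slope 1/2 between
  \<open>x - y\<close> and \<open>x\<close>, which scale 2 excludes.\<close>

lemma fst_peak_link: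
  assumes y: "y \<ge> 2" and N: "F x y = N + 1" and b: "F x (y - 1) \<le> N" and d: "F (x - 2) (y - 2) \<le> N"
    and t: "tame 2 f"
  shows "conn (edge_le F N) 2 (x, y - 1) (x - 2, y - 2)"
proof -
  have low: "N + 1 \<le> y - m div 2 + f m'" if "0 \<le> m" "m \<le> y" "m' = x - m" for m m'
    using le[OF that] N by simp
  have bd: ?thesis if "F (x - 2) (y - 3) \<le> N"
    by (intro conn2[of _ _ "(x - 2, y - 3)"] edge_leI) (use that b d in simp_all)
  have c: ?thesis if "F (x - 1) (y - 1) \<le> N"
    by (intro conn2[of _ _ "(x - 1, y - 1)"] edge_leI) (use that b d in simp_all)
  have bc: ?thesis if "F (x - 1) (y - 2) \<le> N"
    by (intro conn2[of _ _ "(x - 1, y - 2)"] edge_leI) (use that b d in simp_all)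
  have y0: "y - 1 \<ge> 0" "y - 2 \<ge> 0" using y by auto
  obtain m where m: "0 \<le> m" "m \<le> y - 1" "F x (y - 1) = y - 1 - m div 2 + f (x - m)"
    by (rule fst_attained[OF F f y0(1)])
  obtain k' where k': "0 \<le> k'" "k' \<le> y - 2" "F (x - 2) (y - 2) = y - 2 - k' div 2 + f (x - 2 - k')"
    by (rule fst_attained[OF F f y0(2)])
  have "m \<ge> 2 \<or> m = 1 \<or> m = 0" "k' < y - 2 \<or> k' = y - 2" "y = 2 \<or> odd y \<or> y \<ge> 4 \<and> even y"
    using m k' y by presburger+
  then consider "m \<ge> 2" | "m = 1" | "m = 0" "k' < y - 2" | "m = 0" "k' = y - 2" "y = 2"
    | "m = 0" "k' = y - 2" "odd y" | "m = 0" "k' = y - 2" "y \<ge> 4" "even y"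
    by blast
  then show ?thesis
  proof cases
    case 1
    have "F (x - 2) (y - 3) \<le> y - 3 - (m - 2) div 2 + f (x - m)" by (rule le) (use m 1 in auto)
    then show ?thesis using bd m b by simp
  next
    case 2
    have "F (x - 1) (y - 1) \<le> y - 1 - 0 div 2 + f (x - m)" by (rule le) (use m 2 in auto)
    then show ?thesis using c m b 2 by simp
  next
    case 3
    have "F (x - 2) (y - 3) \<le> y - 3 - k' div 2 + f (x - 2 - k')" by (rule le) (use k' 3 in auto)
    then show ?thesis using bd k' d by simp
  next
    case 4
    have "F (x - 1) (y - 2) \<le> y - 2 - 0 div 2 + f (x - 1)" by (rule le) (use 4 in auto)
    then show ?thesis using bc m b 4 nonexpD[OF f, of "x - 1" x] by simp
  next
    case 5
    have "F (x - 1) (y - 1) \<le> y - 1 - (y - 1) div 2 + f (x - 2 - k')" by (rule le) (use k' 5 y in auto)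
    moreover have "(y - 1) div 2 = (y - 2) div 2 + 1" using 5(3) by presburger
    ultimately show ?thesis using c k' d 5 by simp
  next
    case 6
    obtain j where j: "y = 2 * j" using 6(4) by blast
    have tm: "f (x - 2) + f (x - y + 2) \<le> f (x - y) + f (x - 2 + 2) + 1"
      by (rule tameD[OF t]) (use y in simp)
    have "x - 2 + 2 = x" by simp
    note tm = tm[unfolded this]
    have "x - 2 - k' = x - y" using 6 by simp
    have "N + 1 \<le> y - 2 div 2 + f (x - 2)" by (rule low) (use 6 in auto)
    then have "N + 1 \<le> y - 1 + f (x - 2)" by simp
    moreover have dv: "(y - 2) div 2 = j - 1" "(y - 4) div 2 = j - 2" using j by auto
    moreover have "N + 1 \<le> y - (y - 2) div 2 + f (x - y + 2)" by (rule low) (use 6 in auto)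
    moreover have b': "y - 1 + f x \<le> N" using m b 6 by simp
    moreover have d': "y - 2 - (j - 1) + f (x - y) \<le> N" using k' d 6 dv \<open>x - 2 - k' = x - y\<close> by simp
    ultimately have "f (x - 2) \<le> N - y + 2 \<or> f (x - y + 2) \<le> N - y + j" using tm by linarith
    then show ?thesis
    proof
      assume a: "f (x - 2) \<le> N - y + 2"
      have "F (x - 2) (y - 3) \<le> y - 3 - 0 div 2 + f (x - 2)" by (rule le) (use 6 in auto)
      then show ?thesis using bd a by simp
    next
      assume a: "f (x - y + 2) \<le> N - y + j"
      have "F (x - 2) (y - 3) \<le> y - 3 - (y - 4) div 2 + f (x - y + 2)" by (rule le) (use 6 in auto)
      then show ?thesis using bd a dv by simp
    qed
  qed
qed

end

definition on_fst :: "int \<Rightarrow> bool" where "on_fst y \<longleftrightarrow> y = 0"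

lemma fst_peak_up:
  assumes F: "inf_conv f 1 0 F" and f: "nonexp f" and t: "tame 2 f" and y: "y \<ge> 1" and N: "F x y = N + 1"
    and g: "isgen p q" "F (x + p) (y + q) \<le> N" and g': "isgen p' q'" "F (x + p') (y + q') \<le> N"
  shows "conn (edge_le F N) 8 (x + p, y + q) (x + p', y + q')"
proof (cases "y = 1")
  case True
  have up: "F (x - 2) (- 1) = 1 + min (f (x - 2)) (f (x - 1))"
    using fst_one[OF inf_conv_neg[OF F] nonexp_neg[OF f], of "- x + 2"] by (simp add: algebra_simps)
  have e: "conn (edge_le F N) 1 (x - 1, 0) (x, 0)" if "F (x - 1) 0 \<le> N" "F x 0 \<le> N"
    by (rule conn_edge, rule edge_leI) (use that in simp_all)
  have "conn (edge_le F N) (2 + (1 + 2)) (x + p, y + q) (x + p', y + q')"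
    unfolding True by (rule conn_two_hubs[OF edge_le_sym fst_peak_hub_one[OF F f N[unfolded True] g[unfolded True] up]
      fst_peak_hub_one[OF F f N[unfolded True] g'[unfolded True] up] e])
  then show ?thesis by (rule conn_mono) simp
next
  case False
  then have y: "y \<ge> 2" using y by simp
  have "conn (edge_le F N) (3 + (2 + 3)) (x + p, y + q) (x + p', y + q')"
    by (rule conn_two_hubs[OF edge_le_sym fst_peak_hub[OF F f y N g] fst_peak_hub[OF F f y N g']
      fst_peak_link[OF F f y N _ _ t]])
  then show ?thesis by simp
qed

theorem fst_peak:
  assumes F: "inf_conv f 1 0 F" and f: "nonexp f" and t: "tame 2 f" and y: "\<not> on_fst y" and N: "F x y = N + 1"
    and g: "isgen p q" "F (x + p) (y + q) \<le> N" and g': "isgen p' q'" "F (x + p') (y + q') \<le> N"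
  shows "conn (edge_le F N) 8 (x + p, y + q) (x + p', y + q')"
proof (cases "y \<ge> 1")
  case True
  show ?thesis by (rule fst_peak_up[OF F f t True N g g'])
next
  case False
  then have y: "- y \<ge> 1" using y by (simp add: on_fst_def)
  have "conn (edge_le (\<lambda>x y. F (- x) (- y)) N) 8 (- x + - p, - y + - q) (- x + - p', - y + - q')"
    by (rule fst_peak_up[OF inf_conv_neg[OF F] nonexp_neg[OF f] tame_neg[OF t] y])
      (use N g g' isgen_minus[OF g(1)] isgen_minus[OF g'(1)] in \<open>simp_all add: add.commute\<close>)
  then have "conn (edge_le (\<lambda>x y. F (- x) (- y)) N) 8 (- (x + p), - (y + q)) (- (x + p'), - (y + q'))"
    by simp
  then show ?thesis by (rule conn_le_neg)
qed

text \<open>A d-edge from height -1 to height 1 lies in neither closed half-plane. It is replaced by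
  two c-edges, or by a walk b, a, a, b along the entry line.\<close>

lemma fst_hor_cross:
  assumes F: "inf_conv f 1 0 F" and f: "nonexp f" and N: "F x (- 1) = N" "F (x + 2) 1 = N"
  shows "conn (edge_lt F N) 4 (x, - 1) (x + 2, 1)"
proof -
  note L = fst_line[OF F f, of x] fst_line[OF F f, of "x + 1"] fst_line[OF F f, of "x + 2"]
  have "F x (- 1) = 1 + min (f x) (f (x + 1))"
    using fst_one[OF inf_conv_neg[OF F] nonexp_neg[OF f], of "- x"] by (simp add: algebra_simps)
  moreover have "F (x + 2) 1 = 1 + min (f (x + 2)) (f (x + 1))"
    using fst_one[OF F f, of "x + 2"] by (simp add: algebra_simps)
  ultimately consider "f (x + 1) < N" | "f x = N - 1" "f (x + 2) = N - 1" using N by linarith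
  then show ?thesis
  proof cases
    case 1
    then have "conn (edge_lt F N) 2 (x, - 1) (x + 2, 1)"
      by (intro conn2[of _ _ "(x + 1, 0)"] edge_ltI) (use N L in auto)
    then show ?thesis by (rule conn_mono) simp
  next
    case 2
    then have "f (x + 1) \<le> N" using nonexpD[OF f, of "x + 1" x] by simp
    then show ?thesis
      by (intro conn4[of _ _ "(x, 0)" "(x + 1, 0)" "(x + 2, 0)"] edge_ltI) (use N L 2 in auto)
  qed
qed

theorem fst_hor:
  assumes F: "inf_conv f 1 0 F" and f: "nonexp f" and t: "tame 2 f"
    and g: "isgen p q" "F x y = N" "F (x + p) (y + q) = N" and L: "\<not> (on_fst y \<and> on_fst (y + q))"
  shows "conn (edge_lt F N) 4 (x, y) (x + p, y + q)"
proof -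
  have up: "conn (edge_lt F N) 4 (x, y) (x + p, y + q)"
    if F: "inf_conv f 1 0 F" and f: "nonexp f" and t: "tame 2 f" and g: "F x y = N" "F (x + p) (y + q) = N"
      and L: "\<not> (on_fst y \<and> on_fst (y + q))"
      and pq: "(p, q) \<in> {(1, 0), (1, 1), (2, 2), (0, 1)}" and y: "y \<ge> 0"
    for f F x y p q
  proof -
    from pq consider "p = 1" "q = 0" | "p = 1" "q = 1" | "p = 2" "q = 2" | "p = 0" "q = 1" by auto
    then show ?thesis
    proof cases
      case 1
      then have "y \<ge> 1" using y L by (auto simp: on_fst_def)
      then show ?thesis using fst_hor_fst[OF F f _ _ _ t, of y x N] 1 g by simp
    next
      case 2
      then show ?thesis using conn_mono[OF fst_hor_diag[OF F f, of y x N], of 4] g y by simp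
    next
      case 3
      then show ?thesis using conn_mono[OF fst_hor_diag2[OF F f, of y x N], of 4] g y by simp
    next
      case 4
      then show ?thesis using fst_hor_snd[OF F f y _ _ t, of x N] g y by simp
    qed
  qed
  have pos: "conn (edge_lt F N) 4 (x, y) (x + p, y + q)"
    if g: "F x y = N" "F (x + p) (y + q) = N" and L: "\<not> (on_fst y \<and> on_fst (y + q))"
      and pq: "(p, q) \<in> {(1, 0), (1, 1), (2, 2), (0, 1)}"
    for x y p q
  proof -
    have "q = 0 \<or> q = 1 \<or> q = 2 \<and> p = 2" using pq by auto
    then consider "y \<ge> 0" | "y + q \<le> 0" | "y = - 1" "q = 2" "p = 2" by linarith
    then show ?thesis
    proof cases
      case 1
      show ?thesis by (rule up[OF F f t g L pq 1])
    next
      case 2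
      have "conn (edge_lt (\<lambda>x y. F (- x) (- y)) N) 4 (- (x + p), - (y + q)) (- (x + p) + p, - (y + q) + q)"
      proof (rule up[OF inf_conv_neg[OF F] nonexp_neg[OF f] tame_neg[OF t] _ _ _ pq])
        show "F (- (- (x + p))) (- (- (y + q))) = N" using g(2) by (simp only: minus_minus)
        have "- (- (x + p) + p) = x" "- (- (y + q) + q) = y" by simp_all
        then show "F (- (- (x + p) + p)) (- (- (y + q) + q)) = N" using g(1) by (simp only:)
        show "\<not> (on_fst (- (y + q)) \<and> on_fst (- (y + q) + q))" using L by (auto simp: on_fst_def)
        show "0 \<le> - (y + q)" using 2 by simp
      qed
      then have "conn (edge_lt (\<lambda>x y. F (- x) (- y)) N) 4 (- (x + p), - (y + q)) (- x, - y)" by simp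
      then have "conn (edge_lt F N) 4 (x + p, y + q) (x, y)" by (rule conn_lt_neg)
      then show ?thesis by (rule conn_sym[rotated]) (rule edge_lt_sym)
    next
      case 3
      then show ?thesis using fst_hor_cross[OF F f, of x N] g by simp
    qed
  qed
  show ?thesis
  proof (cases "(p, q) \<in> {(1, 0), (1, 1), (2, 2), (0, 1)}")
    case True
    show ?thesis by (rule pos[OF g(2,3) L True])
  next
    case False
    have pq: "(- p, - q) \<in> {(1, 0), (1, 1), (2, 2), (0, 1)}"
      using g(1) False unfolding isgen_def by (elim insertE emptyE) simp_all
    have e: "x + p + - p = x" "y + q + - q = y" by simp_all
    have "conn (edge_lt F N) 4 (x + p, y + q) (x + p + - p, y + q + - q)"
      by (rule pos[OF g(3) _ _ pq], unfold e) (use g(2) L in blast)+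
    then have "conn (edge_lt F N) 4 (x + p, y + q) (x, y)" by simp
    then show ?thesis by (rule conn_sym[rotated]) (rule edge_lt_sym)
  qed
qed

section \<open>All three directions\<close>

text \<open>The directions of d, a, b: those of the lines along which strips are attached.\<close>

definition entry :: "int \<Rightarrow> int \<Rightarrow> bool" where
  "entry ex ey \<longleftrightarrow> (ex, ey) \<in> {(2, 2), (1, 0), (0, 1)}"

lemma entry_cases:
  assumes "entry ex ey"
  obtains "ex = 2" "ey = 2" | "ex = 1" "ey = 0" | "ex = 0" "ey = 1"
  using assms unfolding entry_def by blast

text \<open>All scales are kept together because \<open>good_line\<close> at scale
  \<open>2 ^ j\<close> draws on \<open>f\<close> at the scale below, at or above it, depending on
  the two directions.\<close>

definition good :: "(int \<Rightarrow> int) \<Rightarrow> bool" where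
  "good f \<longleftrightarrow> nonexp f \<and> (\<forall>j\<ge>1. tame (2 ^ j) f)"

lemma nonexp_inf_conv_line:
  assumes F: "inf_conv f ex ey F" and e: "entry px py"
  shows "nonexp (\<lambda>n. F (p + n * px) (q + n * py))"
  unfolding nonexp_def
proof
  fix n
  have g: "isgen px py" using e by (auto simp: entry_def)
  have e: "p + (n + 1) * px - (p + n * px) = px" "q + (n + 1) * py - (q + n * py) = py"
    "p + n * px - (p + (n + 1) * px) = - px" "q + n * py - (q + (n + 1) * py) = - py"
    by (simp_all add: algebra_simps)
  have "F (p + (n + 1) * px) (q + (n + 1) * py) \<le> F (p + n * px) (q + n * py) + 1"
    by (rule inf_conv_step[OF F]) (simp only: e g)
  moreover have "F (p + n * px) (q + n * py) \<le> F (p + (n + 1) * px) (q + (n + 1) * py) + 1"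
    by (rule inf_conv_step[OF F]) (simp only: e isgen_minus[OF g])
  ultimately show "\<bar>F (p + (n + 1) * px) (q + (n + 1) * py) - F (p + n * px) (q + n * py)\<bar> \<le> 1" by simp
qed

text \<open>The inductive step from a copy to its children: the distance along any line that carries
  a further strip has the same property, with unchanged constants.\<close>

lemma good_line:
  assumes F: "inf_conv f ex ey F" and e: "entry ex ey" and p: "entry px py" and f: "good f"
  shows "good (\<lambda>n. F (p + n * px) (q + n * py))"
  unfolding good_def
proof (intro conjI allI impI)
  show "nonexp (\<lambda>n. F (p + n * px) (q + n * py))" by (rule nonexp_inf_conv_line[OF F p])
  fix j :: nat assume j: "j \<ge> 1"
  have nf: "nonexp f" and t: "tame (2 ^ j) f" "tame (2 * 2 ^ j) f" 
    using f j spec[of "\<lambda>j. 1 \<le> j \<longrightarrow> tame (2 ^ j) f" "Suc j"] by (auto simp: good_def)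
  have K: "(2::int) ^ j \<ge> 0" "even ((2::int) ^ j)" using j by auto
  have half: "tame (2 ^ j) (\<lambda>n. F (p + n) q)" if F: "inf_conv f 2 2 F" for F p q
  proof (cases "j = 1")
    case True
    then show ?thesis using tame2_diag_line_fst[OF F nf] by simp
  next
    case False
    then obtain i where i: "j = Suc i" "i \<ge> 1" using j by (cases j) auto
    then have "tame (2 ^ i) f" using f by (auto simp: good_def)
    from tame_diag_line_fst[OF F this] show ?thesis using i by simp
  qed
  have fst_entry: "tame (2 ^ j) (\<lambda>n. F (p + n * px) (q + n * py))" if F: "inf_conv f 1 0 F" and p: "entry px py" for F p q px py
    using p
  proof (cases rule: entry_cases)
    case 1
    then show ?thesis using tame_fst_line_diag[OF F t(2) K(1), of p q] by (simp add: mult.commute)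
  next
    case 2
    then show ?thesis using tame_fst_line_fst[OF F t(1) K(1), of p q] by simp
  next
    case 3
    then show ?thesis using tame_fst_line_snd[OF F t(1) K, of p q] by simp
  qed
  show "tame (2 ^ j) (\<lambda>n. F (p + n * px) (q + n * py))"
    using e
  proof (cases rule: entry_cases)
    case 1
    then have F: "inf_conv f 2 2 F" using F by simp
    show ?thesis using p
    proof (cases rule: entry_cases)
      case 1
      then show ?thesis using tame_diag_line_diag[OF F t(1) K(1), of p q] by (simp add: mult.commute)
    next
      case 2
      then show ?thesis using half[OF F, of p q] by simp
    next
      case 3
      then show ?thesis using half[OF inf_conv_swap[OF F], where p = q and q = p] by simp
    qed
  next
    case 2
    then show ?thesis using fst_entry F p by simp
  next
    case 3
    then have "inf_conv f 1 0 (\<lambda>x y. F y x)" using inf_conv_swap[OF F] by simp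
    moreover have "entry py px" using p by (auto simp: entry_def)
    ultimately show ?thesis using fst_entry[of "\<lambda>x y. F y x" py px q p] by simp
  qed
qed

lemma good_abs: "good (\<lambda>n. \<bar>n\<bar>)"
proof -
  have "\<bar>z + r\<bar> + \<bar>z + K\<bar> \<le> \<bar>z\<bar> + \<bar>z + r + K\<bar> + 1" if "r \<ge> 0" "K \<ge> 0" for z r K :: int
    using that by linarith
  moreover have "\<bar>\<bar>n + 1\<bar> - \<bar>n\<bar>\<bar> \<le> 1" for n :: int by linarith
  ultimately show ?thesis unfolding good_def nonexp_def tame_def by simp
qed

lemma good_Suc:
  assumes "good f"
  shows "good (\<lambda>n. 1 + f n)"
proof -
  have "tame K (\<lambda>n. 1 + f n)" if "tame K f" for K
    unfolding tame_def
  proof (intro allI impI)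
    fix z r :: int assume "r \<ge> 0"
    then have "f (z + r) + f (z + K) \<le> f z + f (z + r + K) + 1" using that by (simp add: tame_def)
    then show "1 + f (z + r) + (1 + f (z + K)) \<le> 1 + f z + (1 + f (z + r + K)) + 1" by linarith
  qed
  then show ?thesis using assms unfolding good_def nonexp_def by simp
qed

definition on_line :: "int \<Rightarrow> int \<Rightarrow> int \<Rightarrow> int \<Rightarrow> bool" where
  "on_line ex ey x y \<longleftrightarrow> (\<exists>n. x = n * ex \<and> y = n * ey)"

lemma on_line_simps: "on_line 2 2 x y \<longleftrightarrow> on_diag x y" "on_line 1 0 x y \<longleftrightarrow> on_fst y" "on_line 0 1 x y \<longleftrightarrow> on_fst x"
  unfolding on_line_def on_diag_def on_fst_def by (auto elim!: evenE)

lemma entry_hor: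
  assumes F: "inf_conv f ex ey F" and e: "entry ex ey" and f: "good f"
    and g: "isgen p q" "F x y = N" "F (x + p) (y + q) = N" and L: "\<not> (on_line ex ey x y \<and> on_line ex ey (x + p) (y + q))"
  shows "conn (edge_lt F N) 4 (x, y) (x + p, y + q)"
proof -
  have nf: "nonexp f" using f by (simp add: good_def)
  have "tame (2 ^ 1) f" using f unfolding good_def by blast
  then have t: "tame 2 f" by simp
  show ?thesis using e
  proof (cases rule: entry_cases)
    case 1
    show ?thesis by (rule diag_hor[OF F[unfolded 1] nf g]) (use L in \<open>simp add: 1 on_line_simps\<close>)
  next
    case 2
    show ?thesis by (rule fst_hor[OF F[unfolded 2] nf t g]) (use L in \<open>simp add: 2 on_line_simps\<close>)
  next
    case 3
    have "conn (edge_lt (\<lambda>x y. F y x) N) 4 (y, x) (y + q, x + p)"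
      by (rule fst_hor[OF inf_conv_swap[OF F, unfolded 3] nf t isgen_swap[OF g(1)] g(2,3)])
        (use L in \<open>simp add: 3 on_line_simps\<close>)
    then show ?thesis by (rule conn_lt_swap)
  qed
qed

lemma entry_peak:
  assumes F: "inf_conv f ex ey F" and e: "entry ex ey" and f: "good f"
    and x: "\<not> on_line ex ey x y" "F x y = N + 1" 
    and g: "isgen p q" "F (x + p) (y + q) \<le> N" and g': "isgen p' q'" "F (x + p') (y + q') \<le> N"
  shows "conn (edge_le F N) 8 (x + p, y + q) (x + p', y + q')"
proof -
  have nf: "nonexp f" using f by (simp add: good_def)
  have "tame (2 ^ 1) f" using f unfolding good_def by blast
  then have t: "tame 2 f" by simp
  show ?thesis using e
  proof (cases rule: entry_cases)
    case 1
    have "conn (edge_le F N) 5 (x + p, y + q) (x + p', y + q')"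
      by (rule diag_peak[OF F[unfolded 1] nf _ x(2) g g']) (use x in \<open>simp add: 1 on_line_simps\<close>)
    then show ?thesis by (rule conn_mono) simp
  next
    case 2
    show ?thesis by (rule fst_peak[OF F[unfolded 2] nf t _ x(2) g g']) (use x in \<open>simp add: 2 on_line_simps\<close>)
  next
    case 3
    have "conn (edge_le (\<lambda>x y. F y x) N) 8 (y + q, x + p) (y + q', x + p')"
      by (rule fst_peak[OF inf_conv_swap[OF F, unfolded 3] nf t _ x(2) isgen_swap[OF g(1)] g(2) isgen_swap[OF g'(1)] g'(2)])
        (use x in \<open>simp add: 3 on_line_simps\<close>)
    then show ?thesis by (rule conn_le_swap)
  qed
qed

lemma nrm_nonneg: "nrm x y \<ge> 0"
  using nrm_lower[of x y] by linarith

lemma nrm_diag: "nrm (n * 2) (n * 2) = \<bar>n\<bar>"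
proof -
  have "nrm (n * 2) (n * 2) \<le> \<bar>n\<bar>" unfolding nrm_le_iff by auto
  moreover have "\<bar>n\<bar> \<le> nrm (n * 2) (n * 2)" using nrm_lower2[of "n * 2" "n * 2"] by linarith
  ultimately show ?thesis by simp
qed

lemma nrm_axis: "nrm n 0 = \<bar>n\<bar>"
proof -
  have "- (n div 2) \<le> \<bar>n\<bar>" "(n + 1) div 2 \<le> \<bar>n\<bar>" by presburger+
  then have "nrm n 0 \<le> \<bar>n\<bar>" unfolding nrm_le_iff by auto
  moreover have "\<bar>n\<bar> \<le> nrm n 0" using nrm_lower2[of n 0] by linarith
  ultimately show ?thesis by simp
qed

lemma nrm_entry: "entry ex ey \<Longrightarrow> nrm (n * ex) (n * ey) = \<bar>n\<bar>"
  using nrm_diag nrm_axis nrm_swap[of 0 n] by (elim entry_cases) simp_all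

lemma inf_conv_line:
  assumes F: "inf_conv f ex ey F" and e: "entry ex ey" and f: "nonexp f"
  shows "F (n * ex) (n * ey) = f n"
proof -
  obtain m where m: "F (n * ex) (n * ey) = f m + nrm (n * ex - m * ex) (n * ey - m * ey)"
    by (rule inf_conv_attained[OF F])
  have "n * ex - m * ex = (n - m) * ex" "n * ey - m * ey = (n - m) * ey" by (simp_all add: algebra_simps)
  then have "F (n * ex) (n * ey) = f m + \<bar>n - m\<bar>" using m nrm_entry[OF e, of "n - m"] by simp
  moreover have "F (n * ex) (n * ey) \<le> f n + nrm 0 0" by (rule inf_conv_le'[OF F]) auto
  ultimately show ?thesis using nonexpD[OF f, of n m] by simp
qed

text \<open>An entry direction is a vertex of the hexagon. To come nearer to a point of the line, a
  step must gain 1 on both facets that meet at this vertex, and among the generators only the vertex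
  itself does.\<close>

lemma nrm_off_entry:
  assumes "entry ex ey" "isgen p q" "nrm (p - j * ex) (q - j * ey) < \<bar>j\<bar>"
  shows "(p = ex \<and> q = ey) \<or> (p = - ex \<and> q = - ey)"
proof -
  define k where "k = nrm (p - j * ex) (q - j * ey)"
  note L = nrm_lower2[of "p - j * ex" "q - j * ey", folded k_def] assms(3)[folded k_def]
  from assms(2) consider "p = 1" "q = 0" | "p = -1" "q = 0" | "p = 0" "q = 1" | "p = 0" "q = -1" | "p = 1" "q = 1"
    | "p = -1" "q = -1" | "p = 2" "q = 2" | "p = -2" "q = -2"
    unfolding isgen_def by auto
  then show ?thesis
    by cases (use assms(1) L in \<open>elim entry_cases; simp; linarith\<close>)+
qed

text \<open>Consequently a peak on the entry line has all its lower neighbours in the copy on this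
  line, so the whole configuration can be pushed through the strip.\<close>

lemma inf_conv_off_line:
  assumes F: "inf_conv f ex ey F" and "entry ex ey" and f: "nonexp f"
    and g: "isgen p q" "F (n * ex + p) (n * ey + q) < f n"
  shows "(p = ex \<and> q = ey) \<or> (p = - ex \<and> q = - ey)"
proof -
  obtain m where m: "F (n * ex + p) (n * ey + q) = f m + nrm (n * ex + p - m * ex) (n * ey + q - m * ey)"
    by (rule inf_conv_attained[OF F])
  have e: "n * ex + p - m * ex = p - (m - n) * ex" "n * ey + q - m * ey = q - (m - n) * ey" by (simp_all add: algebra_simps)
  have "nrm (p - (m - n) * ex) (q - (m - n) * ey) < \<bar>m - n\<bar>"
    using m[unfolded e] g(2) nonexpD[OF f, of n m] by linarith
  then show ?thesis by (rule nrm_off_entry[OF assms(2) g(1)])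
qed

section \<open>Normal forms and their lengths\<close>

text \<open>A strip together with the direction in which it is crossed: \<open>Sa\<close>,
  \<open>Sb\<close> leave an a-line or b-line (letters s, t), \<open>Da\<close>, \<open>Db\<close>
  leave a d-line (their inverses). \<open>opp\<close> is the reverse crossing, so
  \<open>dx (opp s)\<close>, \<open>dy (opp s)\<close> is the direction of the line of
  arrival.\<close>

datatype strip = Sa | Sb | Da | Db

fun opp :: "strip \<Rightarrow> strip" where
  "opp Sa = Da" | "opp Sb = Db" | "opp Da = Sa" | "opp Db = Sb"

fun dx :: "strip \<Rightarrow> int" where
  "dx Sa = 1" | "dx Sb = 0" | "dx Da = 2" | "dx Db = 2"

fun dy :: "strip \<Rightarrow> int" where
  "dy Sa = 0" | "dy Sb = 1" | "dy Da = 2" | "dy Db = 2"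

text \<open>The position along the line through (x, y). The points with value 0 are the chosen coset
  representatives: \<open>x = 0\<close> for a-lines, \<open>y = 0\<close> for b-lines,
  \<open>x\<close> equal to 0 or 1 for d-lines.\<close>

fun pos_on :: "strip \<Rightarrow> int \<Rightarrow> int \<Rightarrow> int" where
  "pos_on Sa x y = x" | "pos_on Sb x y = y" | "pos_on Da x y = x div 2" | "pos_on Db x y = x div 2"

lemma opp_opp [simp]: "opp (opp s) = s"
  by (cases s) auto

lemma entry_dir: "entry (dx s) (dy s)"
  by (cases s) (auto simp: entry_def)

lemma isgen_dir: "isgen (dx s) (dy s)"
  by (cases s) auto

lemma pos_on_add: "pos_on s (x + n * dx s) (y + n * dy s) = pos_on s x y + n"
  by (cases s) auto

lemma pos_on_line [simp]: "pos_on s (n * dx s) (n * dy s) = n"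
  using pos_on_add[of s 0 n 0] by (cases s) auto

text \<open>A state is a Britton normal form: the innermost copy comes with a point \<open>(x, y)\<close>, and every frame records
  the strip through which the parent copy was left, with a point of the line where the strip is attached.
  A strip attached to the entry line leads back to the parent.\<close>

type_synonym frame = "strip \<times> int \<times> int"
type_synonym state = "frame list \<times> int \<times> int"

definition ret :: "frame list \<Rightarrow> strip \<Rightarrow> int \<Rightarrow> int \<Rightarrow> bool" where
  "ret st s p q \<longleftrightarrow> st \<noteq> [] \<and> fst (hd st) = opp s \<and> p = 0 \<and> q = 0"

fun valid :: "frame list \<Rightarrow> bool" where
  "valid [] = True"
| "valid ((s, p, q) # st) \<longleftrightarrow> pos_on s p q = 0 \<and> \<not> ret st s p q \<and> valid st"

text \<open>\<open>(p, q)\<close> is the coset representative and \<open>n\<close> the position on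
  its line. The strip carries it to the \<open>n\<close>-th point of the line on the other side, so
  one square of the strip matches one step on both sides.\<close>

fun enter :: "frame list \<Rightarrow> strip \<Rightarrow> int \<Rightarrow> int \<Rightarrow> int \<Rightarrow> state" where
  "enter st s p q n = (if ret st s p q
     then (tl st, fst (snd (hd st)) + n * dx (opp s), snd (snd (hd st)) + n * dy (opp s))
     else ((s, p, q) # st, n * dx (opp s), n * dy (opp s)))"

definition cross :: "strip \<Rightarrow> state \<Rightarrow> state" where
  "cross s \<omega> = (case \<omega> of (st, x, y) \<Rightarrow>
     enter st s (x - pos_on s x y * dx s) (y - pos_on s x y * dy s) (pos_on s x y))"

declare enter.simps [simp del]

lemma cross_enter:
  assumes "pos_on s p q = 0"
  shows "cross s (st, p + n * dx s, q + n * dy s) = enter st s p q n"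
  unfolding cross_def by (simp add: pos_on_add assms)

lemma decompose_line:
  obtains p q n where "x = p + n * dx s" "y = q + n * dy s" "pos_on s p q = 0"
proof
  let ?n = "pos_on s x y"
  show "x = x - ?n * dx s + ?n * dx s" "y = y - ?n * dy s + ?n * dy s" by simp_all
  show "pos_on s (x - ?n * dx s) (y - ?n * dy s) = 0"
    using pos_on_add[of s x "- ?n" y] by simp
qed

lemma enter_push: "\<not> ret st s p q \<Longrightarrow> enter st s p q n = ((s, p, q) # st, n * dx (opp s), n * dy (opp s))"
  by (simp add: enter.simps)

lemma enter_pop: "enter ((s, p, q) # st) (opp s) 0 0 n = (st, p + n * dx s, q + n * dy s)"
  by (simp add: enter.simps ret_def)

lemma pos_on_0 [simp]: "pos_on s 0 0 = 0"
  by (cases s) auto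

lemma cross_pop: "cross (opp s) ((s, p, q) # st, n * dx (opp s), n * dy (opp s)) = (st, p + n * dx s, q + n * dy s)"
  using cross_enter[of "opp s" 0 0 "(s, p, q) # st" n] by (simp add: enter_pop)

lemma retE:
  assumes "ret st s p q"
  obtains p' q' st' where "st = (opp s, p', q') # st'" "p = 0" "q = 0"
  using assms unfolding ret_def by (cases st) auto

lemma cross_cases:
  assumes "valid st"
  obtains (push) p q n where "x = p + n * dx s" "y = q + n * dy s" "valid ((s, p, q) # st)"
      "cross s (st, x, y) = ((s, p, q) # st, n * dx (opp s), n * dy (opp s))"
  | (pop) p q st' n where "st = (opp s, p, q) # st'" "x = n * dx s" "y = n * dy s" "valid st'"
      "cross s (st, x, y) = (st', p + n * dx (opp s), q + n * dy (opp s))"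
proof -
  obtain p q n where pq: "x = p + n * dx s" "y = q + n * dy s" "pos_on s p q = 0" by (rule decompose_line)
  show thesis
  proof (cases "ret st s p q")
    case True
    then obtain p' q' st' where st: "st = (opp s, p', q') # st'" "p = 0" "q = 0" by (rule retE)
    show thesis
      by (rule pop[of p' q' st' n]) (use st pq assms cross_pop[of "opp s" p' q' st' n] in simp_all)
  next
    case False
    show thesis
      by (rule push[of p n q]) (use False pq assms cross_enter[OF pq(3), of st n] in \<open>simp_all add: enter_push\<close>)
  qed
qed

lemma valid_cross: "valid st \<Longrightarrow> valid (fst (cross s (st, x, y)))"
  by (erule cross_cases[of st x s y]) simp_all

lemma cross_push:
  assumes "valid ((s, p, q) # st)"
  shows "cross s (st, p + n * dx s, q + n * dy s) = ((s, p, q) # st, n * dx (opp s), n * dy (opp s))"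
  using assms cross_enter[of s p q st n] by (simp add: enter_push)

lemma cross_opp:
  assumes "valid st"
  shows "cross (opp s) (cross s (st, x, y)) = (st, x, y)"
  using assms
proof (cases rule: cross_cases[of st x s y])
  case (push p q n)
  then show ?thesis by (simp add: cross_pop)
next
  case (pop p q st' n)
  then show ?thesis using assms cross_push[of "opp s" p q st' n] by simp
qed

definition shift :: "int \<Rightarrow> int \<Rightarrow> state \<Rightarrow> state" where
  "shift p q \<omega> = (fst \<omega>, fst (snd \<omega>) + p, snd (snd \<omega>) + q)"

text \<open>These squares of the strips are the relations that express d as the conjugate of a by s
  and of b by t.\<close>

lemma cross_shift:
  assumes "valid st"
  shows "cross s (shift (dx s) (dy s) (st, x, y)) = shift (dx (opp s)) (dy (opp s)) (cross s (st, x, y))"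
  using assms
proof (cases rule: cross_cases[of st x s y])
  case (push p q n)
  have e: "x + dx s = p + (n + 1) * dx s" "y + dy s = q + (n + 1) * dy s"
    using push by (simp_all add: algebra_simps)
  show ?thesis unfolding push(4) shift_def fst_conv snd_conv e cross_push[OF push(3)] by (simp add: algebra_simps)
next
  case (pop p q st' n)
  have e: "x + dx s = (n + 1) * dx s" "y + dy s = (n + 1) * dy s"
    using pop by (simp_all add: algebra_simps)
  show ?thesis
    unfolding pop(5) shift_def fst_conv snd_conv e using cross_pop[of "opp s" p q st' "n + 1"] pop(1)
    by (simp add: algebra_simps)
qed

section \<open>Levels of states\<close>

text \<open>The cheapest way to pass the last strip at its \<open>n\<close>-th point: level in the
  parent, 1 for the strip, norm in the copy. This is a candidate for the distance to the identity;
  \<open>dist_slev\<close> confirms it.\<close>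

primrec lam :: "frame list \<Rightarrow> int \<Rightarrow> int \<Rightarrow> nat" where
  "lam [] = (\<lambda>x y. nat (nrm x y))"
| "lam (fr # st) = (\<lambda>x y. LEAST k. \<exists>n. int k =
     1 + int (lam st (fst (snd fr) + n * dx (fst fr)) (snd (snd fr) + n * dy (fst fr))) +
     nrm (x - n * dx (opp (fst fr))) (y - n * dy (opp (fst fr))))"

lemma lam_inf_conv:
  "inf_conv (\<lambda>n. 1 + int (lam st (p + n * dx s) (q + n * dy s))) (dx (opp s)) (dy (opp s))
     (\<lambda>x y. int (lam ((s, p, q) # st) x y))"
proof -
  define c where "c x y n = 1 + int (lam st (p + n * dx s) (q + n * dy s)) +
     nrm (x - n * dx (opp s)) (y - n * dy (opp s))" for x y n
  have c0: "c x y n \<ge> 0" for x y n unfolding c_def using nrm_nonneg by (simp add: add_nonneg_nonneg)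
  have L: "lam ((s, p, q) # st) x y = (LEAST k. \<exists>n. int k = c x y n)" for x y
    by (simp add: c_def)
  show ?thesis
    unfolding inf_conv_def
  proof (intro conjI allI)
    fix x y n
    have "lam ((s, p, q) # st) x y \<le> nat (c x y n)"
      unfolding L by (rule Least_le) (use c0 in auto)
    then show "int (lam ((s, p, q) # st) x y) \<le> 1 + int (lam st (p + n * dx s) (q + n * dy s)) +
        nrm (x - n * dx (opp s)) (y - n * dy (opp s))"
      using c0[of x y n] unfolding c_def[symmetric] by linarith
  next
    fix x y
    have "\<exists>k n. int k = c x y n" using c0[of x y 0] by (metis nat_0_le)
    then have "\<exists>n. int (LEAST k. \<exists>n. int k = c x y n) = c x y n" by (rule LeastI_ex)
    then show "\<exists>n. int (lam ((s, p, q) # st) x y) = 1 + int (lam st (p + n * dx s) (q + n * dy s)) +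
        nrm (x - n * dx (opp s)) (y - n * dy (opp s))"
      unfolding L[of x y] unfolding c_def .
  qed
qed

text \<open>The root copy is entered through no strip. The a-line through the identity with
  \<open>f = abs\<close> acts as its entry line, since \<open>nrm n 0\<close> is the absolute value
  of \<open>n\<close>.\<close>

lemma lam_root: "inf_conv (\<lambda>n. \<bar>n\<bar>) 1 0 (\<lambda>x y. int (lam [] x y))"
  unfolding inf_conv_def
proof (intro conjI allI)
  fix x y n
  show "int (lam [] x y) \<le> \<bar>n\<bar> + nrm (x - n * 1) (y - n * 0)"
    using nrm_triangle[of n "x - n" 0 y] nrm_axis[of n] nrm_nonneg[of x y] by simp
next
  fix x y
  show "\<exists>n. int (lam [] x y) = \<bar>n\<bar> + nrm (x - n * 1) (y - n * 0)"
    by (rule exI[of _ 0]) (simp add: nrm_nonneg)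
qed

definition lev :: "frame list \<Rightarrow> int \<Rightarrow> int \<Rightarrow> int" where
  "lev st x y = int (lam st x y)"

definition ent :: "frame list \<Rightarrow> int \<times> int" where
  "ent st = (if st = [] then (1, 0) else (dx (opp (fst (hd st))), dy (opp (fst (hd st)))))"

lemma entry_ent: "entry (fst (ent st)) (snd (ent st))"
  unfolding ent_def using entry_dir by (auto simp: entry_def)

lemma lev_inf_conv:
  obtains f where "inf_conv f (fst (ent st)) (snd (ent st)) (lev st)" "good f" "\<And>x y. lev st x y \<ge> 0"
    "st = [] \<Longrightarrow> f = abs"
    "\<And>s p q st'. st = (s, p, q) # st' \<Longrightarrow> f = (\<lambda>n. 1 + lev st' (p + n * dx s) (q + n * dy s))"
proof -
  have "\<exists>f. inf_conv f (fst (ent st)) (snd (ent st)) (lev st) \<and> good f \<and> (st = [] \<longrightarrow> f = abs) \<and>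
    (\<forall>s p q st'. st = (s, p, q) # st' \<longrightarrow> f = (\<lambda>n. 1 + lev st' (p + n * dx s) (q + n * dy s)))"
  proof (induction st)
    case Nil
    have "inf_conv abs 1 0 (lev [])" using lam_root unfolding lev_def[abs_def] by simp
    moreover have "good abs" using good_abs by simp
    ultimately show ?case by (intro exI[of _ abs]) (simp add: ent_def)
  next
    case (Cons fr st)
    obtain s p q where fr: "fr = (s, p, q)" by (cases fr)
    from Cons obtain f where f: "inf_conv f (fst (ent st)) (snd (ent st)) (lev st)" "good f" by blast
    have "good (\<lambda>n. 1 + lev st (p + n * dx s) (q + n * dy s))"
      by (rule good_Suc[OF good_line[OF f(1) entry_ent entry_dir f(2)]])
    moreover have "inf_conv (\<lambda>n. 1 + lev st (p + n * dx s) (q + n * dy s)) (dx (opp s)) (dy (opp s)) (lev (fr # st))"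
      using lam_inf_conv[of st p s q] unfolding lev_def[abs_def] fr .
    ultimately show ?case by (intro exI[of _ "\<lambda>n. 1 + lev st (p + n * dx s) (q + n * dy s)"]) (simp add: ent_def fr)
  qed
  then obtain f where f: "inf_conv f (fst (ent st)) (snd (ent st)) (lev st)" "good f" "st = [] \<longrightarrow> f = abs"
    "\<forall>s p q st'. st = (s, p, q) # st' \<longrightarrow> f = (\<lambda>n. 1 + lev st' (p + n * dx s) (q + n * dy s))" by blast
  show thesis
  proof (rule that[OF f(1,2)])
    show "lev st x y \<ge> 0" for x y by (simp add: lev_def)
    show "st = [] \<Longrightarrow> f = abs" using f(3) by blast
    show "f = (\<lambda>n. 1 + lev st' (p + n * dx s) (q + n * dy s))" if "st = (s, p, q) # st'" for s p q st'
      using f(4) that by blast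
  qed
qed

section \<open>Horizontal edges and peaks\<close>

definition step :: "state \<Rightarrow> state \<Rightarrow> bool" where
  "step \<omega> \<omega>' \<longleftrightarrow> valid (fst \<omega>) \<and> ((fst \<omega>' = fst \<omega> \<and> gadj (snd \<omega>) (snd \<omega>')) \<or> (\<exists>s. \<omega>' = cross s \<omega>))"

definition slev :: "state \<Rightarrow> int" where
  "slev \<omega> = lev (fst \<omega>) (fst (snd \<omega>)) (snd (snd \<omega>))"

lemma slev_simp [simp]: "slev (st, x, y) = lev st x y"
  by (simp add: slev_def)

text \<open>The combinatorial counterpart of \<open>edge_in_ball\<close>: one end strictly below
  \<open>N\<close> keeps the whole edge in the ball.\<close>

definition bedge :: "int \<Rightarrow> state \<Rightarrow> state \<Rightarrow> bool" where
  "bedge N \<omega> \<omega>' \<longleftrightarrow> step \<omega> \<omega>' \<and> slev \<omega> \<le> N \<and> slev \<omega>' \<le> N \<and> (slev \<omega> < N \<or> slev \<omega>' < N)"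

lemma valid_step: "step \<omega> \<omega>' \<Longrightarrow> valid (fst \<omega>')"
  unfolding step_def by (cases \<omega>) (auto intro: valid_cross)

lemma step_sym: "step \<omega> \<omega>' \<Longrightarrow> step \<omega>' \<omega>"
proof -
  assume s: "step \<omega> \<omega>'"
  obtain st x y where w: "\<omega> = (st, x, y)" by (cases \<omega>)
  have v: "valid (fst \<omega>)" using s by (simp add: step_def)
  from s consider "fst \<omega>' = fst \<omega>" "gadj (snd \<omega>) (snd \<omega>')" | s' where "\<omega>' = cross s' \<omega>"
    unfolding step_def by blast
  then show ?thesis
  proof cases
    case 1
    then show ?thesis using v gadj_sym unfolding step_def by metis
  next
    case 2
    have "cross (opp s') \<omega>' = \<omega>" using v cross_opp[of st s' x y] unfolding 2 w by simp
    then show ?thesis using valid_step[OF s] unfolding step_def by metis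
  qed
qed

lemma bedge_sym: "bedge N \<omega> \<omega>' \<Longrightarrow> bedge N \<omega>' \<omega>"
  unfolding bedge_def using step_sym by blast

lemma bedge_mono: "bedge N \<omega> \<omega>' \<Longrightarrow> N \<le> M \<Longrightarrow> bedge M \<omega> \<omega>'"
  unfolding bedge_def by auto

lemma conn_bedge_mono: "conn (bedge N) k u v \<Longrightarrow> N \<le> M \<Longrightarrow> conn (bedge M) k u v"
  using conn_map[of "bedge N" "bedge M" "\<lambda>x. x" k u v] bedge_mono by blast

lemma lev_nonneg: "lev st x y \<ge> 0"
  by (simp add: lev_def)

lemma lev_line: "lev ((s, p, q) # st) (n * dx (opp s)) (n * dy (opp s)) = 1 + lev st (p + n * dx s) (q + n * dy s)"
proof -
  obtain g where g: "inf_conv g (fst (ent st)) (snd (ent st)) (lev st)" by (rule lev_inf_conv)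
  have F: "inf_conv (\<lambda>n. 1 + lev st (p + n * dx s) (q + n * dy s)) (dx (opp s)) (dy (opp s)) (lev ((s, p, q) # st))"
    using lam_inf_conv[of st p s q] unfolding lev_def[abs_def] .
  have "nonexp (\<lambda>n. 1 + lev st (p + n * dx s) (q + n * dy s))"
    using nonexp_inf_conv_line[OF g entry_dir, of p s q] by (simp add: nonexp_def)
  then show ?thesis by (rule inf_conv_line[OF F entry_dir])
qed

lemma lev_step:
  assumes "isgen p q"
  shows "\<bar>lev st (x + p) (y + q) - lev st x y\<bar> \<le> 1"
proof -
  obtain f where f: "inf_conv f (fst (ent st)) (snd (ent st)) (lev st)" by (rule lev_inf_conv)
  show ?thesis
    using inf_conv_step[OF f, of "x + p" x "y + q" y] inf_conv_step[OF f, of x "x + p" y "y + q"] assms isgen_minus[OF assms]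
    by simp
qed

lemma lev_off_line:
  assumes "on_line (fst (ent st)) (snd (ent st)) x y" "isgen p q" "lev st (x + p) (y + q) < lev st x y"
  shows "(p, q) = ent st \<or> (- p, - q) = ent st"
proof -
  obtain f where f: "inf_conv f (fst (ent st)) (snd (ent st)) (lev st)" "good f" by (rule lev_inf_conv)
  have nf: "nonexp f" using f by (simp add: good_def)
  obtain n where n: "x = n * fst (ent st)" "y = n * snd (ent st)" using assms(1) unfolding on_line_def by blast
  have "lev st x y = f n" unfolding n by (rule inf_conv_line[OF f(1) entry_ent nf])
  then have "(p = fst (ent st) \<and> q = snd (ent st)) \<or> (p = - fst (ent st) \<and> q = - snd (ent st))"
    using inf_conv_off_line[OF f(1) entry_ent nf assms(2), of n] assms(3) n by simp
  then show ?thesis by (auto simp: prod_eq_iff)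
qed

lemma lev_root: "lev [] n 0 = \<bar>n\<bar>"
  by (simp add: lev_def nrm_axis)

lemma both_on_line:
  assumes "entry ex ey" "isgen p q" "on_line ex ey x y" "on_line ex ey (x + p) (y + q)"
  shows "(p, q) = (ex, ey) \<or> (- p, - q) = (ex, ey)"
proof -
  obtain n m where n: "x = n * ex" "y = n * ey" "x + p = m * ex" "y + q = m * ey" using assms unfolding on_line_def by blast
  then have "p = m * ex - n * ex" "q = m * ey - n * ey" by linarith+
  then have p: "p = (m - n) * ex" "q = (m - n) * ey" by (simp_all add: left_diff_distrib)
  have "\<bar>m - n\<bar> = 1" using nrm_entry[OF assms(1), of "m - n"] isgen_nrm[OF assms(2)] p by simp
  then have "m - n = 1 \<or> m - n = -1" by linarith
  then show ?thesis
  proof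
    assume d: "m - n = 1"
    show ?thesis using p unfolding d by simp
  next
    assume d: "m - n = -1"
    show ?thesis using p unfolding d by simp
  qed
qed

section \<open>Detours around horizontal edges\<close>

definition hor :: "frame list \<Rightarrow> nat \<Rightarrow> bool" where
  "hor st k \<longleftrightarrow> (\<forall>x y p q N. isgen p q \<longrightarrow> lev st x y = N \<longrightarrow> lev st (x + p) (y + q) = N \<longrightarrow>
     conn (bedge N) k (st, x, y) (st, x + p, y + q))"

lemma hor_off:
  assumes "valid st" and g: "isgen p q" "lev st x y = N" "lev st (x + p) (y + q) = N"
    and off: "\<not> (on_line (fst (ent st)) (snd (ent st)) x y \<and> on_line (fst (ent st)) (snd (ent st)) (x + p) (y + q))"
  shows "conn (bedge N) 4 (st, x, y) (st, x + p, y + q)"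
proof -
  obtain f where f: "inf_conv f (fst (ent st)) (snd (ent st)) (lev st)" "good f" by (rule lev_inf_conv)
  have "bedge N (st, u) (st, v)" if "edge_lt (lev st) N u v" for u v
    using that assms(1) by (auto simp: edge_lt_def edge_le_def bedge_def step_def slev_def case_prod_beta)
  from conn_map[of "edge_lt (lev st) N" "bedge N" "\<lambda>u. (st, u)", OF this entry_hor[OF f(1) entry_ent f(2) g off]]
  show ?thesis by simp
qed

lemma on_root:
  assumes "on_line (fst (ent [])) (snd (ent [])) x y"
  shows "y = 0"
  using assms by (auto simp: on_line_def ent_def)

text \<open>On the conventional entry line of the root the level is the absolute value, so two
  adjacent points of it never have equal levels.\<close>

lemma hor_root: "hor [] 4"
  unfolding hor_def
proof (intro allI impI)
  fix x y p q N assume g: "isgen p q" "lev [] x y = N" "lev [] (x + p) (y + q) = N"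
  show "conn (bedge N) 4 ([], x, y) ([], x + p, y + q)"
  proof (rule hor_off[OF _ g])
    show "\<not> (on_line (fst (ent [])) (snd (ent [])) x y \<and> on_line (fst (ent [])) (snd (ent [])) (x + p) (y + q))"
    proof
      assume on: "on_line (fst (ent [])) (snd (ent [])) x y \<and> on_line (fst (ent [])) (snd (ent [])) (x + p) (y + q)"
      then have y: "y = 0" "y + q = 0" using on_root by blast+
      have "(p, q) = (1, 0) \<or> (- p, - q) = (1, 0)"
        using both_on_line[OF entry_ent g(1), of "[]" x y] on by (simp add: ent_def)
      then have "p = 1 \<or> p = -1" by auto
      then show False using g(2,3) y lev_root[of x] lev_root[of "x + p"] by auto
    qed
  qed simp
qed

lemma bedge_pop:
  assumes "valid ((s, p, q) # st)" "lev ((s, p, q) # st) (n * dx (opp s)) (n * dy (opp s)) \<le> N"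
  shows "bedge N ((s, p, q) # st, n * dx (opp s), n * dy (opp s)) (st, p + n * dx s, q + n * dy s)"
proof -
  have "step ((s, p, q) # st, n * dx (opp s), n * dy (opp s)) (st, p + n * dx s, q + n * dy s)"
    using assms(1) cross_pop[of s p q st n, symmetric] unfolding step_def fst_conv by blast
  then show ?thesis using assms(2) lev_line[of s p q st n] by (simp add: bedge_def)
qed

lemma on_line_frame:
  assumes "on_line (fst (ent ((s, p, q) # st))) (snd (ent ((s, p, q) # st))) x y"
  obtains n where "x = n * dx (opp s)" "y = n * dy (opp s)"
  using assms unfolding on_line_def ent_def by auto

text \<open>The partners in the parent lie exactly one level lower (\<open>lev_line\<close>), so a
  detour for level \<open>N - 1\<close> there serves for level \<open>N\<close> here, at the price
  of two strip edges.\<close>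

lemma conn_pop:
  assumes v: "valid ((s, p, q) # st)" and "lev ((s, p, q) # st) (n * dx (opp s)) (n * dy (opp s)) \<le> N"
    "lev ((s, p, q) # st) (m * dx (opp s)) (m * dy (opp s)) \<le> N"
    and c: "conn (bedge (N - 1)) k (st, p + n * dx s, q + n * dy s) (st, p + m * dx s, q + m * dy s)"
  shows "conn (bedge N) (k + 2) ((s, p, q) # st, n * dx (opp s), n * dy (opp s)) ((s, p, q) # st, m * dx (opp s), m * dy (opp s))"
proof -
  note 1 = bedge_pop[OF v assms(2)] and 2 = bedge_sym[OF bedge_pop[OF v assms(3)]]
  have "conn (bedge N) k (st, p + n * dx s, q + n * dy s) (st, p + m * dx s, q + m * dy s)"
    by (rule conn_bedge_mono[OF c]) simp
  from conn_step[of "bedge N", OF 1 conn_trans[OF this conn_edge[of "bedge N", OF 2]]] show ?thesis by simp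
qed

text \<open>An a-line or b-line borders one strip only. If it were the entry line of its copy, this
  strip would be the one leading back, and the new frame would not be reduced.\<close>

lemma not_on_entry:
  assumes v: "valid ((s, p, q) # st)" and "st \<noteq> []" and s: "s = Sa \<or> s = Sb"
    and on: "on_line (fst (ent st)) (snd (ent st)) (p + n * dx s) (q + n * dy s)"
  shows "ent st \<noteq> (dx s, dy s)"
proof
  assume e: "ent st = (dx s, dy s)"
  then have "dx (opp (fst (hd st))) = dx s" "dy (opp (fst (hd st))) = dy s" using assms(2) by (auto simp: ent_def)
  then have "opp (fst (hd st)) = s" using s by (cases "opp (fst (hd st))") auto
  then have h: "fst (hd st) = opp s" by (metis opp_opp)
  obtain k where k: "p + n * dx s = k * dx s" "q + n * dy s = k * dy s" using on e unfolding on_line_def by auto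
  then have "p = k * dx s - n * dx s" "q = k * dy s - n * dy s" by linarith+
  then have pq: "p = (k - n) * dx s" "q = (k - n) * dy s" by (simp_all add: left_diff_distrib)
  have "pos_on s p q = 0" using v by simp
  then have "k - n = 0" unfolding pq pos_on_line .
  then have "p = 0" "q = 0" using pq by simp_all
  then have "ret st s p q" using h assms(2) by (simp add: ret_def)
  then show False using v by simp
qed

lemma hor_frame:
  assumes v: "valid ((s, p0, q0) # st)"
    and par: "\<And>n m N. m - n = 1 \<or> m - n = - 1 \<Longrightarrow> lev st (p0 + n * dx s) (q0 + n * dy s) = N \<Longrightarrow>
      lev st (p0 + m * dx s) (q0 + m * dy s) = N \<Longrightarrow>
      conn (bedge N) k (st, p0 + n * dx s, q0 + n * dy s) (st, p0 + m * dx s, q0 + m * dy s)"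
    and "k \<ge> 2"
  shows "hor ((s, p0, q0) # st) (k + 2)"
  unfolding hor_def
proof (intro allI impI)
  let ?st = "(s, p0, q0) # st"
  fix x y p q N assume g: "isgen p q" "lev ?st x y = N" "lev ?st (x + p) (y + q) = N"
  show "conn (bedge N) (k + 2) (?st, x, y) (?st, x + p, y + q)"
  proof (cases "on_line (fst (ent ?st)) (snd (ent ?st)) x y \<and> on_line (fst (ent ?st)) (snd (ent ?st)) (x + p) (y + q)")
    case False
    from hor_off[OF v g this] show ?thesis by (rule conn_mono) (use assms(3) in simp)
  next
    case True
    then obtain n m where n: "x = n * dx (opp s)" "y = n * dy (opp s)" and m: "x + p = m * dx (opp s)" "y + q = m * dy (opp s)"
      by (metis on_line_frame)
    then have "p = m * dx (opp s) - n * dx (opp s)" "q = m * dy (opp s) - n * dy (opp s)" by linarith+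
    then have "p = (m - n) * dx (opp s)" "q = (m - n) * dy (opp s)" by (simp_all add: left_diff_distrib)
    then have "\<bar>m - n\<bar> = 1" using nrm_entry[OF entry_dir, of "m - n" "opp s"] isgen_nrm[OF g(1)] by simp
    then have d: "m - n = 1 \<or> m - n = -1" by linarith
    have "conn (bedge (N - 1)) k (st, p0 + n * dx s, q0 + n * dy s) (st, p0 + m * dx s, q0 + m * dy s)"
      by (rule par[OF d]) (use g(2,3)[unfolded n m] g(3)[unfolded m] lev_line[of s p0 q0 st n] lev_line[of s p0 q0 st m] in simp_all)
    from conn_pop[OF v _ _ this] show ?thesis
      using g(2)[unfolded n] g(3)[unfolded m] unfolding m unfolding n by simp
  qed
qed

lemma line_neighbours:
  fixes n m :: int
  assumes "m - n = 1 \<or> m - n = - 1"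
  shows "p + m * dx s = p + n * dx s + (m - n) * dx s" "q + m * dy s = q + n * dy s + (m - n) * dy s"
    "isgen ((m - n) * dx s) ((m - n) * dy s)"
  using assms isgen_dir[of s] isgen_minus[OF isgen_dir[of s]] by (auto simp: algebra_simps)

lemma ent_unit:
  assumes e: "e = 1 \<or> e = - 1" and "(e * dx s, e * dy s) = ent st \<or> (- (e * dx s), - (e * dy s)) = ent st"
  shows "ent st = (dx s, dy s)"
proof -
  have "ent st = (dx s, dy s) \<or> ent st = (- dx s, - dy s)" using assms by auto
  moreover have "ent st \<noteq> (- dx s, - dy s)" using entry_ent[of st] by (cases s) (auto simp: entry_def)
  ultimately show ?thesis by blast
qed

text \<open>After a crossing by s or t one push suffices: in a parent other than the root, the line
  reached is not the entry line. This gives 4 + 2.\<close>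

lemma hor_upper:
  assumes v: "valid ((s, p0, q0) # st)" and s: "s = Sa \<or> s = Sb"
  shows "hor ((s, p0, q0) # st) 6"
proof -
  have "hor ((s, p0, q0) # st) (4 + 2)"
  proof (rule hor_frame[OF v])
    fix n m N :: int
    assume mn: "m - n = 1 \<or> m - n = - 1"
      and l: "lev st (p0 + n * dx s) (q0 + n * dy s) = N" "lev st (p0 + m * dx s) (q0 + m * dy s) = N"
    note nb = line_neighbours[OF mn, where s = s]
    show "conn (bedge N) 4 (st, p0 + n * dx s, q0 + n * dy s) (st, p0 + m * dx s, q0 + m * dy s)"
    proof (cases "st = []")
      case True
      show ?thesis using hor_root nb l unfolding hor_def True by metis
    next
      case False
      have "conn (bedge N) 4 (st, p0 + n * dx s, q0 + n * dy s) (st, p0 + n * dx s + (m - n) * dx s, q0 + n * dy s + (m - n) * dy s)"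
      proof (rule hor_off[OF _ nb(3) l(1)])
        show "valid st" using v by simp
        show "lev st (p0 + n * dx s + (m - n) * dx s) (q0 + n * dy s + (m - n) * dy s) = N"
          using l(2) unfolding nb(1)[of p0] nb(2)[of q0] .
        show "\<not> (on_line (fst (ent st)) (snd (ent st)) (p0 + n * dx s) (q0 + n * dy s) \<and>
           on_line (fst (ent st)) (snd (ent st)) (p0 + n * dx s + (m - n) * dx s) (q0 + n * dy s + (m - n) * dy s))"
        proof
          assume on: "on_line (fst (ent st)) (snd (ent st)) (p0 + n * dx s) (q0 + n * dy s) \<and>
             on_line (fst (ent st)) (snd (ent st)) (p0 + n * dx s + (m - n) * dx s) (q0 + n * dy s + (m - n) * dy s)"
          then have "((m - n) * dx s, (m - n) * dy s) = ent st \<or> (- ((m - n) * dx s), - ((m - n) * dy s)) = ent st"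
            using both_on_line[OF entry_ent nb(3)] by (metis prod.collapse)
          then have "ent st = (dx s, dy s)" by (rule ent_unit[OF mn])
          then show False using not_on_entry[OF v False s] on by blast
        qed
      qed
      then show ?thesis unfolding nb(1)[of p0] nb(2)[of q0] .
    qed
  qed simp
  then show ?thesis by simp
qed

lemma ent_diag:
  assumes "ent st = (2, 2)"
  obtains s p q st' where "st = (s, p, q) # st'" "s = Sa \<or> s = Sb"
proof (cases st)
  case Nil
  then show thesis using assms by (simp add: ent_def)
next
  case (Cons fr st')
  obtain s p q where fr: "fr = (s, p, q)" by (cases fr)
  have "s = Sa \<or> s = Sb" using assms unfolding Cons fr ent_def by (cases s) auto
  then show thesis using that Cons fr by blast
qed

text \<open>After a crossing by the inverse of s or t the line reached in the parent is a d-line,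
  possibly its entry line. Then the parent itself was entered by s or t, so the bound 6 applies
  there, and 6 + 2 results.\<close>

lemma hor_all:
  assumes v: "valid st"
  shows "hor st 8"
proof (cases st)
  case Nil
  have "conn E 8 u v" if "conn E 4 u v" for E and u v :: state using that by (rule conn_mono) simp
  then show ?thesis using hor_root unfolding Nil hor_def by blast
next
  case (Cons fr st')
  obtain s p0 q0 where fr: "fr = (s, p0, q0)" by (cases fr)
  show ?thesis
  proof (cases "s = Sa \<or> s = Sb")
    case True
    have "conn E 8 u v" if "conn E 6 u v" for E and u v :: state using that by (rule conn_mono) simp
    then show ?thesis using hor_upper[OF v[unfolded Cons fr] True] unfolding Cons fr hor_def by blast
  next
    case False
    then have s: "dx s = 2" "dy s = 2" by (cases s; simp)+
    have "hor ((s, p0, q0) # st') (6 + 2)"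
    proof (rule hor_frame[OF v[unfolded Cons fr]])
      fix n m N :: int
      assume mn: "m - n = 1 \<or> m - n = - 1"
        and l: "lev st' (p0 + n * dx s) (q0 + n * dy s) = N" "lev st' (p0 + m * dx s) (q0 + m * dy s) = N"
      note nb = line_neighbours[OF mn, where s = s]
      have l2: "lev st' (p0 + n * dx s + (m - n) * dx s) (q0 + n * dy s + (m - n) * dy s) = N"
        using l(2) unfolding nb(1)[of p0] nb(2)[of q0] .
      have v': "valid st'" using v Cons fr by simp
      have "conn (bedge N) 6 (st', p0 + n * dx s, q0 + n * dy s) (st', p0 + n * dx s + (m - n) * dx s, q0 + n * dy s + (m - n) * dy s)"
      proof (cases "on_line (fst (ent st')) (snd (ent st')) (p0 + n * dx s) (q0 + n * dy s) \<and>
           on_line (fst (ent st')) (snd (ent st')) (p0 + n * dx s + (m - n) * dx s) (q0 + n * dy s + (m - n) * dy s)")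
        case False
        from hor_off[OF v' nb(3) l(1) l2 this] show ?thesis by (rule conn_mono) simp
      next
        case True
        then have "((m - n) * dx s, (m - n) * dy s) = ent st' \<or> (- ((m - n) * dx s), - ((m - n) * dy s)) = ent st'"
          using both_on_line[OF entry_ent nb(3)] by (metis prod.collapse)
        then have "ent st' = (dx s, dy s)" by (rule ent_unit[OF mn])
        then have "ent st' = (2, 2)" using s by simp
        then obtain s' p q st'' where "st' = (s', p, q) # st''" "s' = Sa \<or> s' = Sb" by (rule ent_diag)
        then have "hor st' 6" using hor_upper v' by blast
        then show ?thesis using nb(3) l(1) l2 unfolding hor_def by blast
      qed
      then show "conn (bedge N) 6 (st', p0 + n * dx s, q0 + n * dy s) (st', p0 + m * dx s, q0 + m * dy s)"
        unfolding nb(1)[of p0] nb(2)[of q0] .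
    qed simp
    then show ?thesis unfolding Cons fr by simp
  qed
qed

section \<open>Detours around peaks\<close>

definition peak :: "frame list \<Rightarrow> nat \<Rightarrow> bool" where
  "peak st k \<longleftrightarrow> (\<forall>x y p q p' q' N. lev st x y = N + 1 \<longrightarrow> isgen p q \<longrightarrow> lev st (x + p) (y + q) \<le> N \<longrightarrow>
     isgen p' q' \<longrightarrow> lev st (x + p') (y + q') \<le> N \<longrightarrow> conn (bedge N) k (st, x + p, y + q) (st, x + p', y + q'))"

text \<open>64 = 8 * 8: \<open>entry_peak\<close> yields at most 8 edges, and each of them that is
  horizontal on level \<open>N\<close> is replaced by at most 8 edges.\<close>

lemma peak_off:
  assumes v: "valid st" and x: "lev st x y = N + 1"
    and g: "isgen p q" "lev st (x + p) (y + q) \<le> N" and g': "isgen p' q'" "lev st (x + p') (y + q') \<le> N"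
    and off: "\<not> on_line (fst (ent st)) (snd (ent st)) x y"
  shows "conn (bedge N) 64 (st, x + p, y + q) (st, x + p', y + q')"
proof -
  obtain f where f: "inf_conv f (fst (ent st)) (snd (ent st)) (lev st)" "good f" by (rule lev_inf_conv)
  have c: "conn (edge_le (lev st) N) 8 (x + p, y + q) (x + p', y + q')"
    by (rule entry_peak[OF f(1) entry_ent f(2) off x g g'])
  have "conn (bedge N) 8 (st, a) (st, b)" if e: "edge_le (lev st) N a b" for a b
  proof -
    obtain a1 a2 b1 b2 where ab: "a = (a1, a2)" "b = (b1, b2)" by (cases a, cases b)
    have e: "isgen (b1 - a1) (b2 - a2)" "lev st a1 a2 \<le> N" "lev st b1 b2 \<le> N"
      using e unfolding edge_le_def gadj_def ab by simp_all
    show ?thesis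
    proof (cases "lev st a1 a2 = N \<and> lev st b1 b2 = N")
      case True
      have "conn (bedge N) 8 (st, a1, a2) (st, a1 + (b1 - a1), a2 + (b2 - a2))"
        by (rule hor_all[OF v, unfolded hor_def, rule_format, OF e(1)]) (use True in simp_all)
      then show ?thesis by (simp add: ab)
    next
      case False
      then have "bedge N (st, a) (st, b)"
        using e v unfolding bedge_def step_def gadj_def ab by auto
      then show ?thesis using conn_mono[OF conn_edge[of "bedge N"], of "(st, a)" "(st, b)" 8] by simp
    qed
  qed
  from conn_bind[of "edge_le (lev st) N" "bedge N" 8 "\<lambda>u. (st, u)", OF this c] show ?thesis by simp
qed

lemma lev_down:
  assumes "lev st x y = N + 1" "isgen p q" "lev st (x + p) (y + q) \<le> N" "on_line (fst (ent st)) (snd (ent st)) x y"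
  shows "(p, q) = ent st \<or> (- p, - q) = ent st"
  using lev_off_line[OF assms(4,2)] assms by simp

lemma lev_down_frame:
  assumes "lev ((s, p0, q0) # st) x y = N + 1" "isgen p q" "lev ((s, p0, q0) # st) (x + p) (y + q) \<le> N"
    "on_line (fst (ent ((s, p0, q0) # st))) (snd (ent ((s, p0, q0) # st))) x y"
  obtains e where "e = 1 \<or> e = - 1" "p = e * dx (opp s)" "q = e * dy (opp s)"
  using lev_down[OF assms]
proof
  assume "(p, q) = ent ((s, p0, q0) # st)"
  then have "p = 1 * dx (opp s)" "q = 1 * dy (opp s)" by (simp_all add: ent_def)
  then show thesis using that[of 1] by blast
next
  assume "(- p, - q) = ent ((s, p0, q0) # st)"
  then have "- p = dx (opp s)" "- q = dy (opp s)" by (simp_all add: ent_def)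
  then have "p = - 1 * dx (opp s)" "q = - 1 * dy (opp s)" by linarith+
  then show thesis using that[of "- 1"] by blast
qed

lemma peak_root: "peak [] 64"
  unfolding peak_def
proof (intro allI impI)
  fix x y p q p' q' N
  assume x: "lev [] x y = N + 1" and g: "isgen p q" "lev [] (x + p) (y + q) \<le> N" and g': "isgen p' q'" "lev [] (x + p') (y + q') \<le> N"
  show "conn (bedge N) 64 ([], x + p, y + q) ([], x + p', y + q')"
  proof (cases "on_line (fst (ent [])) (snd (ent [])) x y")
    case False
    show ?thesis by (rule peak_off[OF _ x g g' False]) simp
  next
    case True
    then have y: "y = 0" by (rule on_root)
    have "(p, q) = (1, 0) \<or> (p, q) = (- 1, 0)" using lev_down[OF x g True] by (auto simp: ent_def)
    moreover have "(p', q') = (1, 0) \<or> (p', q') = (- 1, 0)" using lev_down[OF x g' True] by (auto simp: ent_def)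
    ultimately have pq: "q = 0" "q' = 0" "p = 1 \<or> p = -1" "p' = 1 \<or> p' = - 1" by auto
    \<comment> \<open>The absolute value cannot decrease in both directions, so the two neighbours
      coincide.\<close>
    have "\<bar>x\<bar> = N + 1" "\<bar>x + p\<bar> \<le> N" "\<bar>x + p'\<bar> \<le> N"
      using x g(2) g'(2) unfolding y pq(1,2) by (simp_all add: lev_root)
    then have "p = p'" using pq(3,4) by linarith
    then show ?thesis using pq by (simp add: conn_refl)
  qed
qed

text \<open>At a peak on the entry line both lower neighbours are on the line, so the peak and they
  move together to the parent, one level down.\<close>

lemma peak_frame:
  assumes v: "valid ((s, p0, q0) # st)"
    and par: "\<And>n e e' N. e = 1 \<or> e = - 1 \<Longrightarrow> e' = 1 \<or> e' = - 1 \<Longrightarrow> lev st (p0 + n * dx s) (q0 + n * dy s) = N + 1 \<Longrightarrow>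
      lev st (p0 + n * dx s + e * dx s) (q0 + n * dy s + e * dy s) \<le> N \<Longrightarrow>
      lev st (p0 + n * dx s + e' * dx s) (q0 + n * dy s + e' * dy s) \<le> N \<Longrightarrow>
      conn (bedge N) k (st, p0 + n * dx s + e * dx s, q0 + n * dy s + e * dy s)
        (st, p0 + n * dx s + e' * dx s, q0 + n * dy s + e' * dy s)"
    and k: "k \<ge> 64"
  shows "peak ((s, p0, q0) # st) (k + 2)"
  unfolding peak_def
proof (intro allI impI)
  let ?st = "(s, p0, q0) # st"
  fix x y p q p' q' N
  assume x: "lev ?st x y = N + 1" and g: "isgen p q" "lev ?st (x + p) (y + q) \<le> N" and g': "isgen p' q'" "lev ?st (x + p') (y + q') \<le> N"
  show "conn (bedge N) (k + 2) (?st, x + p, y + q) (?st, x + p', y + q')"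
  proof (cases "on_line (fst (ent ?st)) (snd (ent ?st)) x y")
    case False
    from peak_off[OF v x g g' False] show ?thesis by (rule conn_mono) (use k in simp)
  next
    case True
    then obtain n where n: "x = n * dx (opp s)" "y = n * dy (opp s)" by (rule on_line_frame)
    obtain e where e: "e = 1 \<or> e = -1" "p = e * dx (opp s)" "q = e * dy (opp s)"
      by (rule lev_down_frame[OF x g True])
    obtain e' where e': "e' = 1 \<or> e' = -1" "p' = e' * dx (opp s)" "q' = e' * dy (opp s)"
      by (rule lev_down_frame[OF x g' True])
    have s: "n * dx (opp s) + i * dx (opp s) = (n + i) * dx (opp s)" "n * dy (opp s) + i * dy (opp s) = (n + i) * dy (opp s)"
      "p0 + n * dx s + i * dx s = p0 + (n + i) * dx s" "q0 + n * dy s + i * dy s = q0 + (n + i) * dy s" for i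
      by (simp_all add: algebra_simps)
    have l: "lev ?st ((n + e) * dx (opp s)) ((n + e) * dy (opp s)) \<le> N" "lev ?st ((n + e') * dx (opp s)) ((n + e') * dy (opp s)) \<le> N"
      using g(2) g'(2) unfolding n e(2,3) e'(2,3) s(1,2) .
    have "conn (bedge (N - 1)) k (st, p0 + n * dx s + e * dx s, q0 + n * dy s + e * dy s)
        (st, p0 + n * dx s + e' * dx s, q0 + n * dy s + e' * dy s)"
    proof (rule par[OF e(1) e'(1)])
      show "lev st (p0 + n * dx s) (q0 + n * dy s) = N - 1 + 1"
        using x[unfolded n] lev_line[of s p0 q0 st n] by linarith
      show "lev st (p0 + n * dx s + e * dx s) (q0 + n * dy s + e * dy s) \<le> N - 1"
        unfolding s using l(1) lev_line[of s p0 q0 st "n + e"] by linarith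
      show "lev st (p0 + n * dx s + e' * dx s) (q0 + n * dy s + e' * dy s) \<le> N - 1"
        unfolding s using l(2) lev_line[of s p0 q0 st "n + e'"] by linarith
    qed
    from conn_pop[OF v l this[unfolded s(3,4)]] show ?thesis
      unfolding n e(2,3) e'(2,3) s(1,2) .
  qed
qed

lemma isgen_unit: "e = 1 \<or> e = - 1 \<Longrightarrow> isgen (e * dx s) (e * dy s)"
  using isgen_dir[of s] isgen_minus[OF isgen_dir[of s]] by auto

lemma peak_upper:
  assumes v: "valid ((s, p0, q0) # st)" and s: "s = Sa \<or> s = Sb"
  shows "peak ((s, p0, q0) # st) 66"
proof -
  have "peak ((s, p0, q0) # st) (64 + 2)"
  proof (rule peak_frame[OF v])
    fix n e e' N :: int
    assume e: "e = 1 \<or> e = - 1" and e': "e' = 1 \<or> e' = - 1" and x: "lev st (p0 + n * dx s) (q0 + n * dy s) = N + 1"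
      and l: "lev st (p0 + n * dx s + e * dx s) (q0 + n * dy s + e * dy s) \<le> N"
      "lev st (p0 + n * dx s + e' * dx s) (q0 + n * dy s + e' * dy s) \<le> N"
    show "conn (bedge N) 64 (st, p0 + n * dx s + e * dx s, q0 + n * dy s + e * dy s)
        (st, p0 + n * dx s + e' * dx s, q0 + n * dy s + e' * dy s)"
    proof (cases "st = []")
      case True
      show ?thesis using peak_root x l isgen_unit[OF e, of s] isgen_unit[OF e', of s] unfolding peak_def True by blast
    next
      case False
      have off: "\<not> on_line (fst (ent st)) (snd (ent st)) (p0 + n * dx s) (q0 + n * dy s)"
      proof
        assume on: "on_line (fst (ent st)) (snd (ent st)) (p0 + n * dx s) (q0 + n * dy s)"
        have "ent st = (dx s, dy s)" by (rule ent_unit[OF e lev_down[OF x isgen_unit[OF e] l(1) on]])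
        with not_on_entry[OF v False s on] show False by blast
      qed
      show ?thesis
        by (rule peak_off[OF _ x isgen_unit[OF e] l(1) isgen_unit[OF e'] l(2) off]) (use v in simp)
    qed
  qed simp
  then show ?thesis by simp
qed

lemma peak_mono:
  assumes p: "peak st k" and "k \<le> l"
  shows "peak st l"
  unfolding peak_def
proof (intro allI impI)
  fix x y p q p' q' N
  assume a: "lev st x y = N + 1" "isgen p q" "lev st (x + p) (y + q) \<le> N" "isgen p' q'" "lev st (x + p') (y + q') \<le> N"
  from p[unfolded peak_def, rule_format, OF a] show "conn (bedge N) l (st, x + p, y + q) (st, x + p', y + q')"
    by (rule conn_mono) fact
qed

text \<open>The same two pushes as for horizontal edges, now giving 64 + 2 + 2.\<close>

lemma peak_all:
  assumes v: "valid st"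
  shows "peak st 68"
proof (cases st)
  case Nil
  then show ?thesis using peak_mono[OF peak_root, of 68] by simp
next
  case (Cons fr st')
  obtain s p0 q0 where fr: "fr = (s, p0, q0)" by (cases fr)
  show ?thesis
  proof (cases "s = Sa \<or> s = Sb")
    case True
    then show ?thesis using peak_mono[OF peak_upper[OF v[unfolded Cons fr] True], of 68] unfolding Cons fr by simp
  next
    case False
    then have s: "dx s = 2" "dy s = 2" by (cases s; simp)+
    have v': "valid st'" using v Cons fr by simp
    have "peak ((s, p0, q0) # st') (66 + 2)"
    proof (rule peak_frame[OF v[unfolded Cons fr]])
      fix n e e' N :: int
      assume e: "e = 1 \<or> e = - 1" and e': "e' = 1 \<or> e' = - 1" and x: "lev st' (p0 + n * dx s) (q0 + n * dy s) = N + 1"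
        and l: "lev st' (p0 + n * dx s + e * dx s) (q0 + n * dy s + e * dy s) \<le> N"
        "lev st' (p0 + n * dx s + e' * dx s) (q0 + n * dy s + e' * dy s) \<le> N"
      show "conn (bedge N) 66 (st', p0 + n * dx s + e * dx s, q0 + n * dy s + e * dy s)
          (st', p0 + n * dx s + e' * dx s, q0 + n * dy s + e' * dy s)"
      proof (cases "on_line (fst (ent st')) (snd (ent st')) (p0 + n * dx s) (q0 + n * dy s)")
        case False
        from peak_off[OF v' x isgen_unit[OF e] l(1) isgen_unit[OF e'] l(2) False] show ?thesis
          by (rule conn_mono) simp
      next
        case True
        have "ent st' = (dx s, dy s)" by (rule ent_unit[OF e lev_down[OF x isgen_unit[OF e] l(1) True]])
        then have "ent st' = (2, 2)" using s by simp
        then obtain s' p q st'' where "st' = (s', p, q) # st''" "s' = Sa \<or> s' = Sb" by (rule ent_diag)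
        then have "peak st' 66" using peak_upper v' by blast
        then show ?thesis using x l isgen_unit[OF e, of s] isgen_unit[OF e', of s] unfolding peak_def by blast
      qed
    qed simp
    then show ?thesis unfolding Cons fr by simp
  qed
qed

section \<open>Arbitrary pairs of adjacent states and paths of length two\<close>

text \<open>Strip edges are never horizontal, and they descend only when they lead back to the
  parent; this limits the shapes of peaks in \<open>two_steps\<close>.\<close>

lemma cross_lev:
  assumes "valid st"
  obtains "slev (cross s (st, x, y)) = lev st x y + 1"
  | p q st' n where "st = (opp s, p, q) # st'" "x = n * dx s" "y = n * dy s"
     "cross s (st, x, y) = (st', p + n * dx (opp s), q + n * dy (opp s))" "slev (cross s (st, x, y)) = lev st x y - 1"
  using assms
proof (cases rule: cross_cases[of st x s y])
  case (push p q n)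
  have "slev (cross s (st, x, y)) = lev ((s, p, q) # st) (n * dx (opp s)) (n * dy (opp s))" by (simp add: push(4))
  also have "\<dots> = lev st x y + 1" using lev_line[of s p q st n] push(1,2) by simp
  finally have "slev (cross s (st, x, y)) = lev st x y + 1" .
  then show thesis by (rule that(1))
next
  case (pop p q st' n)
  have "slev (cross s (st, x, y)) = lev st x y - 1"
    using lev_line[of "opp s" p q st' n] unfolding pop(5) slev_simp unfolding pop(1,2,3) by simp
  with pop show thesis by (intro that(2)) 
qed

lemma step_cases:
  assumes "step (st, x, y) \<omega>"
  obtains p q where "isgen p q" "\<omega> = (st, x + p, y + q)" | s where "\<omega> = cross s (st, x, y)"
  using assms
proof -
  obtain st' x' y' where w: "\<omega> = (st', x', y')" by (cases \<omega>)
  from assms consider "st' = st" "gadj (x, y) (x', y')" | s where "\<omega> = cross s (st, x, y)"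
    unfolding step_def w by auto
  then show thesis
  proof cases
    case 1
    then show thesis using that(1)[of "x' - x" "y' - y"] w by (simp add: gadj_def)
  next
    case 2
    then show thesis by (rule that(2))
  qed
qed

lemma step_lev: "step \<omega> \<omega>' \<Longrightarrow> \<bar>slev \<omega>' - slev \<omega>\<bar> \<le> 1"
proof -
  assume s: "step \<omega> \<omega>'"
  obtain st x y where w: "\<omega> = (st, x, y)" by (cases \<omega>)
  have v: "valid st" using s w by (simp add: step_def)
  from s[unfolded w] show ?thesis
  proof (cases rule: step_cases)
    case (1 p q)
    then show ?thesis using lev_step[of p q st x y] w by simp
  next
    case (2 s)
    show ?thesis unfolding 2 w by (rule cross_lev[OF v, of s x y]) simp_all
  qed
qed

lemma step_level:
  assumes "step \<omega> \<omega>'" "slev \<omega> = N" "slev \<omega>' = N"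
  shows "conn (bedge N) 8 \<omega> \<omega>'"
proof -
  obtain st x y where w: "\<omega> = (st, x, y)" by (cases \<omega>)
  have v: "valid st" using assms w by (simp add: step_def)
  from assms(1)[unfolded w] show ?thesis
  proof (cases rule: step_cases)
    case (1 p q)
    show ?thesis unfolding w 1(2)
      by (rule hor_all[OF v, unfolded hor_def, rule_format, OF 1(1)]) (use assms(2,3) 1(2) w in simp_all)
  next
    case (2 s)
    have "slev (cross s (st, x, y)) \<noteq> lev st x y" by (rule cross_lev[OF v, of s x y]) auto
    then show ?thesis using assms 2 w by simp
  qed
qed

text \<open>A peak with one lower neighbour across the entry strip and another in its own copy: the
  latter is on the entry line, so one square of the strip provides the detour.\<close>

lemma strip_turn:
  assumes v: "valid ((s, p0, q0) # st)" and x: "lev ((s, p0, q0) # st) (n * dx (opp s)) (n * dy (opp s)) = N + 1"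
    and g: "isgen p q" "lev ((s, p0, q0) # st) (n * dx (opp s) + p) (n * dy (opp s) + q) \<le> N"
  shows "conn (bedge N) 2 (st, p0 + n * dx s, q0 + n * dy s) ((s, p0, q0) # st, n * dx (opp s) + p, n * dy (opp s) + q)"
proof -
  let ?st = "(s, p0, q0) # st"
  have on: "on_line (fst (ent ?st)) (snd (ent ?st)) (n * dx (opp s)) (n * dy (opp s))"
    by (auto simp: ent_def on_line_def)
  obtain e where e: "e = 1 \<or> e = -1" "p = e * dx (opp s)" "q = e * dy (opp s)"
    by (rule lev_down_frame[OF x g on])
  have sh: "n * dx (opp s) + e * dx (opp s) = (n + e) * dx (opp s)" "n * dy (opp s) + e * dy (opp s) = (n + e) * dy (opp s)"
    by (simp_all add: algebra_simps)
  have l: "lev ?st ((n + e) * dx (opp s)) ((n + e) * dy (opp s)) \<le> N" using g(2) unfolding e(2,3) sh .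
  note b = bedge_sym[OF bedge_pop[OF v l]]
  have l0: "lev st (p0 + n * dx s) (q0 + n * dy s) = N" using x lev_line[of s p0 q0 st n] by simp
  have l1: "lev st (p0 + (n + e) * dx s) (q0 + (n + e) * dy s) < N" using l lev_line[of s p0 q0 st "n + e"] by simp
  have "p0 + (n + e) * dx s - (p0 + n * dx s) = e * dx s" "q0 + (n + e) * dy s - (q0 + n * dy s) = e * dy s"
    by (simp_all add: algebra_simps)
  then have "step (st, p0 + n * dx s, q0 + n * dy s) (st, p0 + (n + e) * dx s, q0 + (n + e) * dy s)"
    using v isgen_unit[OF e(1), of s] unfolding step_def gadj_def fst_conv snd_conv by simp
  then have "bedge N (st, p0 + n * dx s, q0 + n * dy s) (st, p0 + (n + e) * dx s, q0 + (n + e) * dy s)"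
    using l0 l1 by (simp add: bedge_def)
  from conn2[of "bedge N", OF this b] show ?thesis unfolding e(2,3) sh .
qed

lemma two_steps:
  assumes "step \<omega> m" "step m \<omega>'" "slev \<omega> = N" "slev \<omega>' = N"
  shows "conn (bedge N) 68 \<omega> \<omega>'"
proof -
  have up: "conn E 68 u v" if "conn E k u v" "k \<le> 68" for E k and u v :: state using that by (rule conn_mono)
  consider "slev m < N" | "slev m = N" | "slev m = N + 1" using step_lev[OF assms(1)] assms(3) by linarith
  then show ?thesis
  proof cases
    case 1
    then have "bedge N \<omega> m" "bedge N m \<omega>'" using assms by (auto simp: bedge_def)
    from up[OF conn2[of "bedge N", OF this]] show ?thesis by simp
  next
    case 2
    from up[OF conn_trans[OF step_level[OF assms(1,3) 2] step_level[OF assms(2) 2 assms(4)]]] show ?thesis by simp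
  next
    case 3
    obtain st x y where m: "m = (st, x, y)" by (cases m)
    have v: "valid st" using assms(2) m by (simp add: step_def)
    have x: "lev st x y = N + 1" using 3 m by simp
    \<comment> \<open>Strips to children go up from the peak, so a neighbour on level
      \<open>N\<close> lies in the same copy or is the partner across the entry strip.\<close>
    have C: "(\<exists>p q. isgen p q \<and> w = (st, x + p, y + q)) \<or>
       (\<exists>s p q st' n. st = (s, p, q) # st' \<and> x = n * dx (opp s) \<and> y = n * dy (opp s) \<and> w = (st', p + n * dx s, q + n * dy s))"
      if "step m w" "slev w = N" for w
      using that(1)[unfolded m]
    proof (cases rule: step_cases)
      case (1 p q)
      then show ?thesis by blast
    next
      case (2 s)
      show ?thesis
      proof (rule cross_lev[OF v, of s x y])
        assume "slev (cross s (st, x, y)) = lev st x y + 1"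
        then show ?thesis using that(2) 2 x by simp
      next
        fix p q st' n
        assume *: "st = (opp s, p, q) # st'" "x = n * dx s" "y = n * dy s" "cross s (st, x, y) = (st', p + n * dx (opp s), q + n * dy (opp s))"
        have "st = (opp s, p, q) # st' \<and> x = n * dx (opp (opp s)) \<and> y = n * dy (opp (opp s)) \<and>
          w = (st', p + n * dx (opp s), q + n * dy (opp s))" using * 2 by simp
        then show ?thesis by blast
      qed
    qed
    from C[OF step_sym[OF assms(1)] assms(3)] C[OF assms(2,4)] show ?thesis
    proof (elim disjE exE conjE)
      fix p q p' q' assume g: "isgen p q" "isgen p' q'" and w: "\<omega> = (st, x + p, y + q)" "\<omega>' = (st, x + p', y + q')"
      show ?thesis
        unfolding w by (rule peak_all[OF v, unfolded peak_def, rule_format, OF x g(1) _ g(2)])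
          (use assms(3,4) w in simp_all)
    next
      fix p q s p0 q0 st' n
      assume g: "isgen p q" and w: "\<omega> = (st, x + p, y + q)" "\<omega>' = (st', p0 + n * dx s, q0 + n * dy s)"
        and st: "st = (s, p0, q0) # st'" and xy: "x = n * dx (opp s)" "y = n * dy (opp s)"
      have "conn (bedge N) 2 \<omega>' \<omega>"
        using strip_turn[OF v[unfolded st] x[unfolded st xy] g] assms(3) unfolding w st xy slev_simp by simp
      from up[OF conn_sym[of "bedge N", OF bedge_sym this]] show ?thesis by simp
    next
      fix p q s p0 q0 st' n
      assume g: "isgen p q" and w: "\<omega>' = (st, x + p, y + q)" "\<omega> = (st', p0 + n * dx s, q0 + n * dy s)"
        and st: "st = (s, p0, q0) # st'" and xy: "x = n * dx (opp s)" "y = n * dy (opp s)"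
      have "conn (bedge N) 2 \<omega> \<omega>'"
        using strip_turn[OF v[unfolded st] x[unfolded st xy] g] assms(4) unfolding w st xy slev_simp by simp
      from up[OF this] show ?thesis by simp
    next
      fix s p0 q0 st' n s' p0' q0' st'' n'
      assume w: "\<omega> = (st', p0 + n * dx s, q0 + n * dy s)" "\<omega>' = (st'', p0' + n' * dx s', q0' + n' * dy s')"
        and st: "st = (s, p0, q0) # st'" "st = (s', p0', q0') # st''"
        and xy: "x = n * dx (opp s)" "y = n * dy (opp s)" "x = n' * dx (opp s')" "y = n' * dy (opp s')"
      have "s' = s" "p0' = p0" "q0' = q0" "st'' = st'" using st by auto
      moreover have "n = pos_on (opp s) x y" unfolding xy(1,2) by simp
      moreover have "n' = pos_on (opp s') x y" unfolding xy(3,4) by simp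
      ultimately have "\<omega>' = \<omega>" using w by simp
      then show ?thesis by (simp add: conn_refl)
    qed
  qed
qed

section \<open>Descending neighbours\<close>

text \<open>The half of "\<open>nrm\<close> is the word length" that produces generators. Swapping
  and the map to (-y, -x) reduce it to \<open>x \<ge> 0\<close>, \<open>x \<ge> y\<close>, where the
  norm has one simple formula on each side of the a-axis.\<close>

lemma nrm_descent:
  assumes "nrm x y > 0"
  obtains p q where "isgen p q" "nrm (x - p) (y - q) \<le> nrm x y - 1"
proof -
  have A: "\<exists>p q. isgen p q \<and> nrm (x - p) (y - q) \<le> nrm x y - 1" if H: "nrm x y > 0" "x \<ge> 0" "x \<ge> y" for x y
  proof -
    consider "y \<le> 0" "x \<ge> 1" | "y \<le> -1" "x = 0" | "x = 0" "y = 0" | "y = 1" | "y \<ge> 2" using H(2,3) by linarith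
    then show ?thesis
    proof cases
      case 1
      then show ?thesis using nrm_quadrant[of x y] nrm_quadrant[of "x - 1" y] by (intro exI[of _ 1] exI[of _ 0]) simp
    next
      case 2
      then show ?thesis using nrm_quadrant[of x y] nrm_quadrant[of x "y + 1"] by (intro exI[of _ 0] exI[of _ "-1"]) simp
    next
      case 3
      then show ?thesis using H by simp
    next
      case 4
      have "nrm x 1 = x" using nrm_upper[of 1 x] nrm_swap[of 1 x] 4 H by simp
      moreover have "nrm (x - 1) 0 = x - 1" using nrm_axis[of "x - 1"] 4 H by simp
      ultimately show ?thesis using 4 by (intro exI[of _ 1]) simp
    next
      case 5
      have "nrm x y = x - y div 2" using nrm_upper[of y x] nrm_swap[of y x] 5 H by simp
      moreover have "nrm (x - 2) (y - 2) = x - 2 - (y - 2) div 2"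
        using nrm_upper[of "y - 2" "x - 2"] nrm_swap[of "y - 2" "x - 2"] 5 H by simp
      moreover have "(y - 2) div 2 = y div 2 - 1" by simp
      ultimately show ?thesis by (intro exI[of _ 2]) simp
    qed
  qed
  have B: "\<exists>p q. isgen p q \<and> nrm (x - p) (y - q) \<le> nrm x y - 1" if n: "nrm x y > 0" and xy: "x \<ge> y" for x y
  proof (cases "x \<ge> 0")
    case True
    show ?thesis by (rule A[OF n True xy])
  next
    case False
    have "nrm (- y) (- x) = nrm x y" using nrm_neg[of y x] nrm_swap[of x y] by simp
    with A[of "- y" "- x"] n xy False obtain p q where g: "isgen p q" "nrm (- y - p) (- x - q) \<le> nrm x y - 1" by auto
    have "nrm (- y - p) (- x - q) = nrm (x - (- q)) (y - (- p))"
      using nrm_neg[of "y + p" "x + q"] nrm_swap[of "x + q" "y + p"] by simp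
    with g isgen_minus[OF isgen_swap[OF g(1)]] show ?thesis by (intro exI[of _ "- q"] exI[of _ "- p"]) simp
  qed
  show thesis
  proof (cases "x \<ge> y")
    case True
    from B[OF assms True] that show thesis by blast
  next
    case False
    have "nrm y x > 0" "y \<ge> x" using assms False nrm_swap[of x y] by auto
    from B[OF this] obtain p q where g: "isgen p q" "nrm (y - p) (x - q) \<le> nrm y x - 1" by blast
    have "nrm (x - q) (y - p) \<le> nrm x y - 1" using g(2) nrm_swap[of "y - p" "x - q"] nrm_swap[of y x] by simp
    with isgen_swap[OF g(1)] that show thesis by blast
  qed
qed

lemma nrm_zero: "nrm x y = 0 \<Longrightarrow> x = 0 \<and> y = 0"
  using nrm_lower2[of x y] by linarith

lemma slev_zero:
  assumes "slev \<omega> = 0"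
  shows "\<omega> = ([], 0, 0)"
proof -
  obtain st x y where w: "\<omega> = (st, x, y)" by (cases \<omega>)
  show ?thesis
  proof (cases st)
    case Nil
    then show ?thesis using assms w nrm_zero[of x y] nrm_nonneg[of x y] by (simp add: lev_def)
  next
    case (Cons fr st')
    obtain s p q where fr: "fr = (s, p, q)" by (cases fr)
    have F: "inf_conv (\<lambda>n. 1 + lev st' (p + n * dx s) (q + n * dy s)) (dx (opp s)) (dy (opp s)) (lev st)"
      using lam_inf_conv[of st' p s q] unfolding lev_def[abs_def] Cons fr .
    obtain n where "lev st x y = 1 + lev st' (p + n * dx s) (q + n * dy s) + nrm (x - n * dx (opp s)) (y - n * dy (opp s))"
      by (rule inf_conv_attained[OF F])
    then show ?thesis
      using assms w lev_nonneg[of st' "p + n * dx s" "q + n * dy s"] nrm_nonneg[of "x - n * dx (opp s)" "y - n * dy (opp s)"] by simp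
  qed
qed

text \<open>The descent goes towards the optimal entry point as long as the norm part is positive,
  and then through the strip into the parent.\<close>

lemma descent:
  assumes v: "valid (fst \<omega>)" and pos: "slev \<omega> > 0"
  obtains \<omega>' where "step \<omega> \<omega>'" "slev \<omega>' = slev \<omega> - 1"
proof -
  obtain st x y where w: "\<omega> = (st, x, y)" by (cases \<omega>)
  note fin = that
  have vst: "valid st" using v w by simp
  have down: thesis if g: "isgen p q" and le: "lev st (x - p) (y - q) \<le> lev st x y - 1" for p q
  proof (rule fin)
    show s: "step \<omega> (st, x - p, y - q)"
      using vst isgen_minus[OF g] unfolding step_def gadj_def w by simp
    show "slev (st, x - p, y - q) = slev \<omega> - 1" using step_lev[OF s] le w by simp
  qed
  have near: thesis if F: "inf_conv f ex ey (lev st)" and n: "lev st x y = f n + nrm (x - n * ex) (y - n * ey)"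
    "nrm (x - n * ex) (y - n * ey) > 0" for f ex ey n
  proof -
    obtain p q where g: "isgen p q" "nrm (x - n * ex - p) (y - n * ey - q) \<le> nrm (x - n * ex) (y - n * ey) - 1"
      by (rule nrm_descent[OF n(2)])
    have "lev st (x - p) (y - q) \<le> f n + nrm (x - n * ex - p) (y - n * ey - q)"
      by (rule inf_conv_le'[OF F]) auto
    then show thesis using down[OF g(1)] g(2) n(1) by linarith
  qed
  show thesis
  proof (cases st)
    case Nil
    have l: "lev st a b = nrm a b" for a b using nrm_nonneg[of a b] unfolding Nil lev_def by simp
    obtain p q where "isgen p q" "nrm (x - p) (y - q) \<le> nrm x y - 1"
      by (rule nrm_descent[of x y]) (use pos w l in simp)
    then show thesis using down l by simp
  next
    case (Cons fr st')
    obtain s p q where fr: "fr = (s, p, q)" by (cases fr)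
    have F: "inf_conv (\<lambda>n. 1 + lev st' (p + n * dx s) (q + n * dy s)) (dx (opp s)) (dy (opp s)) (lev st)"
      using lam_inf_conv[of st' p s q] unfolding lev_def[abs_def] Cons fr .
    obtain n where n: "lev st x y = 1 + lev st' (p + n * dx s) (q + n * dy s) + nrm (x - n * dx (opp s)) (y - n * dy (opp s))"
      by (rule inf_conv_attained[OF F])
    show thesis
    proof (cases "nrm (x - n * dx (opp s)) (y - n * dy (opp s)) > 0")
      case True
      show thesis by (rule near[OF F n True])
    next
      case False
      then have z: "nrm (x - n * dx (opp s)) (y - n * dy (opp s)) = 0" using nrm_nonneg by (simp add: order_antisym)
      then have xy: "x = n * dx (opp s)" "y = n * dy (opp s)" using nrm_zero[OF z] by simp_all
      have v': "valid ((s, p, q) # st')" using vst Cons fr by simp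
      have b: "bedge (lev st x y) ((s, p, q) # st', n * dx (opp s), n * dy (opp s)) (st', p + n * dx s, q + n * dy s)"
        by (rule bedge_pop[OF v']) (simp add: Cons fr xy)
      show thesis
      proof (rule fin)
        show "step \<omega> (st', p + n * dx s, q + n * dy s)" using b unfolding bedge_def w Cons fr xy by simp
        show "slev (st', p + n * dx s, q + n * dy s) = slev \<omega> - 1" using n z w by simp
      qed
    qed
  qed
qed

section \<open>The group and its normal forms\<close>

lemma (in group) int_pow_slide:
  assumes c: "x \<in> carrier G" "y \<in> carrier G" "s \<in> carrier G" and xy: "x \<otimes> s = s \<otimes> y"
  shows "x [^] (n::int) \<otimes> s = s \<otimes> y [^] n"
proof (induction n rule: int_induct[where k = 0])
  case base
  show ?case using c by simp
next
  case (step1 i)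
  have "x [^] (i + 1) \<otimes> s = x [^] i \<otimes> (x \<otimes> s)" using c by (simp add: int_pow_mult m_assoc)
  also have "\<dots> = x [^] i \<otimes> s \<otimes> y" using c by (simp add: xy m_assoc)
  also have "\<dots> = s \<otimes> y [^] (i + 1)" using c step1(2) by (simp add: int_pow_mult m_assoc)
  finally show ?case .
next
  case (step2 i)
  have inv: "inv x \<otimes> s = s \<otimes> inv y"
  proof -
    have "inv x \<otimes> s = inv x \<otimes> (s \<otimes> y) \<otimes> inv y" using c by (simp add: m_assoc)
    also have "\<dots> = inv x \<otimes> (x \<otimes> s) \<otimes> inv y" by (simp add: xy)
    also have "\<dots> = s \<otimes> inv y" using c by (simp add: m_assoc[symmetric])
    finally show ?thesis .
  qed
  have "x [^] (i - 1) = x [^] i \<otimes> inv x" "y [^] (i - 1) = y [^] i \<otimes> inv y"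
    using int_pow_mult[of x i "- 1"] int_pow_mult[of y i "- 1"] c by (simp_all add: int_pow_neg)
  then have "x [^] (i - 1) \<otimes> s = x [^] i \<otimes> (s \<otimes> inv y)" using c by (simp add: m_assoc inv)
  also have "\<dots> = s \<otimes> y [^] i \<otimes> inv y" using c step2(2) by (simp add: m_assoc[symmetric])
  also have "\<dots> = s \<otimes> y [^] (i - 1)" using c \<open>y [^] (i - 1) = y [^] i \<otimes> inv y\<close> by (simp add: m_assoc)
  finally show ?case .
qed

lemma (in group) int_hom_pow:
  assumes h: "\<And>m n :: int. h (m + n) = h m \<otimes> h n" "\<And>n. h n \<in> carrier G"
  shows "h n = h 1 [^] n"
proof (induction n rule: int_induct[where k = 0])
  case base
  have "h 0 = h 0 \<otimes> h 0" using h(1)[of 0 0] by simp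
  then have "h 0 = \<one>" using h(2)[of 0] by (metis l_cancel_one)
  then show ?case by simp
next
  case (step1 i)
  then show ?case using h(1)[of i 1] h(2) by (simp add: int_pow_mult)
next
  case (step2 i)
  have "h (i - 1) \<otimes> h 1 = h 1 [^] (i - 1) \<otimes> h 1"
    using h(1)[of "i - 1" 1] h(2) step2(2) int_pow_mult[of "h 1" "i - 1" 1] by simp
  then show ?case using h(2) by simp
qed

text \<open>The defining relations with c and d eliminated and the conjugations written without
  inverses.\<close>

locale wise_group = group G for G (structure) +
  fixes a b s t
  assumes a [simp]: "a \<in> carrier G" and b [simp]: "b \<in> carrier G" and s [simp]: "s \<in> carrier G" and t [simp]: "t \<in> carrier G"
    and ab: "a \<otimes> b = b \<otimes> a"
    and as: "a \<otimes> s = s \<otimes> (a \<otimes> b \<otimes> (a \<otimes> b))"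
    and bt: "b \<otimes> t = t \<otimes> (a \<otimes> b \<otimes> (a \<otimes> b))"
begin

definition vec :: "int \<Rightarrow> int \<Rightarrow> 'a" where
  "vec p q = a [^] p \<otimes> b [^] q"

lemma vec_closed [simp]: "vec p q \<in> carrier G"
  by (simp add: vec_def)

lemma vec_add: "vec (p + p') (q + q') = vec p q \<otimes> vec p' q'"
proof -
  have "a [^] p' \<otimes> b = b \<otimes> a [^] p'" by (rule int_pow_slide) (simp_all add: ab)
  then have "b [^] q \<otimes> a [^] p' = a [^] p' \<otimes> b [^] q" by (intro int_pow_slide) simp_all
  then have "a [^] p \<otimes> (b [^] q \<otimes> a [^] p') \<otimes> b [^] q' = a [^] p \<otimes> (a [^] p' \<otimes> b [^] q) \<otimes> b [^] q'" by simp
  then show ?thesis by (simp add: vec_def int_pow_mult m_assoc)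
qed

lemma vec_gens: "vec 1 0 = a" "vec 0 1 = b" "vec 1 1 = a \<otimes> b" "vec 2 2 = a \<otimes> b \<otimes> (a \<otimes> b)" "vec 0 0 = \<one>"
  using vec_add[of 1 1 1 1] by (simp_all add: vec_def)

lemma vec_pow: "vec (n * p) (n * q) = vec p q [^] n"
proof -
  have "vec ((m + n) * p) ((m + n) * q) = vec (m * p) (m * q) \<otimes> vec (n * p) (n * q)" for m n
    by (simp add: vec_add[symmetric] distrib_right)
  from int_hom_pow[of "\<lambda>n. vec (n * p) (n * q)", OF this, of n] show ?thesis by simp
qed

fun sl :: "strip \<Rightarrow> 'a" where
  "sl Sa = s" | "sl Sb = t" | "sl Da = inv s" | "sl Db = inv t"

lemma sl_closed [simp]: "sl r \<in> carrier G"
  by (cases r) auto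

lemma vec_slide:
  assumes "r = Sa \<or> r = Sb"
  shows "vec (n * dx r) (n * dy r) \<otimes> sl r = sl r \<otimes> vec (n * dx (opp r)) (n * dy (opp r))"
  unfolding vec_pow
  by (rule int_pow_slide) (use assms as bt in \<open>auto simp: vec_gens\<close>)

primrec nfs :: "frame list \<Rightarrow> 'a" where
  "nfs [] = \<one>"
| "nfs (fr # st) = nfs st \<otimes> vec (fst (snd fr)) (snd (snd fr)) \<otimes> sl (fst fr)"

lemma nfs_closed [simp]: "nfs st \<in> carrier G"
  by (induction st) auto

definition nfe :: "state \<Rightarrow> 'a" where
  "nfe \<omega> = nfs (fst \<omega>) \<otimes> vec (fst (snd \<omega>)) (snd (snd \<omega>))"

lemma nfe_closed [simp]: "nfe \<omega> \<in> carrier G"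
  by (simp add: nfe_def)

lemma nfe_shift: "nfe (shift p q \<omega>) = nfe \<omega> \<otimes> vec p q"
  by (simp add: nfe_def shift_def vec_add m_assoc)

text \<open>Positive stable letters suffice; the inverse ones follow in \<open>nfe_gact\<close>,
  because the crossings undo each other.\<close>

lemma nfe_cross:
  assumes r: "r = Sa \<or> r = Sb" and v: "valid (fst \<omega>)"
  shows "nfe (cross r \<omega>) = nfe \<omega> \<otimes> sl r"
proof -
  obtain st x y where w: "\<omega> = (st, x, y)" by (cases \<omega>)
  have vst: "valid st" using v w by simp
  have inv: "sl (opp r) \<otimes> sl r = \<one>" using r by auto
  from vst show ?thesis
  proof (cases rule: cross_cases[of st x r y])
    case (push p q n)
    have "nfe (cross r \<omega>) = nfs st \<otimes> vec p q \<otimes> (sl r \<otimes> vec (n * dx (opp r)) (n * dy (opp r)))"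
      unfolding w push(4) by (simp add: nfe_def m_assoc)
    also have "\<dots> = nfs st \<otimes> (vec p q \<otimes> vec (n * dx r) (n * dy r)) \<otimes> sl r"
      unfolding vec_slide[OF r, symmetric] by (simp add: m_assoc)
    also have "\<dots> = nfe \<omega> \<otimes> sl r"
      unfolding vec_add[symmetric] w nfe_def push(1,2) by simp
    finally show ?thesis .
  next
    case (pop p q st' n)
    have "nfe \<omega> \<otimes> sl r = nfs st' \<otimes> vec p q \<otimes> sl (opp r) \<otimes> (vec (n * dx r) (n * dy r) \<otimes> sl r)"
      unfolding w nfe_def pop(1,2,3) by (simp add: m_assoc)
    also have "\<dots> = nfs st' \<otimes> vec p q \<otimes> (sl (opp r) \<otimes> sl r) \<otimes> vec (n * dx (opp r)) (n * dy (opp r))"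
      unfolding vec_slide[OF r] by (simp add: m_assoc)
    also have "\<dots> = nfs st' \<otimes> (vec p q \<otimes> vec (n * dx (opp r)) (n * dy (opp r)))"
      unfolding inv by (simp add: m_assoc)
    also have "\<dots> = nfe (cross r \<omega>)"
      unfolding vec_add[symmetric] w pop(5) nfe_def by simp
    finally show ?thesis by simp
  qed
qed

end

section \<open>Words acting on normal forms\<close>

fun gact :: "wgen \<Rightarrow> bool \<Rightarrow> state \<Rightarrow> state" where
  "gact ga e = shift (if e then 1 else - 1) 0"
| "gact gb e = shift 0 (if e then 1 else - 1)"
| "gact gc e = shift (if e then 1 else - 1) (if e then 1 else - 1)"
| "gact gd e = shift (if e then 2 else - 2) (if e then 2 else - 2)"
| "gact gs e = cross (if e then Sa else Da)"
| "gact gt e = cross (if e then Sb else Db)"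

text \<open>The leftmost letter acts first, so appending a letter, i.e. right multiplication, is a
  move of the final state along one edge.\<close>

definition act :: "wgen word \<Rightarrow> state \<Rightarrow> state" where
  "act w = fold (\<lambda>(x, e). gact x e) w"

lemma act_simps [simp]: "act [] \<omega> = \<omega>" "act ((x, e) # w) \<omega> = act w (gact x e \<omega>)"
  by (simp_all add: act_def)

lemma act_append: "act (u @ v) \<omega> = act v (act u \<omega>)"
  by (simp add: act_def)

lemma valid_gact: "valid (fst \<omega>) \<Longrightarrow> valid (fst (gact x e \<omega>))"
  by (cases \<omega>; cases x) (simp_all add: shift_def valid_cross)

lemma valid_act: "valid (fst \<omega>) \<Longrightarrow> valid (fst (act w \<omega>))"
proof (induction w arbitrary: \<omega>)
  case (Cons l w)
  obtain x e where "l = (x, e)" by (cases l)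
  with Cons show ?case by (simp add: valid_gact)
qed simp

lemma shift_shift: "shift p q (shift p' q' \<omega>) = shift (p + p') (q + q') \<omega>"
  by (simp add: shift_def)

lemma shift_0 [simp]: "shift 0 0 \<omega> = \<omega>"
  by (simp add: shift_def)

lemma cross_opp': "valid (fst \<omega>) \<Longrightarrow> cross (opp r) (cross r \<omega>) = \<omega>"
  using cross_opp[of "fst \<omega>" r "fst (snd \<omega>)" "snd (snd \<omega>)"] by simp

lemma gact_inverse: "valid (fst \<omega>) \<Longrightarrow> gact x (\<not> e) (gact x e \<omega>) = \<omega>"
  using cross_opp'[of \<omega> Sa] cross_opp'[of \<omega> Sb] cross_opp'[of \<omega> Da] cross_opp'[of \<omega> Db]
  by (cases x; cases e) (simp_all add: shift_shift)

lemma gact_conj: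
  assumes v: "valid (fst \<omega>)"
  shows "cross r (shift (dx r) (dy r) (cross (opp r) \<omega>)) = shift (dx (opp r)) (dy (opp r)) \<omega>"
proof -
  obtain st x y where c: "cross (opp r) \<omega> = (st, x, y)" by (cases "cross (opp r) \<omega>")
  have "valid st" using valid_cross[of "fst \<omega>" "opp r" "fst (snd \<omega>)" "snd (snd \<omega>)"] v c by simp
  then have "cross r (shift (dx r) (dy r) (st, x, y)) = shift (dx (opp r)) (dy (opp r)) (cross r (st, x, y))"
    by (rule cross_shift)
  then show ?thesis using cross_opp'[OF v, of "opp r"] unfolding c by simp
qed

text \<open>All relations hold for the action on valid states, so equal elements yield equal states.
  This is the uniqueness half of the normal form theorem.\<close>

lemma act_pres_eq: "pres_eq wise_relations u v \<Longrightarrow> valid (fst \<omega>) \<Longrightarrow> act u \<omega> = act v \<omega>"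
proof (induction arbitrary: \<omega> rule: pres_eq.induct)
  case (append u u' v v')
  then show ?case using valid_act[of \<omega> u'] by (simp add: act_append)
next
  case (cancel x e)
  then show ?case using gact_inverse by simp
next
  case (relation l r)
  then show ?case
    using gact_conj[OF relation(2), of Sa] gact_conj[OF relation(2), of Sb]
    unfolding wise_relations_def by (auto simp: shift_shift)
qed simp_all

section \<open>The normal form theorem for the presented group\<close>

abbreviation cls :: "wgen word \<Rightarrow> wgen word set" where "cls \<equiv> pres_class wise_relations"

lemma G_W_carrier: "carrier G_W = range cls" and G_W_one: "\<one>\<^bsub>G_W\<^esub> = cls []"
  by (simp_all add: G_W_def presented_group_def)

lemma G_W_mult: "cls u \<otimes>\<^bsub>G_W\<^esub> cls v = cls (u @ v)"
  unfolding G_W_def by (rule pres_class_mult)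

lemma cls_closed [simp]: "cls u \<in> carrier G_W"
  by (simp add: G_W_carrier)

lemma cls_relation: "(l, r) \<in> wise_relations \<Longrightarrow> cls l = cls r"
  unfolding pres_class_eq_iff by (rule pres_eq.relation)

lemma cls_cancel: "cls (u @ (x, e) # (x, \<not> e) # v) = cls (u @ v)"
proof -
  have "cls (u @ ([(x, e), (x, \<not> e)] @ v)) = cls (u @ ([] @ v))"
    unfolding pres_class_eq_iff by (intro pres_eq.append pres_eq.refl pres_eq.cancel)
  then show ?thesis by simp
qed

interpretation G_W: group G_W
  unfolding G_W_def by (rule group_presented_group)

lemma cls_neg: "cls [neg x] = inv\<^bsub>G_W\<^esub> (cls [pos x])"
proof -
  have "cls [neg x] \<otimes>\<^bsub>G_W\<^esub> cls [pos x] = \<one>\<^bsub>G_W\<^esub>"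
    using cls_cancel[of "[]" x False "[]"] by (simp add: G_W_mult G_W_one)
  then show ?thesis using G_W.inv_equality by simp
qed

lemma cls_ab: "cls [pos gc] = cls [pos ga] \<otimes>\<^bsub>G_W\<^esub> cls [pos gb]" "cls [pos gc] = cls [pos gb] \<otimes>\<^bsub>G_W\<^esub> cls [pos ga]"
  "cls [pos gd] = cls [pos gc] \<otimes>\<^bsub>G_W\<^esub> cls [pos gc]"
  unfolding G_W_mult by (rule cls_relation; simp add: wise_relations_def)+

lemma cls_strip:
  "cls [pos ga] \<otimes>\<^bsub>G_W\<^esub> cls [pos gs] = cls [pos gs] \<otimes>\<^bsub>G_W\<^esub> cls [pos gd]"
  "cls [pos gb] \<otimes>\<^bsub>G_W\<^esub> cls [pos gt] = cls [pos gt] \<otimes>\<^bsub>G_W\<^esub> cls [pos gd]"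
proof -
  have d: "cls [pos gd] = cls [neg gs, pos ga, pos gs]" "cls [pos gd] = cls [neg gt, pos gb, pos gt]"
    by (rule cls_relation[symmetric], simp add: wise_relations_def)+
  have "cls [pos gs] \<otimes>\<^bsub>G_W\<^esub> cls [pos gd] = cls ([] @ (gs, True) # (gs, \<not> True) # [pos ga, pos gs])"
    unfolding d(1) G_W_mult by simp
  moreover have "cls [pos gt] \<otimes>\<^bsub>G_W\<^esub> cls [pos gd] = cls ([] @ (gt, True) # (gt, \<not> True) # [pos gb, pos gt])"
    unfolding d(2) G_W_mult by simp
  ultimately show "cls [pos ga] \<otimes>\<^bsub>G_W\<^esub> cls [pos gs] = cls [pos gs] \<otimes>\<^bsub>G_W\<^esub> cls [pos gd]"
    "cls [pos gb] \<otimes>\<^bsub>G_W\<^esub> cls [pos gt] = cls [pos gt] \<otimes>\<^bsub>G_W\<^esub> cls [pos gd]"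
    unfolding cls_cancel by (simp_all add: G_W_mult)
qed

interpretation W: wise_group G_W "cls [pos ga]" "cls [pos gb]" "cls [pos gs]" "cls [pos gt]"
proof
  show "cls [pos ga] \<otimes>\<^bsub>G_W\<^esub> cls [pos gb] = cls [pos gb] \<otimes>\<^bsub>G_W\<^esub> cls [pos ga]" using cls_ab(1,2) by simp
  show "cls [pos ga] \<otimes>\<^bsub>G_W\<^esub> cls [pos gs] = cls [pos gs] \<otimes>\<^bsub>G_W\<^esub> (cls [pos ga] \<otimes>\<^bsub>G_W\<^esub> cls [pos gb] \<otimes>\<^bsub>G_W\<^esub> (cls [pos ga] \<otimes>\<^bsub>G_W\<^esub> cls [pos gb]))"
    using cls_strip(1) unfolding cls_ab(3) cls_ab(1) .
  show "cls [pos gb] \<otimes>\<^bsub>G_W\<^esub> cls [pos gt] = cls [pos gt] \<otimes>\<^bsub>G_W\<^esub> (cls [pos ga] \<otimes>\<^bsub>G_W\<^esub> cls [pos gb] \<otimes>\<^bsub>G_W\<^esub> (cls [pos ga] \<otimes>\<^bsub>G_W\<^esub> cls [pos gb]))"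
    using cls_strip(2) unfolding cls_ab(3) cls_ab(1) .
qed simp_all

lemma nfe_gact:
  assumes v: "valid (fst \<omega>)"
  shows "W.nfe (gact x e \<omega>) = W.nfe \<omega> \<otimes>\<^bsub>G_W\<^esub> cls [(x, e)]"
proof -
  have pos: "W.nfe (gact x True \<omega>) = W.nfe \<omega> \<otimes>\<^bsub>G_W\<^esub> cls [pos x]" if "valid (fst \<omega>)" for \<omega>
  proof (cases x)
    case gs
    show ?thesis using W.nfe_cross[of Sa \<omega>] that by (simp add: gs)
  next
    case gt
    show ?thesis using W.nfe_cross[of Sb \<omega>] that by (simp add: gt)
  next
    case gd
    have "cls [pos gd] = W.vec 2 2" unfolding W.vec_gens cls_ab(3) cls_ab(1) ..
    then show ?thesis by (simp add: gd W.nfe_shift)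
  qed (simp_all add: W.nfe_shift W.vec_gens cls_ab(1))
  show ?thesis
  proof (cases e)
    case True
    then show ?thesis using pos[OF v] by simp
  next
    case False
    have "W.nfe \<omega> = W.nfe (gact x False \<omega>) \<otimes>\<^bsub>G_W\<^esub> cls [pos x]"
      using pos[OF valid_gact[OF v, of x False]] gact_inverse[OF v, of x False] by simp
    then have "W.nfe \<omega> \<otimes>\<^bsub>G_W\<^esub> inv\<^bsub>G_W\<^esub> (cls [pos x]) = W.nfe (gact x False \<omega>)"
      using G_W.inv_solve_right'[of "W.nfe (gact x False \<omega>)" "W.nfe \<omega>" "inv\<^bsub>G_W\<^esub> (cls [pos x])"]
      by (simp add: G_W.m_assoc)
    then show ?thesis using False by (simp add: cls_neg)
  qed
qed

lemma cls_nfe: "cls w = W.nfe (act w ([], 0, 0))"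
proof (induction w rule: rev_induct)
  case Nil
  show ?case by (simp add: W.nfe_def W.vec_gens G_W_one)
next
  case (snoc l w)
  obtain x e where l: "l = (x, e)" by (cases l)
  have "valid (fst (act w ([], 0, 0)))" by (rule valid_act) simp
  then show ?case using snoc nfe_gact[of "act w ([], 0, 0)" x e] by (simp add: l act_append G_W_mult[symmetric])
qed

text \<open>The action separates different elements' states from words of one class, and
  \<open>cls_nfe\<close> recovers the element from its state. Equations between given words are
  thereby settled by computing states.\<close>

lemma cls_eq_iff: "cls u = cls v \<longleftrightarrow> act u ([], 0, 0) = act v ([], 0, 0)"
  using act_pres_eq[of u v "([], 0, 0)"] cls_nfe[of u] cls_nfe[of v] unfolding pres_class_eq_iff[symmetric] by auto

section \<open>Distances, almost convexity and the endomorphism\<close>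

abbreviation gens :: "wgen word set set" where
  "gens \<equiv> wise_elt ` {ga, gb, gc, gd, gs, gt}"

lemma gens_eq: "gens = range wise_elt"
proof -
  have "(UNIV :: wgen set) = {ga, gb, gc, gd, gs, gt}" using wgen.exhaust by blast
  then show ?thesis by simp
qed

section \<open>Levels are distances in the Cayley graph\<close>

definition base_state :: state where "base_state = ([], 0, 0)"

lemma valid_root: "valid (fst (act w base_state))"
  by (rule valid_act) (simp add: base_state_def)

lemma slev_root: "slev base_state = 0"
  by (simp add: base_state_def lev_root)

lemma step_gact: "valid (fst \<omega>) \<Longrightarrow> step \<omega> (gact x e \<omega>)"
  unfolding step_def gadj_def by (cases x; cases e) (auto simp: shift_def)

lemma step_imp_gact:
  assumes "step \<omega> \<omega>'"
  obtains x e where "\<omega>' = gact x e \<omega>"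
proof -
  obtain st x y where w: "\<omega> = (st, x, y)" by (cases \<omega>)
  from assms[unfolded w] show thesis
  proof (cases rule: step_cases)
    case (1 p q)
    have sh: "\<omega>' = shift p q \<omega>" using 1(2) w by (simp add: shift_def)
    from 1(1) consider "p = 1" "q = 0" | "p = -1" "q = 0" | "p = 0" "q = 1" | "p = 0" "q = -1" | "p = 1" "q = 1"
      | "p = -1" "q = -1" | "p = 2" "q = 2" | "p = -2" "q = -2"
      unfolding isgen_def by auto
    then show thesis
    proof cases
      case 1 then show thesis using that[of ga True] sh by simp
    next
      case 2 then show thesis using that[of ga False] sh by simp
    next
      case 3 then show thesis using that[of gb True] sh by simp
    next
      case 4 then show thesis using that[of gb False] sh by simp
    next
      case 5 then show thesis using that[of gc True] sh by simp
    next
      case 6 then show thesis using that[of gc False] sh by simp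
    next
      case 7 then show thesis using that[of gd True] sh by simp
    next
      case 8 then show thesis using that[of gd False] sh by simp
    qed
  next
    case (2 r)
    then show thesis using that[of gs True] that[of gs False] that[of gt True] that[of gt False] w by (cases r) auto
  qed
qed

lemma cls_letter_adj: "cayley_adj G_W gens (cls w) (cls (w @ [(x, e)]))"
proof -
  have p: "cls (w @ [pos x]) = cls w \<otimes>\<^bsub>G_W\<^esub> wise_elt x" by (simp add: G_W_mult wise_elt_def)
  have n: "cls w = cls (w @ [neg x]) \<otimes>\<^bsub>G_W\<^esub> wise_elt x"
    using cls_cancel[of w x False "[]"] by (simp add: G_W_mult wise_elt_def)
  have "cls (w @ [(x, e)]) = cls w \<otimes>\<^bsub>G_W\<^esub> wise_elt x \<or> cls w = cls (w @ [(x, e)]) \<otimes>\<^bsub>G_W\<^esub> wise_elt x"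
  proof (cases e)
    case True
    then have "e = True" by simp
    then show ?thesis using disjI1[OF p] by (simp only:)
  next
    case False
    then have "e = False" by simp
    then show ?thesis using disjI2[OF n] by (simp only:)
  qed
  then show ?thesis unfolding cayley_adj_def gens_eq using cls_closed by blast
qed

lemma adj_letter:
  assumes "cayley_adj G_W gens (cls w) h"
  obtains x e where "h = cls (w @ [(x, e)])"
proof -
  obtain v where v: "h = cls v" using assms unfolding cayley_adj_def G_W_carrier by blast
  obtain x where "h = cls w \<otimes>\<^bsub>G_W\<^esub> wise_elt x \<or> cls w = h \<otimes>\<^bsub>G_W\<^esub> wise_elt x"
    using assms unfolding cayley_adj_def gens_eq by blast
  then show thesis
  proof
    assume "h = cls w \<otimes>\<^bsub>G_W\<^esub> wise_elt x"
    then show thesis using that[of x True] by (simp add: G_W_mult wise_elt_def)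
  next
    assume "cls w = h \<otimes>\<^bsub>G_W\<^esub> wise_elt x"
    then have "cls w = cls (v @ [pos x])" by (simp add: v G_W_mult wise_elt_def)
    then have "cls (w @ [neg x]) = cls (v @ [pos x, neg x])" by (simp add: G_W_mult[symmetric, of w] G_W_mult)
    then show thesis using that[of x False] cls_cancel[of v x True "[]"] v by simp
  qed
qed

text \<open>An edge changes the level by at most 1; applied to paths from the identity, this bounds
  the distance from below by the level.\<close>

lemma path_level:
  assumes "cayley_path G_W gens (cls w) g p"
  shows "\<exists>v. g = cls v \<and> \<bar>slev (act v base_state) - slev (act w base_state)\<bar> \<le> int (length p) - 1"
  using assms
proof (induction p arbitrary: w)
  case Nil
  then show ?case by (simp add: cayley_path_def)
next
  case (Cons h p)
  have h: "h = cls w" using Cons.prems by (simp add: cayley_path_def)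
  show ?case
  proof (cases "p = []")
    case True
    then show ?thesis using Cons.prems h by (intro exI[of _ w]) (simp add: cayley_path_def)
  next
    case False
    have adj: "cayley_adj G_W gens (cls w) (hd p)" and p: "cayley_path G_W gens (hd p) g p"
      using Cons.prems False h by (auto simp: cayley_path_def successively_Cons)
    obtain x e where x: "hd p = cls (w @ [(x, e)])" by (rule adj_letter[OF adj])
    obtain v where v: "g = cls v" "\<bar>slev (act v base_state) - slev (act (w @ [(x, e)]) base_state)\<bar> \<le> int (length p) - 1"
      using Cons.IH p x by metis
    have "\<bar>slev (act (w @ [(x, e)]) base_state) - slev (act w base_state)\<bar> \<le> 1"
      using step_lev[OF step_gact[OF valid_root, of w x e]] by (simp add: act_append)
    with v show ?thesis by (intro exI[of _ v]) simp
  qed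
qed

lemma slev_nonneg: "slev \<omega> \<ge> 0"
  by (simp add: slev_def lev_nonneg)

lemma cls_act: "cls u = cls v \<longleftrightarrow> act u base_state = act v base_state"
  unfolding base_state_def by (rule cls_eq_iff)

text \<open>The upper bound for the distance: descending edges are followed down to level 0, which
  only the identity has.\<close>

lemma descent_path:
  assumes "slev (act w base_state) = int n"
  shows "\<exists>p. cayley_path G_W gens (cls []) (cls w) p \<and> length p = Suc n"
  using assms
proof (induction n arbitrary: w)
  case 0
  then have "slev (act w base_state) = 0" by simp
  from slev_zero[OF this] have "act w base_state = base_state" by (simp only: base_state_def)
  then have "cls w = cls []" using cls_act[of w "[]"] by simp
  then show ?case by (intro exI[of _ "[cls []]"]) (simp add: cayley_path_def)
next
  case (Suc n)
  have pos: "slev (act w base_state) > 0" using Suc.prems by simp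
  obtain \<omega>' where w': "step (act w base_state) \<omega>'" "slev \<omega>' = slev (act w base_state) - 1"
    by (rule descent[OF valid_root[of w] pos])
  obtain x e where x: "\<omega>' = gact x e (act w base_state)" by (rule step_imp_gact[OF w'(1)])
  have "slev (act (w @ [(x, e)]) base_state) = int n" using w'(2) Suc.prems x by (simp add: act_append)
  then obtain p where p: "cayley_path G_W gens (cls []) (cls (w @ [(x, e)])) p" "length p = Suc n"
    using Suc.IH by blast
  have "cls ((w @ [(x, e)]) @ [(x, \<not> e)]) = cls w" using cls_cancel[of w x e "[]"] by simp
  then have "cayley_adj G_W gens (cls (w @ [(x, e)])) (cls w)"
    using cls_letter_adj[of "w @ [(x, e)]" x "\<not> e"] by simp
  then have "cayley_path G_W gens (cls []) (cls w) (p @ [cls w])"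
    using p(1) by (auto simp: cayley_path_def successively_append_iff)
  then show ?case using p(2) by (intro exI[of _ "p @ [cls w]"]) simp
qed

lemma dist_slev: "int (cayley_dist G_W gens \<one>\<^bsub>G_W\<^esub> (cls w)) = slev (act w base_state)"
proof -
  obtain n where n: "slev (act w base_state) = int n" using slev_nonneg[of "act w base_state"] nonneg_int_cases by blast
  have "cayley_dist G_W gens \<one>\<^bsub>G_W\<^esub> (cls w) = n"
    unfolding cayley_dist_def G_W_one
  proof (rule Least_equality)
    show "\<exists>p. cayley_path G_W gens (cls []) (cls w) p \<and> length p = Suc n" by (rule descent_path[OF n])
    fix k assume "\<exists>p. cayley_path G_W gens (cls []) (cls w) p \<and> length p = Suc k"
    then obtain p where p: "cayley_path G_W gens (cls []) (cls w) p" "length p = Suc k" by blast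
    obtain v where v: "cls w = cls v" "\<bar>slev (act v base_state) - slev (act [] base_state)\<bar> \<le> int (length p) - 1"
      using path_level[OF p(1)] by blast
    then have "act w base_state = act v base_state" unfolding cls_act by simp
    then show "n \<le> k" using v(2) n p(2) slev_root by simp
  qed
  then show ?thesis using n by simp
qed

lemma path_exists: "\<exists>p. cayley_path G_W gens (cls u) (cls (u @ w)) p"
proof (induction w rule: rev_induct)
  case Nil
  show ?case by (intro exI[of _ "[cls u]"]) (simp add: cayley_path_def)
next
  case (snoc l w)
  then obtain p where p: "cayley_path G_W gens (cls u) (cls (u @ w)) p" by blast
  obtain x e where l: "l = (x, e)" by (cases l)
  have "cayley_path G_W gens (cls u) (cls (u @ w @ [l])) (p @ [cls (u @ w @ [l])])"
    using p cls_letter_adj[of "u @ w" x e] by (auto simp: cayley_path_def successively_append_iff l)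
  then show ?case by blast
qed

lemma dist_path:
  "\<exists>p. cayley_path G_W gens (cls u) (cls v) p \<and> length p = Suc (cayley_dist G_W gens (cls u) (cls v))"
proof -
  \<comment> \<open>Inserting \<open>u\<close> and its formal inverse in front of \<open>v\<close>
    presents the class of \<open>v\<close> as that of an extension of \<open>u\<close>. Hence
    \<open>path_exists\<close> applies and the least path length is attained.\<close>
  have "cls (u @ (map (\<lambda>(x, e). (x, \<not> e)) (rev u) @ v)) = cls v" for u
  proof (induction u arbitrary: v rule: rev_induct)
    case (snoc l u)
    obtain x e where l: "l = (x, e)" by (cases l)
    have "cls ((u @ [l]) @ (map (\<lambda>(x, e). (x, \<not> e)) (rev (u @ [l])) @ v)) =
        cls (u @ (x, e) # (x, \<not> e) # (map (\<lambda>(x, e). (x, \<not> e)) (rev u) @ v))" by (simp add: l)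
    also have "\<dots> = cls (u @ (map (\<lambda>(x, e). (x, \<not> e)) (rev u) @ v))" by (rule cls_cancel)
    also have "\<dots> = cls v" by (rule snoc)
    finally show ?case .
  qed simp
  note e = this[of u]
  obtain p where p: "cayley_path G_W gens (cls u) (cls v) p"
    using path_exists[of u "map (\<lambda>(x, e). (x, \<not> e)) (rev u) @ v"] unfolding e by blast
  then obtain n where "length p = Suc n" by (cases p) (auto simp: cayley_path_def)
  with p have "\<exists>n p. cayley_path G_W gens (cls u) (cls v) p \<and> length p = Suc n" by blast
  then show ?thesis unfolding cayley_dist_def by (rule LeastI_ex)
qed

text \<open>Every point of the edge is within 1 of the end that lies strictly below
  \<open>N\<close>.\<close>

lemma edge_in_ballI:
  assumes "cayley_dist G S \<one>\<^bsub>G\<^esub> u \<le> N" "cayley_dist G S \<one>\<^bsub>G\<^esub> v \<le> N"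
    "cayley_dist G S \<one>\<^bsub>G\<^esub> u < N \<or> cayley_dist G S \<one>\<^bsub>G\<^esub> v < N"
  shows "edge_in_ball G S N u v"
  unfolding edge_in_ball_def
proof
  fix r :: real assume r: "r \<in> {0..1}"
  have "real (cayley_dist G S \<one>\<^bsub>G\<^esub> u) + 1 \<le> real N \<or> real (cayley_dist G S \<one>\<^bsub>G\<^esub> v) + 1 \<le> real N"
    using assms(3) by linarith
  then show "min (real (cayley_dist G S \<one>\<^bsub>G\<^esub> u) + r) (real (cayley_dist G S \<one>\<^bsub>G\<^esub> v) + (1 - r)) \<le> real N"
    using r by (auto simp: min_le_iff_disj)
qed

lemma conn_path:
  assumes "conn (bedge (int N)) k \<omega> \<omega>'" "\<omega> = act w base_state" "slev \<omega> \<le> int N"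
  shows "\<exists>p v. \<omega>' = act v base_state \<and> cayley_path G_W gens (cls w) (cls v) p \<and> path_in_ball G_W gens N p \<and> length p \<le> Suc k"
  using assms
proof (induction arbitrary: w rule: conn.induct)
  case (conn_refl k \<omega>)
  have "cayley_dist G_W gens \<one>\<^bsub>G_W\<^esub> (cls w) \<le> N" using dist_slev[of w] conn_refl by simp
  then show ?case
    using conn_refl by (intro exI[of _ "[cls w]"] exI[of _ w]) (simp add: cayley_path_def path_in_ball_def)
next
  case (conn_step \<omega> \<omega>'' k \<omega>')
  have b: "step \<omega> \<omega>''" "slev \<omega>'' \<le> int N" "slev \<omega> < int N \<or> slev \<omega>'' < int N"
    using conn_step.hyps(1) by (auto simp: bedge_def)
  obtain x e where x: "\<omega>'' = gact x e \<omega>" by (rule step_imp_gact[OF b(1)])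
  let ?w = "w @ [(x, e)]"
  have w: "\<omega>'' = act ?w base_state" using x conn_step.prems by (simp add: act_append)
  obtain p v where p: "\<omega>' = act v base_state" "cayley_path G_W gens (cls ?w) (cls v) p" "path_in_ball G_W gens N p" "length p \<le> Suc k"
    using conn_step.IH[OF w b(2)] by blast
  have d: "cayley_dist G_W gens \<one>\<^bsub>G_W\<^esub> (cls w) \<le> N" "cayley_dist G_W gens \<one>\<^bsub>G_W\<^esub> (cls ?w) \<le> N"
    "cayley_dist G_W gens \<one>\<^bsub>G_W\<^esub> (cls w) < N \<or> cayley_dist G_W gens \<one>\<^bsub>G_W\<^esub> (cls ?w) < N"
    using dist_slev[of w] dist_slev[of ?w] conn_step.prems b w by auto
  have "cayley_path G_W gens (cls w) (cls v) (cls w # p)"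
    using p(2) cls_letter_adj[of w x e] by (auto simp: cayley_path_def successively_Cons)
  moreover have "path_in_ball G_W gens N (cls w # p)"
    using p(2,3) d edge_in_ballI[OF d] by (auto simp: path_in_ball_def cayley_path_def successively_Cons)
  ultimately show ?case using p(1,4) by (intro exI[of _ "cls w # p"] exI[of _ v]) simp
qed

lemma generate_gens: "generate G_W gens = carrier G_W"
proof
  have sub: "gens \<subseteq> carrier G_W" by (auto simp: wise_elt_def)
  show "generate G_W gens \<subseteq> carrier G_W" by (rule G_W.generate_incl[OF sub])
  have "cls w \<in> generate G_W gens" for w
  proof (induction w rule: rev_induct)
    case Nil
    show ?case using generate.one[of G_W gens] by (simp add: G_W_one)
  next
    case (snoc l w)
    obtain x e where l: "l = (x, e)" by (cases l)
    have x: "cls [pos x] \<in> gens" unfolding gens_eq wise_elt_def by blast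
    have "cls [l] \<in> generate G_W gens"
      using generate.incl[OF x] generate.inv[OF x, of G_W] l cls_neg[of x] by (cases e) auto
    from generate.eng[OF snoc this] show ?case by (simp add: G_W_mult)
  qed
  then show "carrier G_W \<subseteq> generate G_W gens" by (auto simp: G_W_carrier)
qed

section \<open>Almost convexity\<close>

lemma almost_convex_G_W: "almost_convex G_W gens"
  unfolding almost_convex_def
\<comment> \<open>68 is the bound for peaks; it dominates a single horizontal edge (8) and two in
  succession (16).\<close>
proof (intro conjI exI[of _ "68::real"] allI ballI impI)
  show "group G_W" by (rule G_W.is_group)
  show "finite gens" by simp
  show "gens \<subseteq> carrier G_W" by (auto simp: wise_elt_def)
  show "generate G_W gens = carrier G_W" by (rule generate_gens)
  show "(68::real) > 0" by simp
  fix N g g'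
  assume g: "g \<in> cayley_sphere G_W gens N" and g': "g' \<in> cayley_sphere G_W gens N"
    and d: "cayley_dist G_W gens g g' \<le> 2"
  obtain u where u: "g = cls u" using g unfolding cayley_sphere_def G_W_carrier by blast
  obtain v where v: "g' = cls v" using g' unfolding cayley_sphere_def G_W_carrier by blast
  have N: "slev (act u base_state) = int N" "slev (act v base_state) = int N"
    using g g' dist_slev[of u] dist_slev[of v] by (auto simp: cayley_sphere_def u v)
  obtain p where p: "cayley_path G_W gens (cls u) (cls v) p" "length p = Suc (cayley_dist G_W gens (cls u) (cls v))"
    using dist_path by blast
  have "length p = 1 \<or> length p = 2 \<or> length p = 3" using p(2) d u v by auto
  then have "conn (bedge (int N)) 68 (act u base_state) (act v base_state)"
  proof (elim disjE)
    assume "length p = 1"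
    then obtain h where h: "p = [h]" by (auto simp: length_Suc_conv)
    have "hd p = cls u" "last p = cls v" using p(1) unfolding cayley_path_def by blast+
    then have 1: "h = cls u" and 2: "h = cls v" unfolding h by simp_all
    have "cls u = cls v" by (rule HOL.trans[OF HOL.sym[OF 1] 2])
    then show ?thesis unfolding cls_act by (simp add: conn_refl)
  next
    assume "length p = 2"
    then obtain h1 h2 where h: "p = [h1, h2]" by (auto simp: length_Suc_conv numeral_2_eq_2)
    have ends: "hd p = cls u" "last p = cls v" and succ: "successively (cayley_adj G_W gens) p"
      using p(1) unfolding cayley_path_def by blast+
    have 1: "h1 = cls u" using ends(1) unfolding h by simp
    have 2: "h2 = cls v" using ends(2) unfolding h by simp
    have adj: "cayley_adj G_W gens (cls u) (cls v)" using succ unfolding h 1 2 by simp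
    obtain x e where "cls v = cls (u @ [(x, e)])" by (rule adj_letter[OF adj])
    then have "act v base_state = gact x e (act u base_state)" unfolding cls_act by (simp add: act_append)
    then have "step (act u base_state) (act v base_state)" using step_gact[OF valid_root] by simp
    from step_level[OF this N] show ?thesis by (rule conn_mono) simp
  next
    assume "length p = 3"
    then obtain h1 h2 h3 where h: "p = [h1, h2, h3]" by (auto simp: length_Suc_conv numeral_3_eq_3)
    have ends: "hd p = cls u" "last p = cls v" and succ: "successively (cayley_adj G_W gens) p"
      using p(1) unfolding cayley_path_def by blast+
    have 1: "h1 = cls u" using ends(1) unfolding h by simp
    have 2: "h3 = cls v" using ends(2) unfolding h by simp
    have adj: "cayley_adj G_W gens (cls u) h2" "cayley_adj G_W gens h2 (cls v)" using succ unfolding h 1 2 by simp_all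
    obtain x e where h2: "h2 = cls (u @ [(x, e)])" by (rule adj_letter[OF adj(1)])
    obtain x' e' where "cls v = cls ((u @ [(x, e)]) @ [(x', e')])" by (rule adj_letter[OF adj(2)[unfolded h2]])
    then have "act v base_state = gact x' e' (act (u @ [(x, e)]) base_state)" unfolding cls_act by (simp add: act_append)
    then have 2: "step (act (u @ [(x, e)]) base_state) (act v base_state)" using step_gact[OF valid_root] by simp
    have 1: "step (act u base_state) (act (u @ [(x, e)]) base_state)"
      using step_gact[OF valid_root, of u x e] by (simp add: act_append)
    show ?thesis by (rule two_steps[OF 1 2 N])
  qed
  from conn_path[OF this HOL.refl] N obtain q w where q: "act v base_state = act w base_state" "cayley_path G_W gens (cls u) (cls w) q"
    "path_in_ball G_W gens N q" "length q \<le> Suc 68" by auto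
  have "cls w = cls v" using q(1) unfolding cls_act by simp
  then show "\<exists>p. cayley_path G_W gens g g' p \<and> path_in_ball G_W gens N p \<and> real (length p - 1) \<le> 68"
    using q u v by (intro exI[of _ q]) auto
qed

section \<open>A surjective endomorphism that is not injective\<close>

text \<open>The relations c = ab = ba and d = cc force c and d to be doubled as soon as a and b
  are.\<close>

fun double :: "wgen \<times> bool \<Rightarrow> wgen word" where
  "double (gs, e) = [(gs, e)]"
| "double (gt, e) = [(gt, e)]"
| "double (x, e) = [(x, e), (x, e)]"

definition subst :: "wgen word \<Rightarrow> wgen word" where
  "subst w = concat (map double w)"

lemma subst_simps [simp]: "subst [] = []" "subst (l # w) = double l @ subst w" "subst (u @ v) = subst u @ subst v"
  by (simp_all add: subst_def)

lemmas run = base_state_def shift_def cross_def enter.simps ret_def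

text \<open>Cancellations and relations are checked by running both sides from
  \<open>base_state\<close>, which decides equality by \<open>cls_act\<close>.\<close>

lemma subst_cong: "pres_eq wise_relations u v \<Longrightarrow> cls (subst u) = cls (subst v)"
proof (induction rule: pres_eq.induct)
  case (append u u' v v')
  then show ?case by (simp add: G_W_mult[symmetric])
next
  case (cancel x e)
  show ?case unfolding cls_act by (cases x; cases e) (simp_all add: run)
next
  case (relation l r)
  have "\<forall>(l, r)\<in>wise_relations. act (subst l) base_state = act (subst r) base_state"
    unfolding wise_relations_def by (simp add: run)
  with relation show ?case unfolding cls_act by blast
qed simp_all

text \<open>Preimages of the letters: c is sent to cc = d, and conjugating d by the inverses of s
  and t returns a and b. The preimage of c is the product of those of a and b.\<close>

fun source :: "wgen \<times> bool \<Rightarrow> wgen word" where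
  "source (ga, e) = [pos gs, (gc, e), neg gs]"
| "source (gb, e) = [pos gt, (gc, e), neg gt]"
| "source (gc, e) = [pos gs, (gc, e), neg gs, pos gt, (gc, e), neg gt]"
| "source (gd, e) = [(gc, e)]"
| "source (gs, e) = [(gs, e)]"
| "source (gt, e) = [(gt, e)]"

lemma subst_source: "cls (subst (source (x, e))) = cls [(x, e)]"
  unfolding cls_act by (cases x; cases e) (simp_all add: run)

definition wise_endo :: "wgen word set \<Rightarrow> wgen word set" where
  "wise_endo P = cls (subst (SOME w. cls w = P))"

lemma wise_endo_cls: "wise_endo (cls w) = cls (subst w)"
proof -
  have "cls (SOME v. cls v = cls w) = cls w" by (rule someI) simp
  then show ?thesis unfolding wise_endo_def by (intro subst_cong) (simp add: pres_class_eq_iff)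
qed

definition kernel_word :: "wgen word" where
  "kernel_word = [pos gs, pos gc, neg gs, pos gt, pos gc, neg gt, pos gs, neg gc, neg gs, pos gt, neg gc, neg gt]"

text \<open>The image is the commutator of a and b. The word itself is reduced: (1,1) is off the
  d-line through the origin, so s and its inverse around c do not cancel, and the adjacent s- and
  t-crossings use different strips. Hence every crossing opens a new frame.\<close>

lemma kernel_word: "cls (subst kernel_word) = cls []" "cls kernel_word \<noteq> cls []"
  unfolding cls_act kernel_word_def by (simp_all add: run)

lemma non_Hopfian_G_W: "non_Hopfian G_W"
  unfolding non_Hopfian_def
proof (intro conjI bexI[of _ wise_endo])
  show "group G_W" by (rule G_W.is_group)
  show "\<not> inj_on wise_endo (carrier G_W)"
  proof
    assume inj: "inj_on wise_endo (carrier G_W)"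
    have "wise_endo (cls kernel_word) = wise_endo (cls [])" by (simp add: wise_endo_cls kernel_word)
    from inj_onD[OF inj this cls_closed cls_closed] show False using kernel_word(2) by simp
  qed
  have "wise_endo \<in> hom G_W G_W"
    by (rule homI) (auto simp: G_W_carrier wise_endo_cls G_W_mult)
  moreover have "\<exists>v. cls w = cls (subst v)" for w
  proof (induction w rule: rev_induct)
    case Nil
    show ?case by (intro exI[of _ "[]"]) simp
  next
    case (snoc l w)
    then obtain v where v: "cls w = cls (subst v)" by blast
    obtain x e where l: "l = (x, e)" by (cases l)
    have "cls (w @ [l]) = cls (subst (v @ source l))"
      using v subst_source[of x e] by (simp add: G_W_mult[symmetric] l)
    then show ?case by blast
  qed
  then have "cls w \<in> wise_endo ` range cls" for w
    using wise_endo_cls by (metis rangeI image_eqI)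
  then have "carrier G_W \<subseteq> wise_endo ` carrier G_W" unfolding G_W_carrier by blast
  moreover have "wise_endo ` carrier G_W \<subseteq> carrier G_W"
    unfolding G_W_carrier using wise_endo_cls by blast
  ultimately show "wise_endo \<in> epi G_W G_W" unfolding epi_def by blast
qed

theorem corollary4p2:
  shows "almost_convex G_W (wise_elt ` {ga, gb, gc, gd, gs, gt}) \<and> non_Hopfian G_W"
  using almost_convex_G_W non_Hopfian_G_W by blast

end
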